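(* Let $k\ge 2$. For $j=1,\ldots,k$, suppose we are given a random sample (i.i.d.) of size $n_j$ from a cumulative distribution function $F_j$ on $\mathbb{R}$, the $k$ samples being independent. Let $n=n_1+\cdots+n_k$ and suppose the proportions $w_j=n_j/n$ remain fixed as $n\to\infty$, with $0<w_j<1$ for all $j$. Let $\hat F$ be the empirical cdf of the pooled sample, let $\mathcal{R}(x)$ be the localized empirical likelihood ratio defined in the context, and let $$T_n = -2\int_{-\infty}^{\infty} \log \mathcal{R}(x)\, d\hat F(x).$$ Then under the null hypothesis $H_0: F_1=\cdots=F_k$, and assuming that the common distribution function $F$ is continuous, as $n\to\infty$, $$T_n \stackrel{d}{\rightarrow} \sum_{j=1}^k w_j \int_0^1 \frac{\bigl(E_{\mathbf{w}}[\mathbf{B}(t)\,|\,\mathcal{I}]_j - \overline{B}(t)\bigr)^2}{t(1-t)}\, dt,$$ where $\mathbf{B} = (B_1/\sqrt{w_1}, B_2/\sqrt{w_2}, \ldots, B_k/\sqrt{w_k})^T$, the processes $B_1, B_2, \ldots, B_k$ are independent standard Brownian bridges on $[0,1]$, $\overline{B} = \sum_{j=1}^k \sqrt{w_j}\, B_j$, and $\stackrel{d}{\rightarrow}$ denotes convergence in distribution.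
   Context: Let $\mathcal{I} = \{\mathbf{z}\in\mathbb{R}^k : z_1\le z_2\le\cdots\le z_k\}$ and $\mathbf{w}=(w_1,\ldots,w_k)$. For $\mathbf{y}\in\mathbb{R}^k$, $E_{\mathbf{w}}(\mathbf{y}|\mathcal{I})$ denotes the weighted least squares projection of $\mathbf{y}$ onto $\mathcal{I}$, i.e. the unique minimizer over $\mathbf{z}\in\mathcal{I}$ of $\sum_{j=1}^k w_j (y_j-z_j)^2$, and $E_{\mathbf{w}}(\mathbf{y}|\mathcal{I})_j$ is its $j$th coordinate. Let $\hat F_j$ be the empirical cdf of the $j$th sample, so that the pooled empirical cdf is $\hat F = \sum_{j=1}^k w_j\hat F_j$. For each $x\in\mathbb{R}$ let $$\tilde F_j(x) = E_{\mathbf{w}}\bigl((\hat F_1(x),\ldots,\hat F_k(x))^T \,\big|\, \mathcal{I}\bigr)_j,\qquad j=1,\ldots,k.$$ The localized empirical likelihood ratio at $x$, for testing $F_1(x)=\cdots=F_k(x)$ against $F_1(x)\le\cdots\le F_k(x)$, is given explicitly by $$\mathcal{R}(x) = \prod_{j=1}^k \left[\frac{\hat F(x)}{\tilde F_j(x)}\right]^{n_j\hat F_j(x)} \left[\frac{1-\hat F(x)}{1-\tilde F_j(x)}\right]^{n_j(1-\hat F_j(x))},$$ with the convention that any term raised to a zero power is set to $1$. This explicit formula is the definition of $\mathcal{R}(x)$ to be used. *)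

theory Defs
  imports "HOL-Probability.Probability"
begin

section \<open>Weighted isotonic regression\<close>

text \<open>Vectors of length k are elements of \<^typ>\<open>real ^ 'k\<close>, where \<open>'k\<close> is a finite linearly ordered
  index type with k elements.\<close>

definition isotonic_cone :: "(real ^ 'k::{finite,linorder}) set" where
  "isotonic_cone = {z. \<forall>i j. i \<le> j \<longrightarrow> z $ i \<le> z $ j}"

definition weighted_projection ::
    "real ^ 'k \<Rightarrow> (real ^ 'k) set \<Rightarrow> real ^ 'k::finite \<Rightarrow> real ^ 'k" where
  "weighted_projection w I y =
     (THE z. is_arg_min (\<lambda>z. \<Sum>j\<in>UNIV. w $ j * (y $ j - z $ j)\<^sup>2) (\<lambda>z. z \<in> I) z)"

lemma ex1_weighted_projection_isotonic_cone:
  fixes w y :: "real ^ 'k::{finite,linorder}"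
  assumes w: "\<And>j. 0 < w $ j"
  shows "\<exists>!z. is_arg_min (\<lambda>z. \<Sum>j\<in>UNIV. w $ j * (y $ j - z $ j)\<^sup>2) (\<lambda>z. z \<in> isotonic_cone) z"
proof -
  define s :: "(real, 'k) vec \<Rightarrow> (real, 'k) vec" where "s z = (\<chi> j. sqrt (w $ j) * z $ j)" for z
  define S where "S = {u :: (real, 'k) vec. \<forall>i j. i \<le> j \<longrightarrow> u $ i / sqrt (w $ i) \<le> u $ j / sqrt (w $ j)}"
  have w0: "w $ j \<noteq> 0" "w $ j \<ge> 0" for j using w[of j] by auto
  have sS: "s z \<in> S \<longleftrightarrow> z \<in> isotonic_cone" for z
    by (simp add: s_def S_def isotonic_cone_def w0)
  have S_eq: "S = (\<Inter>i. \<Inter>j. {u. i \<le> j \<longrightarrow> u $ i / sqrt (w $ i) \<le> u $ j / sqrt (w $ j)})"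
    by (auto simp: S_def)
  have "closed {u :: (real, 'k) vec. i \<le> j \<longrightarrow> u $ i / sqrt (w $ i) \<le> u $ j / sqrt (w $ j)}" for i j
    by (cases "i \<le> j") (auto intro!: closed_Collect_le continuous_intros simp: w0)
  then have cl: "closed S" unfolding S_eq by blast
  have cv: "convex S"
    unfolding convex_def S_def
    by (auto simp: add_divide_distrib simp flip: times_divide_eq_right intro!: add_mono mult_left_mono)
  have ne: "S \<noteq> {}" by (auto simp: S_def intro!: exI[of _ 0])
  have dst: "(\<Sum>j\<in>UNIV. w $ j * (y $ j - z $ j)\<^sup>2) = (dist (s y) (s z))\<^sup>2" for z
  proof -
    have "(dist (s y) (s z))\<^sup>2 = (\<Sum>j\<in>UNIV. (sqrt (w $ j) * y $ j - sqrt (w $ j) * z $ j)\<^sup>2)"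
      by (simp add: dist_vec_def L2_set_def dist_real_def sum_nonneg s_def)
    then show ?thesis
      by (simp add: power_mult_distrib w0 flip: right_diff_distrib)
  qed
  have surj: "\<exists>z. s z = u" for u
    by (rule exI[of _ "\<chi> j. u $ j / sqrt (w $ j)"]) (simp add: s_def vec_eq_iff w0)
  have inj: "s z = s z' \<Longrightarrow> z = z'" for z z'
    by (simp add: s_def vec_eq_iff w0)
  have arg: "is_arg_min (\<lambda>z. \<Sum>j\<in>UNIV. w $ j * (y $ j - z $ j)\<^sup>2) (\<lambda>z. z \<in> isotonic_cone) z
      \<longleftrightarrow> s z \<in> S \<and> (\<forall>u\<in>S. dist (s y) (s z) \<le> dist (s y) u)" for z
    unfolding is_arg_min_def dst sS[symmetric] not_ex de_Morgan_conj
    by (metis surj abs_le_square_iff abs_of_nonneg zero_le_dist not_less)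
  obtain z where z: "s z = closest_point S (s y)" using surj by blast
  show ?thesis
    unfolding arg
  proof (rule ex1I[of _ z])
    show "s z \<in> S \<and> (\<forall>u\<in>S. dist (s y) (s z) \<le> dist (s y) u)"
      using closest_point_exists[OF cl ne, of "s y"] z by simp
    then show "x = z" if "s x \<in> S \<and> (\<forall>u\<in>S. dist (s y) (s x) \<le> dist (s y) u)" for x
      using any_closest_point_unique[OF cv cl, of "s x" "s z" "s y"] that inj by blast
  qed
qed

section \<open>Empirical distribution functions and the localized likelihood ratio\<close>

definition ecdf :: "'i set \<Rightarrow> ('i \<Rightarrow> real) \<Rightarrow> real \<Rightarrow> real" where
  "ecdf I u x = real (card {i \<in> I. u i \<le> x}) / real (card I)"

text \<open>A collection of samples is given by the sample sizes \<open>N j\<close> and the observations \<open>X j i\<close> with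
  \<open>i < N j\<close>; values \<open>X j i\<close> with \<open>i \<ge> N j\<close> are never used.\<close>

definition sample_ecdf :: "('k \<Rightarrow> nat) \<Rightarrow> ('k \<Rightarrow> nat \<Rightarrow> real) \<Rightarrow> 'k \<Rightarrow> real \<Rightarrow> real" where
  "sample_ecdf N X j = ecdf {..<N j} (X j)"

definition pooled_ecdf :: "('k \<Rightarrow> nat) \<Rightarrow> ('k \<Rightarrow> nat \<Rightarrow> real) \<Rightarrow> real \<Rightarrow> real" where
  "pooled_ecdf N X = ecdf (SIGMA j:UNIV. {..<N j}) (\<lambda>(j, i). X j i)"

lemma pooled_ecdf_eq:
  fixes N :: "'k::finite \<Rightarrow> nat"
  assumes w: "\<And>j. w $ j = real (N j) / real (\<Sum>j\<in>UNIV. N j)" and N: "\<And>j. 0 < N j"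
  shows "pooled_ecdf N X x = (\<Sum>j\<in>UNIV. w $ j * sample_ecdf N X j x)"
proof -
  have "{p \<in> SIGMA j:UNIV. {..<N j}. (case p of (j, i) \<Rightarrow> X j i) \<le> x}
      = (SIGMA j:UNIV. {i \<in> {..<N j}. X j i \<le> x})"
    by auto
  moreover have "real (N j) \<noteq> 0" for j using N[of j] by simp
  ultimately show ?thesis
    by (simp add: pooled_ecdf_def sample_ecdf_def ecdf_def w card_SigmaI sum_divide_distrib)
qed

definition isotonized_ecdf ::
    "real ^ 'k::{finite,linorder} \<Rightarrow> ('k \<Rightarrow> nat) \<Rightarrow> ('k \<Rightarrow> nat \<Rightarrow> real) \<Rightarrow> 'k \<Rightarrow> real \<Rightarrow> real" where
  "isotonized_ecdf w N X j x =
     weighted_projection w isotonic_cone (\<chi> i. sample_ecdf N X i x) $ j"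

text \<open>Real powers in which a zero exponent always gives 1; in contrast, \<^term>\<open>0 powr 0 = (0::real)\<close>.\<close>

definition rpow :: "real \<Rightarrow> real \<Rightarrow> real" where
  "rpow b e = (if e = 0 then 1 else b powr e)"

definition localized_likelihood_ratio ::
    "real ^ 'k::{finite,linorder} \<Rightarrow> ('k \<Rightarrow> nat) \<Rightarrow> ('k \<Rightarrow> nat \<Rightarrow> real) \<Rightarrow> real \<Rightarrow> real" where
  "localized_likelihood_ratio w N X x =
     (\<Prod>j\<in>UNIV.
        rpow (pooled_ecdf N X x / isotonized_ecdf w N X j x)
             (real (N j) * sample_ecdf N X j x) *
        rpow ((1 - pooled_ecdf N X x) / (1 - isotonized_ecdf w N X j x))
             (real (N j) * (1 - sample_ecdf N X j x)))"

text \<open>The integrator is the Lebesgue--Stieltjes measure of the pooled empirical cdf.\<close>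

definition test_statistic ::
    "real ^ 'k::{finite,linorder} \<Rightarrow> ('k \<Rightarrow> nat) \<Rightarrow> ('k \<Rightarrow> nat \<Rightarrow> real) \<Rightarrow> real" where
  "test_statistic w N X =
     - 2 * (LINT x|interval_measure (pooled_ecdf N X). ln (localized_likelihood_ratio w N X x))"

section \<open>Brownian bridges\<close>

text \<open>Point masses count as (degenerate) normal distributions.\<close>

definition gaussian_rv :: "'a measure \<Rightarrow> ('a \<Rightarrow> real) \<Rightarrow> bool" where
  "gaussian_rv P Y \<longleftrightarrow> Y \<in> borel_measurable P \<and>
     (\<exists>\<mu>. (AE \<omega> in P. Y \<omega> = \<mu>) \<or> (\<exists>\<sigma>>0. distributed P lborel Y (normal_density \<mu> \<sigma>)))"

definition gaussian_process :: "'a measure \<Rightarrow> 't set \<Rightarrow> ('t \<Rightarrow> 'a \<Rightarrow> real) \<Rightarrow> bool" where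
  "gaussian_process P T Y \<longleftrightarrow>
     (\<forall>S c. finite S \<longrightarrow> S \<subseteq> T \<longrightarrow> gaussian_rv P (\<lambda>\<omega>. \<Sum>t\<in>S. c t * Y t \<omega>))"

definition brownian_bridge :: "'a measure \<Rightarrow> (real \<Rightarrow> 'a \<Rightarrow> real) \<Rightarrow> bool" where
  "brownian_bridge P B \<longleftrightarrow>
     gaussian_process P {0..1} B \<and>
     (\<forall>t\<in>{0..1}. (LINT \<omega>|P. B t \<omega>) = 0) \<and>
     (\<forall>s\<in>{0..1}. \<forall>t\<in>{0..1}. (LINT \<omega>|P. B s \<omega> * B t \<omega>) = min s t - s * t) \<and>
     (\<forall>\<omega>\<in>space P. continuous_on {0..1} (\<lambda>t. B t \<omega>))"

text \<open>Processes are independent if they are independent as random elements of the product space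
  of real functions on \<open>T\<close>.\<close>

definition indep_processes ::
    "'a measure \<Rightarrow> 't set \<Rightarrow> ('k \<Rightarrow> 't \<Rightarrow> 'a \<Rightarrow> real) \<Rightarrow> bool" where
  "indep_processes P T B \<longleftrightarrow>
     prob_space.indep_vars P (\<lambda>_. PiM T (\<lambda>_. borel)) (\<lambda>j \<omega>. \<lambda>t\<in>T. B j t \<omega>) UNIV"

text \<open>The inner integrals are almost surely finite, because the expectation of the sum of the
  numerators is bounded by a multiple of \<open>t * (1 - t)\<close>.\<close>

definition limit_variable ::
    "real ^ 'k::{finite,linorder} \<Rightarrow> ('k \<Rightarrow> real \<Rightarrow> 'a \<Rightarrow> real) \<Rightarrow> 'a \<Rightarrow> real" where
  "limit_variable w B \<omega> =
     (\<Sum>j\<in>UNIV. w $ j *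
        (LBINT t=0..1.
           (weighted_projection w isotonic_cone (\<chi> i. B i t \<omega> / sqrt (w $ i)) $ j
            - (\<Sum>i\<in>UNIV. sqrt (w $ i) * B i t \<omega>))\<^sup>2
           / (t * (1 - t))))"

end

theory Submission
  imports Defs
begin

text \<open>
  On each level set of the isotonic projection \<open>z\<close> of \<open>y\<close>, the value of \<open>z\<close> is the weighted mean of \<open>y\<close>.
  Therefore \<open>- 2 ln R(x)\<close> equals \<open>2 n \<Sum>\<^sub>j w\<^sub>j KL(z\<^sub>j, m)\<close> with the Kullback--Leibler divergence of Bernoulli
  distributions and the pooled value \<open>m\<close>, and to leading order it is \<open>n \<Sum>\<^sub>j w\<^sub>j (z\<^sub>j - m)\<^sup>2 / (m (1 - m))\<close>.
  Almost surely there are no ties, and the statistic is the average of these terms over the ranks.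

  No functional limit theorem is used. Both the statistic and the limit are integrals over \<open>(0, 1)\<close> and
  are approximated in \<open>L\<^sup>1\<close>, uniformly in \<open>n\<close>, by the same Riemann sum over a finite mesh; a Riemann sum
  is a continuous function of finitely many values of the empirical distribution functions (for the
  statistic) or of the bridges (for the limit), for which the multivariate central limit theorem suffices.
  The moment bounds at random ranks follow from exchangeability of the pooled sample. Continuous
  functions of random vectors are reduced to characteristic functions by approximating them by
  trigonometric polynomials.
\<close>

section \<open>Projection onto the isotonic cone\<close>

text \<open>Two obstacles shape the argument: the weight 1/(t(1-t)) is singular at both ends, and
  the ratio is evaluated at random order statistics rather than at fixed points. Near the ends no
  expansion of the logarithm is possible; there the divergence is bounded by the chi-square
  distance, which needs no margin, and the exact variance factor r(n-r)/(n(n-1)) of rank counts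
  cancels the weight. Every rank then has a bounded expected contribution, and a strip of width a/K
  at each end costs only O(a/K). In the interior, the vector at rank r is compared with the vector
  at a fixed quantile: two nested lower sets differ in about sqrt n observations, so the squared
  distance of the centered vectors has expectation of order n^(-3/2) instead of 1/n. This also
  controls the cubic remainder of the divergence: for rank vectors only second moments are computed,
  so their third moment is split between this small difference and the fixed-quantile vector, whose
  fourth moments are those of independent sums. The margin from the endpoints is fixed before the
  mesh is refined, so negative powers of the margin are harmless.\<close>

locale weights =
  fixes w :: "real ^ 'k::{finite,linorder}"
  assumes weight_pos: "\<And>j. 0 < w $ j"
    and sum_weights: "(\<Sum>j\<in>UNIV. w $ j) = 1"
begin

lemma weight_nonneg: "0 \<le> w $ j"
  using weight_pos[of j] by simp

definition proj :: "(real, 'k) vec \<Rightarrow> (real, 'k) vec" where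
  "proj = weighted_projection w isotonic_cone"

definition wmean :: "(real, 'k) vec \<Rightarrow> real" where
  "wmean v = (\<Sum>j\<in>UNIV. w $ j * v $ j)"

definition wsq :: "(real, 'k) vec \<Rightarrow> real" where
  "wsq v = (\<Sum>j\<in>UNIV. w $ j * (v $ j)\<^sup>2)"

definition center :: "(real, 'k) vec \<Rightarrow> (real, 'k) vec" where
  "center v = (\<chi> j. v $ j - wmean v)"

text \<open>Common core of statistic and limit: \<open>n * iso_dev y / (m * (1 - m))\<close> is the
  leading term of \<open>-2 ln R\<close> for the vector \<open>y\<close> of empirical values with
  pooled value \<open>m\<close>, and at the vector of scaled bridges \<open>iso_dev\<close> is the
  numerator of the limit integrand, summed over \<open>j\<close> with weights.\<close>

definition iso_dev :: "(real, 'k) vec \<Rightarrow> real" where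
  "iso_dev v = (\<Sum>j\<in>UNIV. w $ j * (proj v $ j - wmean v)\<^sup>2)"

section \<open>First-order optimality and level sets of the projection\<close>

lemma proj_arg_min:
  "is_arg_min (\<lambda>z. \<Sum>j\<in>UNIV. w $ j * (y $ j - z $ j)\<^sup>2) (\<lambda>z. z \<in> isotonic_cone) (proj y)"
  unfolding proj_def weighted_projection_def
  by (rule theI'[OF ex1_weighted_projection_isotonic_cone[OF weight_pos]])

lemma proj_mem: "proj y \<in> isotonic_cone"
  using proj_arg_min unfolding is_arg_min_def by blast

lemma proj_least:
  "v \<in> isotonic_cone \<Longrightarrow>
    (\<Sum>j\<in>UNIV. w $ j * (y $ j - proj y $ j)\<^sup>2) \<le> (\<Sum>j\<in>UNIV. w $ j * (y $ j - v $ j)\<^sup>2)"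
  using proj_arg_min unfolding is_arg_min_def by (meson not_less)

lemma proj_unique:
  assumes "z \<in> isotonic_cone"
    and "\<And>v. v \<in> isotonic_cone \<Longrightarrow>
      (\<Sum>j\<in>UNIV. w $ j * (y $ j - z $ j)\<^sup>2) \<le> (\<Sum>j\<in>UNIV. w $ j * (y $ j - v $ j)\<^sup>2)"
  shows "z = proj y"
proof -
  have "is_arg_min (\<lambda>z. \<Sum>j\<in>UNIV. w $ j * (y $ j - z $ j)\<^sup>2) (\<lambda>z. z \<in> isotonic_cone) z"
    using assms unfolding is_arg_min_def by (meson not_less)
  then show ?thesis
    using ex1_weighted_projection_isotonic_cone[of w y, OF weight_pos] proj_arg_min[of y] by blast
qed

lemma linear_part_nonpos:
  fixes a b e :: real
  assumes e: "0 < e" and h: "\<And>t. 0 < t \<Longrightarrow> t \<le> e \<Longrightarrow> 2 * t * a \<le> t\<^sup>2 * b"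
  shows "a \<le> 0"
proof (rule ccontr)
  assume "\<not> a \<le> 0"
  then have a: "0 < a" by simp
  \<comment> \<open>With this \<open>t\<close> the quadratic term, after division by
    \<open>t\<close>, is at most \<open>a\<close>, against \<open>2 * a\<close> on the left.\<close>
  define t where "t = min e (a / (\<bar>b\<bar> + 1))"
  have t: "0 < t" "t \<le> e" using a e by (auto simp: t_def)
  have "2 * a \<le> t * b" using h[OF t] t by (simp add: power2_eq_square)
  also have "\<dots> \<le> t * (\<bar>b\<bar> + 1)" using t by (intro mult_left_mono) auto
  also have "\<dots> \<le> a / (\<bar>b\<bar> + 1) * (\<bar>b\<bar> + 1)" by (intro mult_right_mono) (auto simp: t_def)
  also have "\<dots> = a" by simp
  finally show False using a by simp
qed

text \<open>First-order optimality along any direction in which a short segment stays inside the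
  cone. It serves both for directions towards other points of the cone and for moving level
  sets.\<close>

lemma proj_perturb:
  fixes d :: "(real, 'k) vec"
  assumes e: "0 < e" and mem: "\<And>t. 0 < t \<Longrightarrow> t \<le> e \<Longrightarrow> proj y + t *\<^sub>R d \<in> isotonic_cone"
  shows "(\<Sum>j\<in>UNIV. w $ j * (y $ j - proj y $ j) * d $ j) \<le> 0"
proof (rule linear_part_nonpos[OF e])
  fix t :: real assume t: "0 < t" "t \<le> e"
  have "w $ j * (y $ j - (proj y $ j + t * d $ j))\<^sup>2 = w $ j * (y $ j - proj y $ j)\<^sup>2
      - 2 * t * (w $ j * (y $ j - proj y $ j) * d $ j) + t\<^sup>2 * (w $ j * (d $ j)\<^sup>2)" for j
    by (simp add: power2_eq_square algebra_simps)
  then have "(\<Sum>j\<in>UNIV. w $ j * (y $ j - (proj y + t *\<^sub>R d) $ j)\<^sup>2) =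
      (\<Sum>j\<in>UNIV. w $ j * (y $ j - proj y $ j)\<^sup>2)
      - 2 * t * (\<Sum>j\<in>UNIV. w $ j * (y $ j - proj y $ j) * d $ j) + t\<^sup>2 * (\<Sum>j\<in>UNIV. w $ j * (d $ j)\<^sup>2)"
    by (simp add: sum.distrib sum_subtractf sum_distrib_left)
  with proj_least[OF mem[OF t], of y]
  show "2 * t * (\<Sum>j\<in>UNIV. w $ j * (y $ j - proj y $ j) * d $ j)
      \<le> t\<^sup>2 * (\<Sum>j\<in>UNIV. w $ j * (d $ j)\<^sup>2)"
    by linarith
qed

text \<open>By convexity the whole segment from the projection to \<open>v\<close> stays inside the
  cone, so \<open>v - proj y\<close> is an admissible direction with step 1.\<close>

lemma proj_variational:
  assumes v: "v \<in> isotonic_cone"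
  shows "(\<Sum>j\<in>UNIV. w $ j * (y $ j - proj y $ j) * (v $ j - proj y $ j)) \<le> 0"
proof -
  have "(\<Sum>j\<in>UNIV. w $ j * (y $ j - proj y $ j) * (v - proj y) $ j) \<le> 0"
  proof (rule proj_perturb[of 1])
    fix t :: real assume t: "0 < t" "t \<le> 1"
    have "proj y $ i + t * (v $ i - proj y $ i) \<le> proj y $ j + t * (v $ j - proj y $ j)" if "i \<le> j" for i j
    proof -
      have "(1 - t) * proj y $ i + t * v $ i \<le> (1 - t) * proj y $ j + t * v $ j"
        using t that v proj_mem[of y] unfolding isotonic_cone_def
        by (intro add_mono mult_left_mono) auto
      then show ?thesis by (simp add: algebra_simps)
    qed
    then show "proj y + t *\<^sub>R (v - proj y) \<in> isotonic_cone"
      by (simp add: isotonic_cone_def)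
  qed simp
  then show ?thesis by simp
qed

text \<open>Moving a level set of the projection by a small amount in either direction stays inside the cone,
  so the variational inequality holds with both signs.\<close>

lemma proj_level_sets:
  "(\<Sum>j\<in>UNIV. w $ j * (y $ j - proj y $ j) * h (proj y $ j)) = 0"
proof -
  have le: "(\<Sum>j\<in>UNIV. w $ j * (y $ j - proj y $ j) * h (proj y $ j)) \<le> 0" for h :: "real \<Rightarrow> real"
  proof -
    let ?z = "proj y"
    define H where "H = (\<Sum>j\<in>UNIV. \<bar>h (?z $ j)\<bar>) + 1"
    \<comment> \<open>A lower bound for the gaps between distinct values of the projection; the
      inserted 1 keeps the minimum defined when all values coincide.\<close>
    define g where "g = Min (insert 1 {?z $ j - ?z $ i | i j. ?z $ i < ?z $ j})"
    have fin: "finite (insert 1 {?z $ j - ?z $ i | i j. ?z $ i < ?z $ j})"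
      by (rule finite_subset[of _ "insert 1 ((\<lambda>(i,j). ?z $ j - ?z $ i) ` UNIV)"]) auto
    have g: "0 < g" unfolding g_def by (subst Min_gr_iff[OF fin]) auto
    have gle: "g \<le> ?z $ j - ?z $ i" if "?z $ i < ?z $ j" for i j
      unfolding g_def by (rule Min_le[OF fin]) (use that in auto)
    have H: "\<bar>h (?z $ j)\<bar> \<le> H" for j
      using member_le_sum[of j UNIV "\<lambda>j. \<bar>h (?z $ j)\<bar>"] by (simp add: H_def)
    have H0: "0 < H" unfolding H_def by (intro add_nonneg_pos sum_nonneg) auto
    have "(\<Sum>j\<in>UNIV. w $ j * (y $ j - ?z $ j) * (\<chi> j. h (?z $ j)) $ j) \<le> 0"
    proof (rule proj_perturb[of "g / (2 * H)"])
      show "0 < g / (2 * H)" using g H0 by simp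
      fix t :: real assume t: "0 < t" "t \<le> g / (2 * H)"
      \<comment> \<open>Coordinates on one level set move together. Two distinct levels approach
        each other by at most \<open>2 * H * t\<close>, hence by at most the gap \<open>g\<close>,
        so the order is preserved.\<close>
      have "?z $ i + t * h (?z $ i) \<le> ?z $ j + t * h (?z $ j)" if "i \<le> j" for i j
      proof (cases "?z $ i = ?z $ j")
        case False
        then have lt: "?z $ i < ?z $ j"
          using that proj_mem[of y] unfolding isotonic_cone_def by (auto simp: less_le)
        have "t * (h (?z $ i) - h (?z $ j)) \<le> t * (2 * H)"
          using t H[of i] H[of j] by (intro mult_left_mono) auto
        also have "\<dots> \<le> g / (2 * H) * (2 * H)"
          using t H0 by (intro mult_right_mono) auto
        also have "\<dots> = g" using H0 by simp
        finally show ?thesis using gle[OF lt] by (simp add: algebra_simps)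
      qed simp
      then show "?z + t *\<^sub>R (\<chi> j. h (?z $ j)) \<in> isotonic_cone"
        by (simp add: isotonic_cone_def)
    qed
    then show ?thesis by simp
  qed
  from le[of h] le[of "\<lambda>x. - h x"] show ?thesis by (simp add: sum_negf)
qed

lemma proj_block:
  "(\<Sum>j | proj y $ j = c. w $ j * y $ j) = (\<Sum>j | proj y $ j = c. w $ j * c)"
proof -
  have "(\<Sum>j\<in>UNIV. w $ j * (y $ j - proj y $ j) * (if proj y $ j = c then 1 else 0)) = 0"
    by (rule proj_level_sets)
  then have "(\<Sum>j\<in>UNIV. if proj y $ j = c then w $ j * y $ j - w $ j * c else 0) = 0"
    by (simp add: if_distrib cong: if_cong) (simp add: algebra_simps cong: if_cong)
  then show ?thesis
    by (simp add: sum.If_cases sum_subtractf)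
qed

text \<open>A level strictly below all the data would contradict \<open>proj_block\<close>, since
  the weighted mean of the data over its level set would exceed the level.\<close>

lemma proj_ge:
  assumes "\<And>j. a \<le> y $ j" shows "a \<le> proj y $ i"
proof (rule ccontr)
  assume "\<not> a \<le> proj y $ i"
  then have c: "proj y $ i < a" by simp
  have "(\<Sum>j | proj y $ j = proj y $ i. w $ j * proj y $ i) < (\<Sum>j | proj y $ j = proj y $ i. w $ j * y $ j)"
    by (rule sum_strict_mono) (use c assms weight_pos in \<open>auto intro!: mult_strict_left_mono intro: less_le_trans\<close>)
  then show False by (simp add: proj_block)
qed

lemma proj_le:
  assumes "\<And>j. y $ j \<le> b" shows "proj y $ i \<le> b"
proof (rule ccontr)
  assume "\<not> proj y $ i \<le> b"
  then have c: "b < proj y $ i" by simp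
  have "(\<Sum>j | proj y $ j = proj y $ i. w $ j * y $ j) < (\<Sum>j | proj y $ j = proj y $ i. w $ j * proj y $ i)"
    by (rule sum_strict_mono) (use c assms weight_pos in \<open>auto intro!: mult_strict_left_mono intro: le_less_trans\<close>)
  then show False by (simp add: proj_block)
qed

text \<open>A weighted mean of values that are at least \<open>a\<close> equals \<open>a\<close>
  only if all of them do. In the likelihood ratio this makes the exponent zero wherever a
  denominator vanishes.\<close>

lemma proj_eq_lower:
  assumes "\<And>j. a \<le> y $ j" "proj y $ i = a" shows "y $ i = a"
proof -
  have "(\<Sum>j | proj y $ j = a. w $ j * (y $ j - a)) = 0"
    using proj_block[of y a] by (simp add: right_diff_distrib sum_subtractf)
  then have "\<forall>j\<in>{j. proj y $ j = a}. w $ j * (y $ j - a) = 0"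
    by (subst (asm) sum_nonneg_eq_0_iff) (simp_all add: weight_nonneg assms(1))
  then show ?thesis using assms(2) weight_pos[of i] by auto
qed

lemma proj_eq_upper:
  assumes "\<And>j. y $ j \<le> b" "proj y $ i = b" shows "y $ i = b"
proof -
  have "(\<Sum>j | proj y $ j = b. w $ j * (b - y $ j)) = 0"
    using proj_block[of y b] by (simp add: right_diff_distrib sum_subtractf)
  then have "\<forall>j\<in>{j. proj y $ j = b}. w $ j * (b - y $ j) = 0"
    by (subst (asm) sum_nonneg_eq_0_iff) (simp_all add: weight_nonneg assms(1))
  then show ?thesis using assms(2) weight_pos[of i] by auto
qed

section \<open>Equivariance under shifts and scalings, and contraction in the weighted norm\<close>

lemma proj_shift: "proj (\<chi> j. y $ j + c) $ i = proj y $ i + c"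
proof -
  have "(\<chi> j. proj y $ j + c) = proj (\<chi> j. y $ j + c)"
  proof (rule proj_unique)
    show "(\<chi> j. proj y $ j + c) \<in> isotonic_cone"
      using proj_mem[of y] by (simp add: isotonic_cone_def)
    fix v :: "(real, 'k) vec" assume v: "v \<in> isotonic_cone"
    then have "(\<chi> j. v $ j - c) \<in> isotonic_cone" by (simp add: isotonic_cone_def)
    from proj_least[OF this, of y]
    show "(\<Sum>j\<in>UNIV. w $ j * ((\<chi> j. y $ j + c) $ j - (\<chi> j. proj y $ j + c) $ j)\<^sup>2)
        \<le> (\<Sum>j\<in>UNIV. w $ j * ((\<chi> j. y $ j + c) $ j - v $ j)\<^sup>2)"
      by (simp add: algebra_simps)
  qed
  then show ?thesis by (simp add: vec_eq_iff)
qed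

lemma proj_scale:
  assumes c: "0 < c" shows "proj (c *\<^sub>R y) = c *\<^sub>R proj y"
proof (rule sym, rule proj_unique)
  show "c *\<^sub>R proj y \<in> isotonic_cone"
    using proj_mem[of y] c by (simp add: isotonic_cone_def)
  fix v :: "(real, 'k) vec" assume v: "v \<in> isotonic_cone"
  then have "(1 / c) *\<^sub>R v \<in> isotonic_cone" using c by (simp add: isotonic_cone_def divide_right_mono)
  from proj_least[OF this, of y]
  have "c\<^sup>2 * (\<Sum>j\<in>UNIV. w $ j * (y $ j - proj y $ j)\<^sup>2)
      \<le> c\<^sup>2 * (\<Sum>j\<in>UNIV. w $ j * (y $ j - ((1 / c) *\<^sub>R v) $ j)\<^sup>2)"
    by (intro mult_left_mono) auto
  moreover have "c\<^sup>2 * (w $ j * (y $ j - proj y $ j)\<^sup>2) = w $ j * ((c *\<^sub>R y) $ j - (c *\<^sub>R proj y) $ j)\<^sup>2" for j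
    by (simp add: power_mult_distrib flip: right_diff_distrib)
  moreover have "c\<^sup>2 * (w $ j * (y $ j - ((1 / c) *\<^sub>R v) $ j)\<^sup>2) = w $ j * ((c *\<^sub>R y) $ j - v $ j)\<^sup>2" for j
  proof -
    have "c\<^sup>2 * (y $ j - v $ j / c)\<^sup>2 = (c * (y $ j - v $ j / c))\<^sup>2" by (simp add: power_mult_distrib)
    also have "c * (y $ j - v $ j / c) = c * y $ j - v $ j" using c by (simp add: field_simps)
    finally show ?thesis by simp
  qed
  ultimately show "(\<Sum>j\<in>UNIV. w $ j * ((c *\<^sub>R y) $ j - (c *\<^sub>R proj y) $ j)\<^sup>2)
      \<le> (\<Sum>j\<in>UNIV. w $ j * ((c *\<^sub>R y) $ j - v $ j)\<^sup>2)"
    by (simp only: sum_distrib_left)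
qed

lemma wsq_nonneg: "0 \<le> wsq v"
  unfolding wsq_def by (intro sum_nonneg mult_nonneg_nonneg weight_nonneg) auto

lemma wsq_component: "w $ j * (v $ j)\<^sup>2 \<le> wsq v"
  unfolding wsq_def
  by (rule member_le_sum[of j UNIV "\<lambda>j. w $ j * (v $ j)\<^sup>2"])
    (auto intro!: mult_nonneg_nonneg weight_nonneg)

text \<open>Pythagoras: the residual \<open>y - proj y\<close> is orthogonal to
  \<open>proj y\<close>, which is \<open>proj_level_sets\<close> with the identity as
  \<open>h\<close>.\<close>

lemma wsq_proj_le: "wsq (proj y) \<le> wsq y"
proof -
  have "(\<Sum>j\<in>UNIV. w $ j * (y $ j - proj y $ j) * proj y $ j) = 0"
    using proj_level_sets[of y "\<lambda>x. x"] by simp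
  moreover have "w $ j * (y $ j)\<^sup>2 = w $ j * (proj y $ j)\<^sup>2
      + 2 * (w $ j * (y $ j - proj y $ j) * proj y $ j) + w $ j * (y $ j - proj y $ j)\<^sup>2" for j
    by (simp add: power2_eq_square algebra_simps)
  ultimately have "wsq y = wsq (proj y) + (\<Sum>j\<in>UNIV. w $ j * (y $ j - proj y $ j)\<^sup>2)"
    unfolding wsq_def by (simp add: sum.distrib flip: sum_distrib_left)
  moreover have "0 \<le> (\<Sum>j\<in>UNIV. w $ j * (y $ j - proj y $ j)\<^sup>2)"
    by (intro sum_nonneg mult_nonneg_nonneg weight_nonneg) auto
  ultimately show ?thesis by simp
qed

text \<open>Adding the variational inequalities at \<open>y\<close> and \<open>y'\<close> bounds the squared distance of the
  projections by an inner product, which is at most half the sum of the squares.\<close>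

lemma wsq_proj_diff_le: "wsq (proj y - proj y') \<le> wsq (y - y')"
proof -
  have 1: "(\<Sum>j\<in>UNIV. w $ j * (y $ j - proj y $ j) * (proj y' $ j - proj y $ j)) \<le> 0"
    by (rule proj_variational[OF proj_mem])
  have 2: "(\<Sum>j\<in>UNIV. w $ j * (y' $ j - proj y' $ j) * (proj y $ j - proj y' $ j)) \<le> 0"
    by (rule proj_variational[OF proj_mem])
  have "2 * wsq (proj y - proj y')
      - 2 * (\<Sum>j\<in>UNIV. w $ j * (y $ j - proj y $ j) * (proj y' $ j - proj y $ j))
      - 2 * (\<Sum>j\<in>UNIV. w $ j * (y' $ j - proj y' $ j) * (proj y $ j - proj y' $ j))
     = (\<Sum>j\<in>UNIV. w $ j * (2 * (y $ j - y' $ j) * (proj y $ j - proj y' $ j)))"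
    unfolding wsq_def sum_distrib_left sum_subtractf[symmetric]
    by (intro sum.cong) (auto simp: power2_eq_square algebra_simps)
  also have "\<dots> \<le> (\<Sum>j\<in>UNIV. w $ j * ((y $ j - y' $ j)\<^sup>2 + (proj y $ j - proj y' $ j)\<^sup>2))"
    by (intro sum_mono mult_left_mono sum_squares_bound weight_nonneg)
  also have "\<dots> = wsq (y - y') + wsq (proj y - proj y')"
    by (simp add: wsq_def distrib_left sum.distrib)
  finally show ?thesis using 1 2 by linarith
qed

lemma wmean_diff: "wmean (y - y') = wmean y - wmean y'"
  by (simp add: wmean_def right_diff_distrib sum_subtractf)

lemma center_diff: "center (y - y') = center y - center y'"
  by (simp add: center_def wmean_diff vec_eq_iff)

lemma wmean_scale: "wmean (c *\<^sub>R y) = c * wmean y"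
  by (simp add: wmean_def sum_distrib_left mult_ac)

lemma wmean_shift: "wmean (\<chi> j. y $ j + c) = wmean y + c"
  by (simp add: wmean_def distrib_left sum.distrib sum_weights flip: sum_distrib_right)

lemma wsq_center: "wsq (center y) = wsq y - (wmean y)\<^sup>2"
proof -
  have "wsq (center y) = (\<Sum>j\<in>UNIV. w $ j * (y $ j)\<^sup>2 - 2 * wmean y * (w $ j * y $ j) + (wmean y)\<^sup>2 * w $ j)"
    unfolding wsq_def center_def by (intro sum.cong) (auto simp: power2_eq_square algebra_simps)
  also have "\<dots> = wsq y - 2 * wmean y * wmean y + (wmean y)\<^sup>2"
    by (simp only: sum.distrib sum_subtractf sum_distrib_left[symmetric] sum_weights
        wsq_def[symmetric] wmean_def[symmetric] mult_1_right)
  finally show ?thesis by (simp add: power2_eq_square)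
qed

lemma wsq_center_le: "wsq (center y) \<le> wsq y"
  by (simp add: wsq_center)

lemma wsq_scale: "wsq (c *\<^sub>R y) = c\<^sup>2 * wsq y"
  by (simp add: wsq_def sum_distrib_left power_mult_distrib mult_ac)

lemma proj_center: "proj (center y) $ j = proj y $ j - wmean y"
  using proj_shift[of y "- wmean y" j] by (simp add: center_def)

text \<open>Centering commutes with the projection, so the contraction bounds for
  \<open>proj\<close> become bounds for \<open>iso_dev\<close>.\<close>

lemma iso_dev_eq: "iso_dev v = wsq (proj (center v))"
  by (simp add: iso_dev_def wsq_def proj_center)

lemma iso_dev_nonneg: "0 \<le> iso_dev v"
  by (simp add: iso_dev_eq wsq_nonneg)

lemma iso_dev_le: "iso_dev v \<le> wsq (center v)"
  by (simp add: iso_dev_eq wsq_proj_le)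

lemma iso_dev_shift: "iso_dev (\<chi> j. y $ j + c) = iso_dev y"
  by (simp add: iso_dev_def proj_shift wmean_shift)

lemma iso_dev_scale: "0 < c \<Longrightarrow> iso_dev (c *\<^sub>R y) = c\<^sup>2 * iso_dev y"
  by (simp add: iso_dev_def proj_scale wmean_scale sum_distrib_left mult_ac power_mult_distrib
      flip: right_diff_distrib)

text \<open>The free parameter \<open>l\<close> balances a small difference against bounded norms:
  if the difference has second moment of order \<open>d\<close>, the choice
  \<open>l = sqrt d\<close> makes both terms of order \<open>sqrt d\<close> in mean.\<close>

lemma iso_dev_diff:
  assumes l: "0 < l"
  shows "\<bar>iso_dev v - iso_dev v'\<bar>
    \<le> wsq (center (v - v')) / l + l * (wsq (center v) + wsq (center v'))"
proof -
  let ?p = "proj (center v)" and ?q = "proj (center v')"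
  \<comment> \<open>Young's inequality applied to the factorization of the difference of squares
    into \<open>a - b\<close> and \<open>a + b\<close>.\<close>
  have key: "\<bar>a\<^sup>2 - b\<^sup>2\<bar> \<le> (a - b)\<^sup>2 / l + l * (a\<^sup>2 + b\<^sup>2)" for a b :: real
  proof -
    have "0 \<le> (2 * \<bar>a - b\<bar> - l * \<bar>a + b\<bar>)\<^sup>2" by simp
    also have "\<dots> = 4 * (a - b)\<^sup>2 + l\<^sup>2 * (a + b)\<^sup>2 - 4 * l * \<bar>(a - b) * (a + b)\<bar>"
      by (simp add: power2_diff power_mult_distrib abs_mult)
    also have "(a - b) * (a + b) = a\<^sup>2 - b\<^sup>2" by (simp add: power2_eq_square algebra_simps)
    also have "4 * (a - b)\<^sup>2 + l\<^sup>2 * (a + b)\<^sup>2 - 4 * l * \<bar>a\<^sup>2 - b\<^sup>2\<bar>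
        = 4 * l * ((a - b)\<^sup>2 / l + l * ((a + b)\<^sup>2 / 4) - \<bar>a\<^sup>2 - b\<^sup>2\<bar>)"
    proof -
      have "4 * l * ((a - b)\<^sup>2 / l) = 4 * (a - b)\<^sup>2" "4 * l * (l * ((a + b)\<^sup>2 / 4)) = l\<^sup>2 * (a + b)\<^sup>2"
        using l by (simp_all add: power2_eq_square)
      then show ?thesis by (simp only: right_diff_distrib distrib_left)
    qed
    finally have "\<bar>a\<^sup>2 - b\<^sup>2\<bar> \<le> (a - b)\<^sup>2 / l + l * ((a + b)\<^sup>2 / 4)"
      using l by (simp add: zero_le_mult_iff)
    also have "l * ((a + b)\<^sup>2 / 4) \<le> l * (a\<^sup>2 + b\<^sup>2)"
    proof (intro mult_left_mono)
      have "2 * a * b \<le> a\<^sup>2 + b\<^sup>2" by (rule sum_squares_bound)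
      then have "(a + b)\<^sup>2 \<le> 4 * (a\<^sup>2 + b\<^sup>2)"
        by (simp add: power2_sum) (smt (verit) zero_le_power2)
      then show "(a + b)\<^sup>2 / 4 \<le> a\<^sup>2 + b\<^sup>2" by simp
    qed (use l in simp)
    finally show ?thesis by simp
  qed
  have "\<bar>iso_dev v - iso_dev v'\<bar> = \<bar>\<Sum>j\<in>UNIV. w $ j * ((?p $ j)\<^sup>2 - (?q $ j)\<^sup>2)\<bar>"
    by (simp add: iso_dev_eq wsq_def right_diff_distrib sum_subtractf)
  also have "\<dots> \<le> (\<Sum>j\<in>UNIV. w $ j * \<bar>(?p $ j)\<^sup>2 - (?q $ j)\<^sup>2\<bar>)"
    by (rule order_trans[OF sum_abs]) (simp add: abs_mult weight_nonneg)
  also have "\<dots> \<le> (\<Sum>j\<in>UNIV. w $ j * ((?p $ j - ?q $ j)\<^sup>2 / l + l * ((?p $ j)\<^sup>2 + (?q $ j)\<^sup>2)))"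
    by (intro sum_mono mult_left_mono key weight_nonneg)
  also have "\<dots> = wsq (?p - ?q) / l + l * (wsq ?p + wsq ?q)"
    by (simp add: wsq_def distrib_left sum.distrib sum_distrib_left sum_divide_distrib mult_ac)
  also have "\<dots> \<le> wsq (center (v - v')) / l + l * (wsq (center v) + wsq (center v'))"
    using l unfolding center_diff
    by (intro add_mono divide_right_mono mult_left_mono wsq_proj_diff_le wsq_proj_le) auto
  finally show ?thesis .
qed

section \<open>Continuity of the projection and of the squared deviation\<close>

lemma continuous_wsq: "continuous_on UNIV wsq"
  unfolding wsq_def by (intro continuous_intros)

lemma continuous_wmean: "continuous_on UNIV wmean"
  unfolding wmean_def by (intro continuous_intros)

lemma continuous_proj: "continuous_on UNIV (\<lambda>v. proj v $ j)"
  unfolding continuous_on_def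
proof (intro ballI)
  fix v :: "(real, 'k) vec"
  have "((\<lambda>u. wsq (u - v) / w $ j) \<longlongrightarrow> 0) (at v)"
  proof -
    have "isCont (\<lambda>u. wsq (u - v) / w $ j) v"
      unfolding wsq_def by (intro continuous_intros) (use weight_pos[of j] in simp)
    then show ?thesis by (simp add: isCont_def wsq_def)
  qed
  then have "((\<lambda>u. (proj u $ j - proj v $ j)\<^sup>2) \<longlongrightarrow> 0) (at v)"
  proof (rule Lim_null_comparison[rotated], intro always_eventually allI)
    fix u
    have "w $ j * ((proj u - proj v) $ j)\<^sup>2 \<le> wsq (u - v)"
      using wsq_component[of j "proj u - proj v"] wsq_proj_diff_le[of u v] by linarith
    then show "norm ((proj u $ j - proj v $ j)\<^sup>2) \<le> wsq (u - v) / w $ j"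
      using weight_pos[of j] by (simp add: field_simps)
  qed
  then have "((\<lambda>u. sqrt ((proj u $ j - proj v $ j)\<^sup>2)) \<longlongrightarrow> sqrt 0) (at v)"
    by (rule tendsto_real_sqrt)
  then have "((\<lambda>u. proj u $ j - proj v $ j) \<longlongrightarrow> 0) (at v)"
    by (simp add: tendsto_rabs_zero_iff)
  then show "((\<lambda>u. proj u $ j) \<longlongrightarrow> proj v $ j) (at v within UNIV)"
    by (simp add: LIM_zero_iff)
qed

lemma continuous_iso_dev: "continuous_on UNIV iso_dev"
  unfolding iso_dev_def
  by (intro continuous_intros continuous_proj continuous_wmean)

end

section \<open>The Kullback--Leibler divergence of Bernoulli distributions\<close>

text \<open>Vanishing factors in front of the logarithms give the usual values at
  \<open>z = 0\<close> and \<open>z = 1\<close>. At \<open>z = m = 1\<close> the value is 0, which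
  is the case of the largest observation.\<close>

definition bern_kl :: "real \<Rightarrow> real \<Rightarrow> real" where
  "bern_kl z m = z * ln (z / m) + (1 - z) * ln ((1 - z) / (1 - m))"

lemma xlnx_le: "0 \<le> x \<Longrightarrow> x * ln x \<le> x * (x - 1)" for x :: real
  by (cases "x = 0") (auto intro!: mult_left_mono ln_le_minus_one)

lemma xlnx_ge: "0 \<le> x \<Longrightarrow> x - 1 \<le> x * ln x" for x :: real
proof (cases "x = 0")
  case False
  assume "0 \<le> x"
  with False have x: "0 < x" by simp
  have "ln (1 / x) \<le> 1 / x - 1" using x by (intro ln_le_minus_one) auto
  then have "x * (1 - 1 / x) \<le> x * ln x" using x by (intro mult_left_mono) (auto simp: ln_div)
  then show ?thesis using x by (simp add: right_diff_distrib)
qed simp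

lemma mult_ratio_minus_one: "b \<noteq> 0 \<Longrightarrow> b * (a / b - 1) = a - b" for a b :: real
  by (simp add: field_simps)

text \<open>The bound \<open>xlnx_ge\<close> is applied to both probability ratios; the linear terms
  cancel because both distributions have total mass 1.\<close>

lemma bern_kl_nonneg:
  assumes "0 < m" "m < 1" "0 \<le> z" "z \<le> 1" shows "0 \<le> bern_kl z m"
proof -
  have "m * (z / m - 1) = z - m" "(1 - m) * ((1 - z) / (1 - m) - 1) = m - z"
    using assms by (simp_all add: mult_ratio_minus_one)
  moreover have "m * (z / m - 1) + (1 - m) * ((1 - z) / (1 - m) - 1)
      \<le> m * (z / m * ln (z / m)) + (1 - m) * ((1 - z) / (1 - m) * ln ((1 - z) / (1 - m)))"
    using assms by (intro add_mono mult_left_mono xlnx_ge) auto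
  ultimately show ?thesis using assms by (simp add: bern_kl_def)
qed

text \<open>The divergence is at most the chi-square distance. No margin between \<open>m\<close>
  and the endpoints enters, so the bound remains usable at the extreme ranks, where the quadratic
  expansion has no uniform error.\<close>

lemma bern_kl_le:
  assumes "0 < m" "m < 1" "0 \<le> z" "z \<le> 1" shows "bern_kl z m \<le> (z - m)\<^sup>2 / (m * (1 - m))"
proof -
  have "m * (z / m * ln (z / m)) + (1 - m) * ((1 - z) / (1 - m) * ln ((1 - z) / (1 - m)))
    \<le> m * (z / m * (z / m - 1)) + (1 - m) * ((1 - z) / (1 - m) * ((1 - z) / (1 - m) - 1))"
    using assms by (intro add_mono mult_left_mono xlnx_le) auto
  also have "\<dots> = z * (z / m - 1) + (1 - z) * ((1 - z) / (1 - m) - 1)"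
    using assms by simp
  also have "\<dots> = z * (z - m) / m + (1 - z) * (m - z) / (1 - m)"
  proof -
    have "z / m - 1 = (z - m) / m" "(1 - z) / (1 - m) - 1 = (m - z) / (1 - m)"
      using assms by (simp_all add: field_simps)
    then show ?thesis by simp
  qed
  also have "\<dots> = (z - m)\<^sup>2 / (m * (1 - m))"
    using assms by (subst add_frac_eq) (auto simp: power2_eq_square algebra_simps)
  finally show ?thesis using assms by (simp add: bern_kl_def)
qed

text \<open>Below 1/2 the left side is at most 1 and \<open>8 * (1 / 2) ^ 3 = 1\<close>, which is
  the origin of the constant 8. Above 1/2 the derivative of the error is at most
  \<open>2 * (x - 1)\<close> squared between 1 and \<open>x\<close>, and the mean value theorem
  gives a cubic bound.\<close>

lemma xlnx_quadratic:
  fixes x :: real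
  assumes x: "0 \<le> x"
  shows "\<bar>x * ln x - (x - 1) - (x - 1)\<^sup>2 / 2\<bar> \<le> 8 * \<bar>x - 1\<bar> ^ 3"
proof (cases "x < 1 / 2")
  case True
  have a: "x * ln x - (x - 1) - (x - 1)\<^sup>2 / 2 \<le> 1"
  proof -
    have "x * ln x - (x - 1) \<le> (x - 1)\<^sup>2"
      using xlnx_le[OF x] by (simp add: power2_eq_square algebra_simps)
    moreover have "(1 - x)\<^sup>2 \<le> 1\<^sup>2" using x True by (intro power_mono) auto
    ultimately show ?thesis by (simp add: power2_commute)
  qed
  have "(1 - x)\<^sup>2 \<le> 1\<^sup>2" using x True by (intro power_mono) auto
  then have "(x - 1)\<^sup>2 \<le> 1" by (simp add: power2_commute)
  then have b: "- 1 \<le> x * ln x - (x - 1) - (x - 1)\<^sup>2 / 2"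
    using xlnx_ge[OF x] by simp
  have "(1 / 2) ^ 3 \<le> \<bar>x - 1\<bar> ^ 3" using True by (intro power_mono) auto
  then have "1 \<le> 8 * \<bar>x - 1\<bar> ^ 3" by (simp add: power3_eq_cube)
  with a b show ?thesis by linarith
next
  case False
  then have x2: "1 / 2 \<le> x" by simp
  define u :: "real \<Rightarrow> real" where "u t = t * ln t - (t - 1) - (t - 1)\<^sup>2 / 2" for t
  have du: "(u has_real_derivative ln t - (t - 1)) (at t)" if "1 / 2 \<le> t" for t
    unfolding u_def using that by (auto intro!: derivative_eq_intros simp: power2_eq_square field_simps)
  have bd: "\<bar>ln t - (t - 1)\<bar> \<le> 2 * (x - 1)\<^sup>2" if t: "1 / 2 \<le> t" "\<bar>t - 1\<bar> \<le> \<bar>x - 1\<bar>" for t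
  proof -
    have "ln t \<le> t - 1" using t by (intro ln_le_minus_one) auto
    moreover have "(t - 1) - ln t \<le> (t - 1)\<^sup>2 / t"
      using xlnx_ge[of t] t by (simp add: field_simps power2_eq_square)
    moreover have "(t - 1)\<^sup>2 / t \<le> 2 * (t - 1)\<^sup>2"
      using t mult_right_mono[of "1/2" t "2 * (t - 1)\<^sup>2"] by (simp add: field_simps)
    moreover have "(t - 1)\<^sup>2 \<le> (x - 1)\<^sup>2" using t by (simp add: abs_le_square_iff)
    ultimately show ?thesis by linarith
  qed
  have "\<bar>u x - u 1\<bar> \<le> 2 * (x - 1)\<^sup>2 * \<bar>x - 1\<bar>"
  proof (cases x "1 :: real" rule: linorder_cases)
    case less
    then obtain t where "x < t" "t < 1" "u 1 - u x = (1 - x) * (ln t - (t - 1))"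
      using MVT2[of x 1 u "\<lambda>t. ln t - (t - 1)"] du x2 by fastforce
    moreover from this less have "\<bar>ln t - (t - 1)\<bar> \<le> 2 * (x - 1)\<^sup>2" using x2 by (intro bd) auto
    ultimately show ?thesis
      using less by (subst abs_minus_commute) (auto simp: abs_mult mult.commute intro!: mult_right_mono)
  next
    case greater
    then obtain t where "1 < t" "t < x" "u x - u 1 = (x - 1) * (ln t - (t - 1))"
      using MVT2[of 1 x u "\<lambda>t. ln t - (t - 1)"] du by fastforce
    moreover from this greater have "\<bar>ln t - (t - 1)\<bar> \<le> 2 * (x - 1)\<^sup>2" by (intro bd) auto
    ultimately show ?thesis
      using greater by (auto simp: abs_mult mult.commute intro!: mult_right_mono)
  qed simp
  also have "2 * (x - 1)\<^sup>2 * \<bar>x - 1\<bar> = 2 * \<bar>x - 1\<bar> ^ 3"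
    by (simp add: power2_eq_square power3_eq_cube flip: abs_mult)
  also have "\<dots> \<le> 8 * \<bar>x - 1\<bar> ^ 3" by simp
  finally show ?thesis by (simp add: u_def)
qed

text \<open>The expansion of \<open>x * ln x\<close> is used at the ratios \<open>z / m\<close> and
  \<open>(1 - z) / (1 - m)\<close>. The linear terms cancel, the quadratic ones add up through
  \<open>1 / m + 1 / (1 - m) = 1 / (m * (1 - m))\<close>, and each cubic error is divided by the
  square of \<open>m\<close> or \<open>1 - m\<close>.\<close>

lemma bern_kl_quadratic:
  assumes m: "0 < m" "m < 1" and z: "0 \<le> z" "z \<le> 1" and c: "c \<le> m" "c \<le> 1 - m" "0 < c"
  shows "\<bar>bern_kl z m - (z - m)\<^sup>2 / (2 * (m * (1 - m)))\<bar> \<le> 16 * \<bar>z - m\<bar> ^ 3 / c\<^sup>2"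
proof -
  define x where "x = z / m"
  define y where "y = (1 - z) / (1 - m)"
  let ?f = "\<lambda>x::real. x * ln x - (x - 1) - (x - 1)\<^sup>2 / 2"
  have x1: "x - 1 = (z - m) / m" and y1: "y - 1 = (m - z) / (1 - m)"
    using m by (auto simp: x_def y_def field_simps)
  have "bern_kl z m - (z - m)\<^sup>2 / (2 * (m * (1 - m))) = m * ?f x + (1 - m) * ?f y"
  proof -
    have "bern_kl z m = m * (x * ln x) + (1 - m) * (y * ln y)"
      using m by (simp add: bern_kl_def x_def y_def)
    moreover have "m * (x - 1) + (1 - m) * (y - 1) = 0" using m by (simp add: x1 y1)
    moreover have "m * ((x - 1)\<^sup>2 / 2) + (1 - m) * ((y - 1)\<^sup>2 / 2) = (z - m)\<^sup>2 / (2 * (m * (1 - m)))"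
    proof -
      have "m * ((x - 1)\<^sup>2 / 2) = (z - m)\<^sup>2 / 2 * (1 / m)"
        using m by (simp add: x1 power_divide power2_eq_square)
      moreover have "(1 - m) * ((y - 1)\<^sup>2 / 2) = (z - m)\<^sup>2 / 2 * (1 / (1 - m))"
        using m by (simp add: y1 power_divide power2_commute[of m z]) (simp add: power2_eq_square)
      moreover have "1 / m + 1 / (1 - m) = 1 / (m * (1 - m))"
        using m by (subst add_frac_eq) auto
      ultimately have "m * ((x - 1)\<^sup>2 / 2) + (1 - m) * ((y - 1)\<^sup>2 / 2) = (z - m)\<^sup>2 / 2 * (1 / (m * (1 - m)))"
        by (simp only: distrib_left[symmetric])
      then show ?thesis by simp
    qed
    ultimately show ?thesis by (simp add: algebra_simps)
  qed
  also have "\<bar>\<dots>\<bar> \<le> m * \<bar>?f x\<bar> + (1 - m) * \<bar>?f y\<bar>"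
    by (rule order_trans[OF abs_triangle_ineq]) (use m in \<open>simp add: abs_mult\<close>)
  also have "\<dots> \<le> m * (8 * \<bar>x - 1\<bar> ^ 3) + (1 - m) * (8 * \<bar>y - 1\<bar> ^ 3)"
    using m z by (intro add_mono mult_left_mono xlnx_quadratic) (auto simp: x_def y_def)
  also have "\<dots> = 8 * \<bar>z - m\<bar> ^ 3 / m\<^sup>2 + 8 * \<bar>z - m\<bar> ^ 3 / (1 - m)\<^sup>2"
    using m by (simp add: x1 y1 abs_divide power_divide abs_minus_commute power2_eq_square power3_eq_cube)
  also have "\<dots> \<le> 8 * \<bar>z - m\<bar> ^ 3 / c\<^sup>2 + 8 * \<bar>z - m\<bar> ^ 3 / c\<^sup>2"
    using m c by (intro add_mono divide_left_mono power_mono mult_pos_pos) auto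
  finally show ?thesis by simp
qed

section \<open>Convergence of continuous functions of random vectors\<close>

text \<open>The functions \<open>cts_step\<close> are the test functions for weak convergence; the
  Lipschitz constant \<open>1 / (b - a)\<close> turns closeness in mean into closeness of their
  expectations.\<close>

lemma cts_step_lipschitz:
  assumes "a < b" shows "\<bar>cts_step a b x - cts_step a b y\<bar> \<le> \<bar>x - y\<bar> / (b - a)"
proof -
  have "cts_step a b x = min 1 (max 0 ((b - x) / (b - a)))" for x
    using assms by (auto simp: cts_step_def min_def max_def field_simps)
  moreover have "\<bar>min 1 (max 0 u) - min 1 (max 0 v)\<bar> \<le> \<bar>u - v\<bar>" for u v :: real by auto
  ultimately have "\<bar>cts_step a b x - cts_step a b y\<bar> \<le> \<bar>(b - x) / (b - a) - (b - y) / (b - a)\<bar>" by simp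
  also have "\<dots> = \<bar>x - y\<bar> / (b - a)"
    using assms by (simp add: diff_divide_distrib[symmetric] abs_minus_commute)
  finally show ?thesis .
qed

lemma cts_step_bound: "a < b \<Longrightarrow> \<bar>cts_step a b x\<bar> \<le> 1"
  by (auto simp: cts_step_def field_simps)

lemma cts_step_continuous: "a < b \<Longrightarrow> continuous_on UNIV (cts_step a b)"
  by (intro uniformly_continuous_imp_continuous cts_step_uniformly_continuous)

lemma measurable_cts_step: "a < b \<Longrightarrow> cts_step a b \<in> borel_measurable borel"
  by (intro borel_measurable_continuous_onI cts_step_continuous)

text \<open>The linear span of the sines and cosines of linear forms with arbitrary real
  frequencies. Linearity transfers convergence of characteristic functions to the span, and the
  product-to-sum formulas make it an algebra, as Stone--Weierstrass requires.\<close>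

inductive_set trig_polys :: "'i set \<Rightarrow> (('i \<Rightarrow> real) \<Rightarrow> real) set" for J where
  cos: "(\<lambda>x. cos (\<Sum>i\<in>J. c i * x i)) \<in> trig_polys J"
| sin: "(\<lambda>x. sin (\<Sum>i\<in>J. c i * x i)) \<in> trig_polys J"
| scale: "f \<in> trig_polys J \<Longrightarrow> (\<lambda>x. a * f x) \<in> trig_polys J"
| add: "f \<in> trig_polys J \<Longrightarrow> g \<in> trig_polys J \<Longrightarrow> (\<lambda>x. f x + g x) \<in> trig_polys J"

lemma trig_polys_const: "(\<lambda>x. c) \<in> trig_polys J"
  using trig_polys.scale[OF trig_polys.cos[of "\<lambda>_. 0" J], of c] by simp

lemma trig_polys_diff:
  "f \<in> trig_polys J \<Longrightarrow> g \<in> trig_polys J \<Longrightarrow> (\<lambda>x. f x - g x) \<in> trig_polys J"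
  using trig_polys.add[OF _ trig_polys.scale[of g J "-1"], of f] by simp

lemma trig_polys_half: "f \<in> trig_polys J \<Longrightarrow> (\<lambda>x. f x / 2) \<in> trig_polys J"
  using trig_polys.scale[of f J "1/2"] by simp

lemma trig_polys_mult_cos:
  "f \<in> trig_polys J \<Longrightarrow> (\<lambda>x. f x * cos (\<Sum>i\<in>J. c i * x i)) \<in> trig_polys J"
proof (induction rule: trig_polys.induct)
  case (cos d)
  have "(\<lambda>x. cos (\<Sum>i\<in>J. d i * x i) * cos (\<Sum>i\<in>J. c i * x i))
    = (\<lambda>x. (cos (\<Sum>i\<in>J. (d i - c i) * x i) + cos (\<Sum>i\<in>J. (d i + c i) * x i)) / 2)"
    by (simp add: cos_times_cos left_diff_distrib distrib_right sum_subtractf sum.distrib)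
  then show ?case by (simp only:) (intro trig_polys_half trig_polys.intros)
next
  case (sin d)
  have "(\<lambda>x. sin (\<Sum>i\<in>J. d i * x i) * cos (\<Sum>i\<in>J. c i * x i))
    = (\<lambda>x. (sin (\<Sum>i\<in>J. (d i + c i) * x i) + sin (\<Sum>i\<in>J. (d i - c i) * x i)) / 2)"
    by (simp add: sin_times_cos left_diff_distrib distrib_right sum_subtractf sum.distrib)
  then show ?case by (simp only:) (intro trig_polys_half trig_polys.intros)
next
  case (scale f a)
  from trig_polys.scale[OF scale.IH, of a] show ?case by (simp add: mult_ac)
next
  case (add f g)
  from trig_polys.add[OF add.IH] show ?case by (simp add: distrib_right)
qed

lemma trig_polys_mult_sin:
  "f \<in> trig_polys J \<Longrightarrow> (\<lambda>x. f x * sin (\<Sum>i\<in>J. c i * x i)) \<in> trig_polys J"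
proof (induction rule: trig_polys.induct)
  case (cos d)
  have "(\<lambda>x. cos (\<Sum>i\<in>J. d i * x i) * sin (\<Sum>i\<in>J. c i * x i))
    = (\<lambda>x. (sin (\<Sum>i\<in>J. (d i + c i) * x i) - sin (\<Sum>i\<in>J. (d i - c i) * x i)) / 2)"
    by (simp add: cos_times_sin left_diff_distrib distrib_right sum_subtractf sum.distrib)
  then show ?case by (simp only:) (intro trig_polys_half trig_polys_diff trig_polys.intros)
next
  case (sin d)
  have "(\<lambda>x. sin (\<Sum>i\<in>J. d i * x i) * sin (\<Sum>i\<in>J. c i * x i))
    = (\<lambda>x. (cos (\<Sum>i\<in>J. (d i - c i) * x i) - cos (\<Sum>i\<in>J. (d i + c i) * x i)) / 2)"
    by (simp add: sin_times_sin left_diff_distrib distrib_right sum_subtractf sum.distrib)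
  then show ?case by (simp only:) (intro trig_polys_half trig_polys_diff trig_polys.intros)
next
  case (scale f a)
  from trig_polys.scale[OF scale.IH, of a] show ?case by (simp add: mult_ac)
next
  case (add f g)
  from trig_polys.add[OF add.IH] show ?case by (simp add: distrib_right)
qed

lemma trig_polys_mult:
  assumes f: "f \<in> trig_polys J" and g: "g \<in> trig_polys J"
  shows "(\<lambda>x. f x * g x) \<in> trig_polys J"
  using g
proof (induction rule: trig_polys.induct)
  case (scale g a)
  from trig_polys.scale[OF scale.IH, of a] show ?case by (simp add: mult_ac)
next
  case (add g h)
  from trig_polys.add[OF add.IH] show ?case by (simp add: distrib_left)
qed (auto intro: trig_polys_mult_cos trig_polys_mult_sin f)

lemma trig_polys_sin_coordinate:
  assumes "finite J" "i \<in> J" shows "(\<lambda>x. sin (\<theta> * x i)) \<in> trig_polys J"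
proof -
  have "(\<Sum>j\<in>J. (if j = i then \<theta> else 0) * x j) = \<theta> * x i" for x
    using assms by (simp add: if_distrib[of "\<lambda>a. a * _"] cong: if_cong)
  then show ?thesis using trig_polys.sin[of "\<lambda>j. if j = i then \<theta> else 0" J] by simp
qed

text \<open>Both limits are linear in \<open>f\<close>, so it suffices to know single frequencies.
  Integrability is carried through the induction because additivity of the integral needs
  it.\<close>

lemma trig_polys_convergence:
  fixes Z :: "nat \<Rightarrow> 'i \<Rightarrow> 'a \<Rightarrow> real" and Y :: "'i \<Rightarrow> 'b \<Rightarrow> real"
  assumes M: "\<And>n. prob_space (M n)" and P: "prob_space P"
    and Z: "\<And>n i. i \<in> J \<Longrightarrow> Z n i \<in> borel_measurable (M n)"
    and Y: "\<And>i. i \<in> J \<Longrightarrow> Y i \<in> borel_measurable P"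
    and cos: "\<And>c. (\<lambda>n. LINT \<omega>|M n. cos (\<Sum>i\<in>J. c i * Z n i \<omega>)) \<longlonglongrightarrow> (LINT \<omega>|P. cos (\<Sum>i\<in>J. c i * Y i \<omega>))"
    and sin: "\<And>c. (\<lambda>n. LINT \<omega>|M n. sin (\<Sum>i\<in>J. c i * Z n i \<omega>)) \<longlonglongrightarrow> (LINT \<omega>|P. sin (\<Sum>i\<in>J. c i * Y i \<omega>))"
    and f: "f \<in> trig_polys J"
  shows "(\<forall>n. integrable (M n) (\<lambda>\<omega>. f (\<lambda>i. Z n i \<omega>))) \<and> integrable P (\<lambda>\<omega>. f (\<lambda>i. Y i \<omega>)) \<and>
    (\<lambda>n. LINT \<omega>|M n. f (\<lambda>i. Z n i \<omega>)) \<longlonglongrightarrow> (LINT \<omega>|P. f (\<lambda>i. Y i \<omega>))"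
  using f
proof (induction rule: trig_polys.induct)
  interpret P: prob_space P by fact
  {
    case (cos c)
    have "integrable (M n) (\<lambda>\<omega>. cos (\<Sum>i\<in>J. c i * Z n i \<omega>))" for n
    proof -
      interpret prob_space "M n" by fact
      have "(\<lambda>\<omega>. \<Sum>i\<in>J. c i * Z n i \<omega>) \<in> borel_measurable (M n)"
        by (intro borel_measurable_sum borel_measurable_times borel_measurable_const Z)
      then show ?thesis by (intro integrable_const_bound[of _ 1]) auto
    qed
    moreover have "integrable P (\<lambda>\<omega>. cos (\<Sum>i\<in>J. c i * Y i \<omega>))"
    proof -
      have "(\<lambda>\<omega>. \<Sum>i\<in>J. c i * Y i \<omega>) \<in> borel_measurable P"
        by (intro borel_measurable_sum borel_measurable_times borel_measurable_const Y)
      then show ?thesis by (intro P.integrable_const_bound[of _ 1]) auto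
    qed
    ultimately show ?case using assms(5) by blast
  next
    case (sin c)
    have "integrable (M n) (\<lambda>\<omega>. sin (\<Sum>i\<in>J. c i * Z n i \<omega>))" for n
    proof -
      interpret prob_space "M n" by fact
      have "(\<lambda>\<omega>. \<Sum>i\<in>J. c i * Z n i \<omega>) \<in> borel_measurable (M n)"
        by (intro borel_measurable_sum borel_measurable_times borel_measurable_const Z)
      then show ?thesis by (intro integrable_const_bound[of _ 1]) auto
    qed
    moreover have "integrable P (\<lambda>\<omega>. sin (\<Sum>i\<in>J. c i * Y i \<omega>))"
    proof -
      have "(\<lambda>\<omega>. \<Sum>i\<in>J. c i * Y i \<omega>) \<in> borel_measurable P"
        by (intro borel_measurable_sum borel_measurable_times borel_measurable_const Y)
      then show ?thesis by (intro P.integrable_const_bound[of _ 1]) auto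
    qed
    ultimately show ?case using assms(6) by blast
  next
    case (scale f a)
    then show ?case by (auto intro!: tendsto_mult_left)
  next
    case (add f g)
    then show ?case by (auto intro!: tendsto_add)
  }
qed

text \<open>A continuous function on the box \<open>[-L, L]\<^sup>J\<close> is a continuous function of the sines
  \<open>sin (\<pi> x\<^sub>i / 2 L)\<close>, hence, by Stone--Weierstrass, uniformly close to a trigonometric
  polynomial. Being a polynomial in these sines, the latter is bounded outside the box as well.\<close>

lemma trig_polys_approximation:
  fixes h :: "('i::countable \<Rightarrow> real) \<Rightarrow> real"
  assumes J: "finite J" and h: "continuous_on UNIV h" and b: "\<And>x. \<bar>h x\<bar> \<le> b"
    and L: "0 < L" and e: "0 < e"
  obtains p where "p \<in> trig_polys J" "\<And>x. \<bar>p x\<bar> \<le> b + e"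
    "\<And>x. (\<And>i. i \<in> J \<Longrightarrow> \<bar>x i\<bar> \<le> L) \<Longrightarrow> \<bar>h (\<lambda>i. if i \<in> J then x i else 0) - p x\<bar> \<le> e"
proof -
  \<comment> \<open>Coordinates outside \<open>J\<close> are pinned to 0, which leaves only
    coordinates in \<open>J\<close> to separate points of \<open>S\<close>.\<close>
  define S :: "('i \<Rightarrow> real) set" where "S = PiE UNIV (\<lambda>i. if i \<in> J then {-1..1} else {0})"
  define \<theta> where "\<theta> = pi / (2 * L)"
  define s where "s x = (\<lambda>i. if i \<in> J then sin (\<theta> * x i) else 0)" for x :: "'i \<Rightarrow> real"
  define R where "R = {f. continuous_on S f \<and> (\<lambda>x. f (s x)) \<in> trig_polys J}"
  \<comment> \<open>This undoes \<open>s\<close> on the box: for \<open>x\<close> bounded by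
    \<open>L\<close> on \<open>J\<close>, \<open>g (s x)\<close> is the value of \<open>h\<close> at
    the point that agrees with \<open>x\<close> on \<open>J\<close> and is 0 elsewhere.\<close>
  define g where "g u = h (\<lambda>i. arcsin (max (-1) (min 1 (u i))) / \<theta>)" for u
  have \<theta>: "0 < \<theta>" using L by (simp add: \<theta>_def)
  have sS: "s x \<in> S" for x by (auto simp: s_def S_def)
  have compact: "compact S"
    unfolding S_def compactin_euclidean_iff[symmetric] euclidean_product_topology[symmetric]
    by (subst compactin_PiE) auto
  interpret function_ring_on R S
  proof
    show "compact S" by fact
    show "f \<in> R \<Longrightarrow> continuous_on S f" for f by (simp add: R_def)
    show "f \<in> R \<Longrightarrow> g \<in> R \<Longrightarrow> (\<lambda>x. f x + g x) \<in> R" for f g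
      by (auto simp: R_def intro!: continuous_intros trig_polys.add)
    show "f \<in> R \<Longrightarrow> g \<in> R \<Longrightarrow> (\<lambda>x. f x * g x) \<in> R" for f g
      by (auto simp: R_def intro!: continuous_intros trig_polys_mult)
    show "(\<lambda>_. c) \<in> R" for c by (auto simp: R_def intro!: trig_polys_const)
    fix x y assume xy: "x \<in> S" "y \<in> S" "x \<noteq> y"
    then obtain i where i: "x i \<noteq> y i" by auto
    have off: "u i = 0" if "u \<in> S" "i \<notin> J" for u
      using PiE_mem[OF that(1)[unfolded S_def], of i] that(2) by simp
    from i off[OF xy(1)] off[OF xy(2)] have "i \<in> J" by (cases "i \<in> J") auto
    moreover have "(\<lambda>u. u i) \<in> R"
    proof -
      have "continuous_on S (\<lambda>u. u i)"
        by (rule continuous_on_subset[OF continuous_on_product_coordinates]) simp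
      moreover have "(\<lambda>x. s x i) \<in> trig_polys J"
        using trig_polys_sin_coordinate[OF J \<open>i \<in> J\<close>, of \<theta>] \<open>i \<in> J\<close> by (simp add: s_def)
      ultimately show ?thesis by (simp add: R_def)
    qed
    ultimately show "\<exists>f\<in>R. f x \<noteq> f y" using i by (intro bexI[of _ "\<lambda>u. u i"])
  qed
  have "continuous_on S g"
    unfolding g_def
  proof (rule continuous_on_compose2[OF h])
    show "continuous_on S (\<lambda>u i. arcsin (max (-1) (min 1 (u i))) / \<theta>)"
    proof (rule continuous_on_coordinatewise_then_product)
      fix i
      have "continuous_on S (\<lambda>u. u i)"
        by (rule continuous_on_subset[OF continuous_on_product_coordinates]) simp
      then show "continuous_on S (\<lambda>u. arcsin (max (-1) (min 1 (u i))) / \<theta>)"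
        using \<theta> by (intro continuous_on_divide continuous_on_arcsin continuous_on_max
            continuous_on_min continuous_on_const) auto
    qed
  qed auto
  from Stone_Weierstrass_basic[OF this e] obtain q where q: "q \<in> R" "\<And>u. u \<in> S \<Longrightarrow> \<bar>g u - q u\<bar> < e"
    by blast
  show thesis
  proof (rule that[of "\<lambda>x. q (s x)"])
    show "(\<lambda>x. q (s x)) \<in> trig_polys J" using q by (simp add: R_def)
    show "\<bar>q (s x)\<bar> \<le> b + e" for x
      using q(2)[OF sS[of x]] b[of "\<lambda>i. arcsin (max (-1) (min 1 (s x i))) / \<theta>"] by (simp add: g_def)
    fix x :: "'i \<Rightarrow> real" assume x: "\<And>i. i \<in> J \<Longrightarrow> \<bar>x i\<bar> \<le> L"
    have "arcsin (sin (\<theta> * x i)) = \<theta> * x i" if "i \<in> J" for i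
    proof (rule arcsin_sin)
      have "\<bar>\<theta> * x i\<bar> \<le> \<theta> * L" using x[OF that] \<theta> by (simp add: abs_mult)
      also have "\<theta> * L = pi / 2" using L by (simp add: \<theta>_def)
      finally show "- (pi / 2) \<le> \<theta> * x i" "\<theta> * x i \<le> pi / 2" by auto
    qed
    then have "(\<lambda>i. arcsin (max (-1) (min 1 (s x i))) / \<theta>) = (\<lambda>i. if i \<in> J then x i else 0)"
      using \<theta> by (auto simp: s_def fun_eq_iff)
    then show "\<bar>h (\<lambda>i. if i \<in> J then x i else 0) - q (s x)\<bar> \<le> e"
      using q(2)[OF sS[of x]] by (simp add: g_def)
  qed
qed

text \<open>The second-moment bound \<open>C\<close> plays the role of tightness. Inside a large box
  \<open>h\<close> is close to a trigonometric polynomial; outside, both are bounded, and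
  Chebyshev's inequality makes the contribution small uniformly in \<open>n\<close>.\<close>

lemma random_vectors_convergence:
  fixes Z :: "nat \<Rightarrow> 'i::countable \<Rightarrow> 'a \<Rightarrow> real" and Y :: "'i \<Rightarrow> 'b \<Rightarrow> real"
    and h :: "('i \<Rightarrow> real) \<Rightarrow> real"
  assumes M: "\<And>n. prob_space (M n)" and P: "prob_space P" and J: "finite J"
    and Z: "\<And>n i. i \<in> J \<Longrightarrow> Z n i \<in> borel_measurable (M n)"
    and Y: "\<And>i. i \<in> J \<Longrightarrow> Y i \<in> borel_measurable P"
    and cos: "\<And>c. (\<lambda>n. LINT \<omega>|M n. cos (\<Sum>i\<in>J. c i * Z n i \<omega>)) \<longlonglongrightarrow> (LINT \<omega>|P. cos (\<Sum>i\<in>J. c i * Y i \<omega>))"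
    and sin: "\<And>c. (\<lambda>n. LINT \<omega>|M n. sin (\<Sum>i\<in>J. c i * Z n i \<omega>)) \<longlonglongrightarrow> (LINT \<omega>|P. sin (\<Sum>i\<in>J. c i * Y i \<omega>))"
    and Z2: "\<And>n i. i \<in> J \<Longrightarrow> integrable (M n) (\<lambda>\<omega>. (Z n i \<omega>)\<^sup>2) \<and> (LINT \<omega>|M n. (Z n i \<omega>)\<^sup>2) \<le> C"
    and Y2: "\<And>i. i \<in> J \<Longrightarrow> integrable P (\<lambda>\<omega>. (Y i \<omega>)\<^sup>2) \<and> (LINT \<omega>|P. (Y i \<omega>)\<^sup>2) \<le> C"
    and h: "continuous_on UNIV h" and b: "\<And>x. \<bar>h x\<bar> \<le> b"
  shows "(\<lambda>n. LINT \<omega>|M n. h (\<lambda>i. if i \<in> J then Z n i \<omega> else 0)) \<longlonglongrightarrow>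
    (LINT \<omega>|P. h (\<lambda>i. if i \<in> J then Y i \<omega> else 0))"
proof (rule LIMSEQ_I)
  fix r :: real assume r: "0 < r"
  have b0: "0 \<le> b" using b[of undefined] by linarith
  define e where "e = min 1 (r / 8)"
  have e: "0 < e" "e \<le> 1" "e \<le> r / 8" using r by (auto simp: e_def)
  \<comment> \<open>\<open>D\<close> dominates the bound \<open>2 * b + 1\<close> on the difference
    times the total second moment, so \<open>D\<close> divided by the square of \<open>L\<close> is
    \<open>r / 8\<close>; together with \<open>e \<le> r / 8\<close> each replacement by
    \<open>p\<close> costs at most \<open>r / 4\<close>.\<close>
  define D where "D = (2 * b + 1) * (card J * \<bar>C\<bar>) + 1"
  have D: "0 < D" using b0 by (auto simp: D_def intro!: add_nonneg_pos)
  define L where "L = sqrt (8 * D / r)"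
  have L: "0 < L" "L\<^sup>2 = 8 * D / r" using D r by (auto simp: L_def)
  obtain p where p: "p \<in> trig_polys J" "\<And>x. \<bar>p x\<bar> \<le> b + e"
    "\<And>x. (\<And>i. i \<in> J \<Longrightarrow> \<bar>x i\<bar> \<le> L) \<Longrightarrow> \<bar>h (\<lambda>i. if i \<in> J then x i else 0) - p x\<bar> \<le> e"
    using trig_polys_approximation[OF J h b L(1) e(1)] by metis
  have pt: "\<bar>h (\<lambda>i. if i \<in> J then x i else 0) - p x\<bar> \<le> e + (2 * b + 1) * (\<Sum>i\<in>J. (x i)\<^sup>2) / L\<^sup>2" for x
  proof (cases "\<forall>i\<in>J. \<bar>x i\<bar> \<le> L")
    case True
    then have "\<bar>h (\<lambda>i. if i \<in> J then x i else 0) - p x\<bar> \<le> e" by (intro p(3)) auto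
    moreover have "0 \<le> (2 * b + 1) * (\<Sum>i\<in>J. (x i)\<^sup>2) / L\<^sup>2"
      using b0 by (intro divide_nonneg_nonneg mult_nonneg_nonneg sum_nonneg) auto
    ultimately show ?thesis by linarith
  next
    case False
    then obtain i where i: "i \<in> J" "L < \<bar>x i\<bar>" by auto
    have "\<bar>h (\<lambda>i. if i \<in> J then x i else 0) - p x\<bar> \<le> b + (b + e)"
      using b[of "\<lambda>i. if i \<in> J then x i else 0"] p(2)[of x] by linarith
    also have "\<dots> \<le> (2 * b + 1) * 1 + e" using e by simp
    also have "\<dots> \<le> (2 * b + 1) * ((\<Sum>i\<in>J. (x i)\<^sup>2) / L\<^sup>2) + e"
    proof (intro add_right_mono mult_left_mono)
      have "L\<^sup>2 \<le> \<bar>x i\<bar>\<^sup>2" using i L by (intro power_mono) auto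
      also have "\<dots> \<le> (\<Sum>i\<in>J. (x i)\<^sup>2)"
        using member_le_sum[of i J "\<lambda>i. (x i)\<^sup>2"] i J by simp
      finally show "1 \<le> (\<Sum>i\<in>J. (x i)\<^sup>2) / L\<^sup>2" using L(1) by simp
    qed (use b0 in simp)
    finally show ?thesis by simp
  qed
  have hm: "(\<lambda>\<omega>. h (\<lambda>i. if i \<in> J then W i \<omega> else 0)) \<in> borel_measurable N"
    if "\<And>i. i \<in> J \<Longrightarrow> W i \<in> borel_measurable N" for W :: "'i \<Rightarrow> 'c \<Rightarrow> real" and N
  proof (rule borel_measurable_continuous_on[OF h])
    have "(\<lambda>\<omega>. \<lambda>i. if i \<in> J then W i \<omega> else 0) \<in> measurable N (Pi\<^sub>M UNIV (\<lambda>_. borel))"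
    proof (rule measurable_PiM_single')
      show "(\<lambda>\<omega>. if i \<in> J then W i \<omega> else 0) \<in> borel_measurable N" for i
        using that by (cases "i \<in> J") auto
    qed auto
    then show "(\<lambda>\<omega>. \<lambda>i. if i \<in> J then W i \<omega> else 0) \<in> borel_measurable N"
      using measurable_cong_sets[OF refl sets_PiM_equal_borel[where 'a='i and 'b=real]] by blast
  qed
  have close: "\<bar>(LINT \<omega>|N. h (\<lambda>i. if i \<in> J then W i \<omega> else 0)) - (LINT \<omega>|N. p (\<lambda>i. W i \<omega>))\<bar> \<le> r / 4"
    if N: "prob_space N" and W: "\<And>i. i \<in> J \<Longrightarrow> W i \<in> borel_measurable N"
      and W2: "\<And>i. i \<in> J \<Longrightarrow> integrable N (\<lambda>\<omega>. (W i \<omega>)\<^sup>2) \<and> (LINT \<omega>|N. (W i \<omega>)\<^sup>2) \<le> C"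
      and ip: "integrable N (\<lambda>\<omega>. p (\<lambda>i. W i \<omega>))"
    for W :: "'i \<Rightarrow> 'c \<Rightarrow> real" and N
  proof -
    interpret N: prob_space N by fact
    have ih: "integrable N (\<lambda>\<omega>. h (\<lambda>i. if i \<in> J then W i \<omega> else 0))"
      by (rule N.integrable_const_bound[of _ b]) (auto intro!: hm W b)
    have "\<bar>(LINT \<omega>|N. h (\<lambda>i. if i \<in> J then W i \<omega> else 0)) - (LINT \<omega>|N. p (\<lambda>i. W i \<omega>))\<bar>
      \<le> (LINT \<omega>|N. \<bar>h (\<lambda>i. if i \<in> J then W i \<omega> else 0) - p (\<lambda>i. W i \<omega>)\<bar>)"
      by (subst Bochner_Integration.integral_diff[symmetric]) (auto intro!: ih ip)
    also have "\<dots> \<le> (LINT \<omega>|N. e + (2 * b + 1) * (\<Sum>i\<in>J. (W i \<omega>)\<^sup>2) / L\<^sup>2)"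
      using W2 ih ip by (intro integral_mono pt) auto
    also have "\<dots> = e + (2 * b + 1) * (\<Sum>i\<in>J. LINT \<omega>|N. (W i \<omega>)\<^sup>2) / L\<^sup>2"
      using W2 by (simp add: N.prob_space)
    also have "\<dots> \<le> e + (2 * b + 1) * (\<Sum>i\<in>J. \<bar>C\<bar>) / L\<^sup>2"
      using W2 b0 by (intro add_left_mono divide_right_mono mult_left_mono sum_mono) fastforce+
    also have "\<dots> \<le> e + D / L\<^sup>2" by (intro add_left_mono divide_right_mono) (auto simp: D_def)
    also have "D / L\<^sup>2 = r / 8" using L(2) D r by simp
    finally show ?thesis using e(3) by linarith
  qed
  note tp = trig_polys_convergence[OF M P Z Y cos sin p(1)]
  obtain n0 where n0: "\<And>n. n \<ge> n0 \<Longrightarrow>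
      \<bar>(LINT \<omega>|M n. p (\<lambda>i. Z n i \<omega>)) - (LINT \<omega>|P. p (\<lambda>i. Y i \<omega>))\<bar> < r / 4"
    using LIMSEQ_D[OF tp[THEN conjunct2, THEN conjunct2], of "r / 4"] r by auto
  have "norm ((LINT \<omega>|M n. h (\<lambda>i. if i \<in> J then Z n i \<omega> else 0)) -
      (LINT \<omega>|P. h (\<lambda>i. if i \<in> J then Y i \<omega> else 0))) < r" if "n \<ge> n0" for n
  proof -
    have "\<bar>(LINT \<omega>|M n. h (\<lambda>i. if i \<in> J then Z n i \<omega> else 0)) - (LINT \<omega>|M n. p (\<lambda>i. Z n i \<omega>))\<bar> \<le> r / 4"
      by (rule close[OF M Z Z2]) (use tp in auto)
    moreover have "\<bar>(LINT \<omega>|P. h (\<lambda>i. if i \<in> J then Y i \<omega> else 0)) - (LINT \<omega>|P. p (\<lambda>i. Y i \<omega>))\<bar> \<le> r / 4"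
      by (rule close[OF P Y Y2]) (use tp in auto)
    ultimately show ?thesis using n0[OF that] r unfolding real_norm_def by linarith
  qed
  then show "\<exists>no. \<forall>n\<ge>no. norm ((LINT \<omega>|M n. h (\<lambda>i. if i \<in> J then Z n i \<omega> else 0)) -
      (LINT \<omega>|P. h (\<lambda>i. if i \<in> J then Y i \<omega> else 0))) < r" by blast
qed

section \<open>Independent identically distributed observations\<close>

text \<open>The matrix is \<open>\<alpha> - \<beta>\<close> times the identity plus
  \<open>\<beta>\<close> times the all-ones matrix. For contrasts, where the \<open>a i\<close> sum
  to 0, only the first part survives.\<close>

lemma sum_two_valued_quadratic_form:
  fixes a :: "'i \<Rightarrow> real"
  assumes "finite I" and g: "\<And>i k. i \<in> I \<Longrightarrow> k \<in> I \<Longrightarrow> g i k = (if i = k then \<alpha> else \<beta>)"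
  shows "(\<Sum>i\<in>I. \<Sum>k\<in>I. a i * a k * g i k) = (\<Sum>i\<in>I. (a i)\<^sup>2) * (\<alpha> - \<beta>) + \<beta> * (\<Sum>i\<in>I. a i)\<^sup>2"
proof -
  have "(\<Sum>i\<in>I. \<Sum>k\<in>I. a i * a k * g i k)
      = (\<Sum>i\<in>I. \<Sum>k\<in>I. (if i = k then a i * a k * (\<alpha> - \<beta>) else 0) + \<beta> * (a i * a k))"
    by (intro sum.cong refl) (auto simp: g algebra_simps)
  also have "\<dots> = (\<Sum>i\<in>I. (a i)\<^sup>2 * (\<alpha> - \<beta>)) + (\<Sum>i\<in>I. \<Sum>k\<in>I. \<beta> * (a i * a k))"
    using assms(1) by (simp add: sum.distrib power2_eq_square)
  also have "(\<Sum>i\<in>I. \<Sum>k\<in>I. \<beta> * (a i * a k)) = \<beta> * (\<Sum>i\<in>I. a i)\<^sup>2"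
    by (simp only: power2_eq_square sum_product) (simp only: sum_distrib_left)
  finally show ?thesis by (simp only: sum_distrib_right)
qed

text \<open>An observation counts itself, so without ties the ranks are
  \<open>1, ..., card I\<close>, and the pooled empirical cdf at an observation is its rank divided
  by \<open>card I\<close>.\<close>

definition rank_in :: "'i set \<Rightarrow> ('i \<Rightarrow> real) \<Rightarrow> 'i \<Rightarrow> nat" where
  "rank_in I x i = card {k \<in> I. x k \<le> x i}"

lemma rank_in_mono: "finite I \<Longrightarrow> x i \<le> x k \<Longrightarrow> rank_in I x i \<le> rank_in I x k"
  unfolding rank_in_def by (intro card_mono) auto

lemma rank_in_strict_mono: "finite I \<Longrightarrow> k \<in> I \<Longrightarrow> x i < x k \<Longrightarrow> rank_in I x i < rank_in I x k"
proof -
  assume "finite I" "k \<in> I" "x i < x k"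
  moreover from this have "k \<in> {l \<in> I. x l \<le> x k} - {l \<in> I. x l \<le> x i}" by auto
  then have "{l \<in> I. x l \<le> x i} \<noteq> {l \<in> I. x l \<le> x k}" by blast
  moreover have "{l \<in> I. x l \<le> x i} \<subseteq> {l \<in> I. x l \<le> x k}" using \<open>x i < x k\<close> by auto
  ultimately show ?thesis
    unfolding rank_in_def by (intro psubset_card_mono psubsetI) auto
qed

lemma rank_in_le_iff:
  "finite I \<Longrightarrow> i \<in> I \<Longrightarrow> k \<in> I \<Longrightarrow> rank_in I x i \<le> rank_in I x k \<longleftrightarrow> x i \<le> x k"
  using rank_in_mono[of I x i k] rank_in_strict_mono[of I i x k] by (meson linorder_not_le)

lemma bij_betw_rank_in:
  assumes I: "finite I" and inj: "inj_on x I"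
  shows "bij_betw (rank_in I x) I {1..card I}"
proof -
  have "inj_on (rank_in I x) I"
    using inj rank_in_le_iff[OF I] by (auto simp: inj_on_def) (metis order_antisym order_refl)
  moreover have "rank_in I x ` I \<subseteq> {1..card I}"
  proof safe
    fix i assume i: "i \<in> I"
    then have "{k \<in> I. x k \<le> x i} \<noteq> {}" by auto
    with I have "0 < rank_in I x i" by (simp add: rank_in_def card_gt_0_iff)
    moreover have "rank_in I x i \<le> card I" unfolding rank_in_def using I by (intro card_mono) auto
    ultimately show "rank_in I x i \<in> {1..card I}" by simp
  qed
  ultimately show ?thesis
    by (simp add: bij_betw_def card_image card_subset_eq)
qed

lemma card_rank_in_le:
  assumes I: "finite I" and inj: "inj_on x I" and r: "r \<le> card I"
  shows "card {i \<in> I. rank_in I x i \<le> r} = r"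
proof -
  have "bij_betw (rank_in I x) {i \<in> I. rank_in I x i \<le> r} {1..r}"
  proof (rule bij_betw_subset[OF bij_betw_rank_in[OF I inj]])
    show "rank_in I x ` {i \<in> I. rank_in I x i \<le> r} = {1..r}"
    proof (intro equalityI subsetI)
      fix m assume m: "m \<in> {1..r}"
      then have "m \<in> rank_in I x ` I"
        using bij_betw_rank_in[OF I inj] r by (auto simp: bij_betw_def)
      with m show "m \<in> rank_in I x ` {i \<in> I. rank_in I x i \<le> r}" by auto
    next
      fix m assume "m \<in> rank_in I x ` {i \<in> I. rank_in I x i \<le> r}"
      then show "m \<in> {1..r}"
        using bij_betw_rank_in[OF I inj] by (auto simp: bij_betw_def)
    qed
  qed auto
  then show ?thesis by (simp add: bij_betw_same_card)
qed

lemma rank_in_reindex: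
  assumes "bij_betw \<pi> I I" "i \<in> I"
  shows "rank_in I (\<lambda>k\<in>I. x (\<pi> k)) i = rank_in I x (\<pi> i)"
proof -
  have "bij_betw \<pi> {k \<in> I. x (\<pi> k) \<le> x (\<pi> i)} {k \<in> I. x k \<le> x (\<pi> i)}"
    by (rule bij_betw_subset[OF assms(1)]) (use assms in \<open>auto simp: bij_betw_def\<close>)
  then have "card {k \<in> I. x (\<pi> k) \<le> x (\<pi> i)} = card {k \<in> I. x k \<le> x (\<pi> i)}"
    by (rule bij_betw_same_card)
  moreover have "{k \<in> I. (\<lambda>k\<in>I. x (\<pi> k)) k \<le> (\<lambda>k\<in>I. x (\<pi> k)) i} = {k \<in> I. x (\<pi> k) \<le> x (\<pi> i)}"
    using assms(2) by auto
  ultimately show ?thesis by (simp add: rank_in_def)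
qed

lemma rank_in_restrict: "i \<in> I \<Longrightarrow> rank_in I (restrict x I) i = rank_in I x i"
  unfolding rank_in_def by (intro arg_cong[of _ _ card]) auto

lemma measurable_rank_in:
  assumes I: "finite I" and i: "i \<in> I" and x: "\<And>k. k \<in> I \<Longrightarrow> (\<lambda>\<omega>. x \<omega> k) \<in> borel_measurable M"
  shows "(\<lambda>\<omega>. rank_in I (x \<omega>) i) \<in> measurable M (count_space UNIV)"
proof -
  have "rank_in I (x \<omega>) i = (\<Sum>k\<in>I. if x \<omega> k \<le> x \<omega> i then 1 else 0)" for \<omega>
    using I by (simp add: rank_in_def sum.If_cases Int_def)
  moreover have "(\<lambda>\<omega>. \<Sum>k\<in>I. if x \<omega> k \<le> x \<omega> i then 1 else (0 :: nat)) \<in> measurable M (count_space UNIV)"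
  proof (rule measurable_sum_nat)
    fix k assume k: "k \<in> I"
    note [measurable] = x[OF k] x[OF i]
    show "(\<lambda>\<omega>. if x \<omega> k \<le> x \<omega> i then 1 else (0 :: nat)) \<in> measurable M (count_space UNIV)"
      by measurable
  qed
  ultimately show ?thesis by simp
qed

text \<open>Two observations are required because the exchangeable covariance formula divides by
  \<open>card I - 1\<close>. The atomless law excludes ties almost surely and provides exact
  quantiles.\<close>

locale iid_pool = prob_space M for M :: "'a measure" +
  fixes I :: "'i set" and \<xi> :: "'i \<Rightarrow> 'a \<Rightarrow> real" and \<nu> :: "real measure"
  assumes finite_I: "finite I"
    and indep: "indep_vars (\<lambda>_. borel) \<xi> I"
    and law: "\<And>i. i \<in> I \<Longrightarrow> distr M borel (\<xi> i) = \<nu>"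
    and card_I: "2 \<le> card I"
    and atomless: "\<And>x. measure \<nu> {x} = 0"
begin

section \<open>Permutation invariance of the pooled sample\<close>

abbreviation "obs \<omega> \<equiv> (\<lambda>i\<in>I. \<xi> i \<omega>)"

lemma I_nonempty: "I \<noteq> {}" using card_I by auto

lemma rv: "i \<in> I \<Longrightarrow> \<xi> i \<in> borel_measurable M"
  using indep by (simp add: indep_vars_def2)

lemma real_distribution_law: "real_distribution \<nu>"
proof -
  obtain i where i: "i \<in> I" using I_nonempty by auto
  then show ?thesis unfolding law[OF i, symmetric] by (intro real_distribution_distr rv)
qed

lemma measurable_vec: "obs \<in> measurable M (Pi\<^sub>M I (\<lambda>_. borel))"
  by (intro measurable_restrict rv)

lemma distr_vec: "distr M (Pi\<^sub>M I (\<lambda>_. borel)) obs = Pi\<^sub>M I (\<lambda>_. \<nu>)"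
proof -
  have "distr M (Pi\<^sub>M I (\<lambda>_. borel)) obs = Pi\<^sub>M I (\<lambda>i. distr M borel (\<xi> i))"
    using indep_vars_iff_distr_eq_PiM'[OF I_nonempty, where M'="\<lambda>_. borel" and X=\<xi>] rv indep by blast
  also have "\<dots> = Pi\<^sub>M I (\<lambda>_. \<nu>)" by (intro PiM_cong law refl)
  finally show ?thesis .
qed

text \<open>The joint law is a power of one measure, and such a product measure is invariant under
  permutations of its coordinates.\<close>

lemma expectation_reindex:
  fixes f :: "('i \<Rightarrow> real) \<Rightarrow> real"
  assumes \<pi>: "bij_betw \<pi> I I" and f: "f \<in> borel_measurable (Pi\<^sub>M I (\<lambda>_. borel))"
  shows "expectation (\<lambda>\<omega>. f (\<lambda>i\<in>I. obs \<omega> (\<pi> i))) = expectation (\<lambda>\<omega>. f (obs \<omega>))"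
proof -
  interpret \<nu>: real_distribution \<nu> by (rule real_distribution_law)
  let ?T = "\<lambda>x :: 'i \<Rightarrow> real. \<lambda>i\<in>I. x (\<pi> i)"
  have sets: "sets (Pi\<^sub>M I (\<lambda>_. \<nu>)) = sets (Pi\<^sub>M I (\<lambda>_. borel))"
    by (intro sets_PiM_cong) auto
  have \<pi>I: "i \<in> I \<Longrightarrow> \<pi> i \<in> I" for i using \<pi> by (auto simp: bij_betw_def)
  have T: "?T \<in> measurable (Pi\<^sub>M I (\<lambda>_. borel)) (Pi\<^sub>M I (\<lambda>_. borel))"
    by (intro measurable_restrict measurable_component_singleton \<pi>I)
  then have T': "?T \<in> measurable (Pi\<^sub>M I (\<lambda>_. \<nu>)) (Pi\<^sub>M I (\<lambda>_. \<nu>))"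
    using measurable_cong_sets[OF sets sets] by blast
  have f': "f \<in> borel_measurable (Pi\<^sub>M I (\<lambda>_. \<nu>))"
    using f measurable_cong_sets[OF sets refl] by blast
  have "expectation (\<lambda>\<omega>. f (?T (obs \<omega>))) = (LINT x|distr M (Pi\<^sub>M I (\<lambda>_. borel)) obs. f (?T x))"
    by (rule integral_distr[symmetric, OF measurable_vec measurable_compose[OF T f]])
  also have "\<dots> = (LINT x|Pi\<^sub>M I (\<lambda>_. \<nu>). f (?T x))" by (simp only: distr_vec)
  also have "\<dots> = (LINT x|distr (Pi\<^sub>M I (\<lambda>_. \<nu>)) (Pi\<^sub>M I (\<lambda>_. \<nu>)) ?T. f x)"
    by (rule integral_distr[symmetric, OF T' f'])
  also have "distr (Pi\<^sub>M I (\<lambda>_. \<nu>)) (Pi\<^sub>M I (\<lambda>_. \<nu>)) ?T = Pi\<^sub>M I (\<lambda>_. \<nu>)"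
    by (rule distr_PiM_reindex) (use \<pi> \<nu>.prob_space_axioms in \<open>auto simp: bij_betw_def\<close>)
  also have "(LINT x|Pi\<^sub>M I (\<lambda>_. \<nu>). f x) = expectation (\<lambda>\<omega>. f (obs \<omega>))"
    unfolding distr_vec[symmetric] by (rule integral_distr[OF measurable_vec f])
  finally show ?thesis .
qed

text \<open>Exchangeability makes the second moments of an equivariant family two-valued, so that they are
  determined by the moments of the sums of the family and of its squares.\<close>

lemma equivariant_second_moment:
  fixes \<gamma> :: "'i \<Rightarrow> ('i \<Rightarrow> real) \<Rightarrow> real"
  assumes meas: "\<And>i. i \<in> I \<Longrightarrow> \<gamma> i \<in> borel_measurable (Pi\<^sub>M I (\<lambda>_. borel))"
    and bd: "\<And>i x. \<bar>\<gamma> i x\<bar> \<le> 1"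
    and equiv: "\<And>\<pi> i x. bij_betw \<pi> I I \<Longrightarrow> i \<in> I \<Longrightarrow> \<gamma> i (\<lambda>k\<in>I. x (\<pi> k)) = \<gamma> (\<pi> i) x"
    and a: "(\<Sum>i\<in>I. a i) = 0"
  shows "expectation (\<lambda>\<omega>. (\<Sum>i\<in>I. a i * \<gamma> i (obs \<omega>))\<^sup>2) = (\<Sum>i\<in>I. (a i)\<^sup>2) *
    (expectation (\<lambda>\<omega>. \<Sum>i\<in>I. (\<gamma> i (obs \<omega>))\<^sup>2) / card I
     - (expectation (\<lambda>\<omega>. (\<Sum>i\<in>I. \<gamma> i (obs \<omega>))\<^sup>2) - expectation (\<lambda>\<omega>. \<Sum>i\<in>I. (\<gamma> i (obs \<omega>))\<^sup>2))
        / (card I * (card I - 1)))"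
proof -
  define g where "g i k = expectation (\<lambda>\<omega>. \<gamma> i (obs \<omega>) * \<gamma> k (obs \<omega>))" for i k
  have m: "(\<lambda>\<omega>. \<gamma> i (obs \<omega>)) \<in> borel_measurable M" if "i \<in> I" for i
    using measurable_compose[OF measurable_vec meas[OF that]] .
  have int: "integrable M (\<lambda>\<omega>. \<gamma> i (obs \<omega>) * \<gamma> k (obs \<omega>))" if "i \<in> I" "k \<in> I" for i k
    by (rule integrable_const_bound[of _ 1])
      (use m that bd mult_mono[of "\<bar>\<gamma> i _\<bar>" 1 "\<bar>\<gamma> k _\<bar>" 1] in \<open>auto simp: abs_mult\<close>)
  have gp: "g i k = g (\<pi> i) (\<pi> k)" if "bij_betw \<pi> I I" "i \<in> I" "k \<in> I" for \<pi> i k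
  proof -
    have "expectation (\<lambda>\<omega>. (\<lambda>x. \<gamma> i x * \<gamma> k x) (\<lambda>j\<in>I. obs \<omega> (\<pi> j))) = g i k"
      unfolding g_def by (rule expectation_reindex) (use that meas in auto)
    then show ?thesis using that by (simp only: equiv) (simp add: g_def)
  qed
  \<comment> \<open>Transpositions suffice: one of them maps any diagonal pair to any other, and
    changing one index at a time connects any two off-diagonal pairs.\<close>
  have bij: "bij_betw (Transposition.transpose i k) I I" if "i \<in> I" "k \<in> I" for i k
    by (rule bij_betwI[where g="Transposition.transpose i k"]) (use that in \<open>auto simp: Transposition.transpose_def\<close>)
  have sym: "g i k = g k i" for i k by (simp add: g_def mult.commute)
  have diag: "g i i = g k k" if "i \<in> I" "k \<in> I" for i k
    using gp[OF bij[OF that] that(1) that(1)] by simp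
  have left: "g i k = g j k" if "i \<in> I" "j \<in> I" "k \<in> I" "i \<noteq> k" "j \<noteq> k" for i j k
    using gp[OF bij[OF that(1,2)] that(1,3)] that by simp
  have off: "g i k = g i' k'" if "i \<in> I" "k \<in> I" "i' \<in> I" "k' \<in> I" "i \<noteq> k" "i' \<noteq> k'" for i k i' k'
  proof (cases "i' = k")
    case False
    then show ?thesis using left[of i i' k] left[of k k' i'] that sym by metis
  next
    case True
    then show ?thesis using left[of i k' k] sym[of k' k] that by metis
  qed
  obtain i0 where i0: "i0 \<in> I" using I_nonempty by auto
  have "\<not> I \<subseteq> {i0}"
    using card_mono[of "{i0}" I] card_I by auto
  then obtain k0 where k0: "k0 \<in> I" "k0 \<noteq> i0" by auto
  let ?\<alpha> = "g i0 i0" and ?\<beta> = "g i0 k0"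
  have g_eq: "g i k = (if i = k then ?\<alpha> else ?\<beta>)" if "i \<in> I" "k \<in> I" for i k
    using diag[OF that(1) i0] off[OF that i0 k0(1) _ k0(2)[symmetric]] by auto
  have quad: "expectation (\<lambda>\<omega>. (\<Sum>i\<in>I. b i * \<gamma> i (obs \<omega>))\<^sup>2)
      = (\<Sum>i\<in>I. (b i)\<^sup>2) * (?\<alpha> - ?\<beta>) + ?\<beta> * (\<Sum>i\<in>I. b i)\<^sup>2" for b
  proof -
    have "expectation (\<lambda>\<omega>. (\<Sum>i\<in>I. b i * \<gamma> i (obs \<omega>))\<^sup>2)
        = expectation (\<lambda>\<omega>. \<Sum>i\<in>I. \<Sum>k\<in>I. b i * b k * (\<gamma> i (obs \<omega>) * \<gamma> k (obs \<omega>)))"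
      by (simp add: power2_eq_square sum_product mult_ac)
    also have "\<dots> = (\<Sum>i\<in>I. \<Sum>k\<in>I. b i * b k * g i k)"
      unfolding g_def by (simp add: int)
    finally show ?thesis by (simp add: sum_two_valued_quadratic_form[OF finite_I g_eq])
  qed
  have Q: "expectation (\<lambda>\<omega>. \<Sum>i\<in>I. (\<gamma> i (obs \<omega>))\<^sup>2) = card I * ?\<alpha>"
  proof -
    have "expectation (\<lambda>\<omega>. \<Sum>i\<in>I. (\<gamma> i (obs \<omega>))\<^sup>2) = (\<Sum>i\<in>I. g i i)"
      unfolding g_def power2_eq_square by (simp add: int)
    also have "\<dots> = (\<Sum>i\<in>I. ?\<alpha>)" by (intro sum.cong refl) (simp add: g_eq)
    finally show ?thesis by simp
  qed
  let ?c = "real (card I)" and ?d = "real (card I - 1)"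
  have c: "?c \<noteq> 0" "?d \<noteq> 0" "?c * ?d = ?c\<^sup>2 - ?c"
    using card_I by (auto simp: of_nat_diff power2_eq_square right_diff_distrib)
  \<comment> \<open>With all coefficients equal to 1 the quadratic form expresses
    \<open>?\<beta>\<close> through the second moment of the plain sum.\<close>
  have "expectation (\<lambda>\<omega>. (\<Sum>i\<in>I. \<gamma> i (obs \<omega>))\<^sup>2) = ?c * (?\<alpha> - ?\<beta>) + ?\<beta> * ?c\<^sup>2"
    using quad[of "\<lambda>_. 1"] by simp
  also have "\<dots> = ?c * ?\<alpha> + ?\<beta> * (?c * ?d)"
    unfolding c(3) by (simp add: algebra_simps)
  finally have "(expectation (\<lambda>\<omega>. (\<Sum>i\<in>I. \<gamma> i (obs \<omega>))\<^sup>2) - ?c * ?\<alpha>) / (?c * ?d) = ?\<beta>"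
    using c(1,2) by simp
  then have "?c * ?\<alpha> / ?c - (expectation (\<lambda>\<omega>. (\<Sum>i\<in>I. \<gamma> i (obs \<omega>))\<^sup>2) - ?c * ?\<alpha>) / (?c * ?d) = ?\<alpha> - ?\<beta>"
    using c(1) by simp
  then show ?thesis
    unfolding Q quad[of a] a of_nat_mult by simp
qed

text \<open>Two independent observations have a product law, whose diagonal is null by Fubini
  because single points are null; only finitely many pairs have to be considered.\<close>

lemma AE_inj: "AE \<omega> in M. inj_on (\<lambda>i. \<xi> i \<omega>) I"
proof -
  interpret \<nu>: real_distribution \<nu> by (rule real_distribution_law)
  interpret \<nu>\<nu>: pair_sigma_finite \<nu> \<nu> ..
  have "AE \<omega> in M. \<xi> i \<omega> \<noteq> \<xi> k \<omega>" if "i \<in> I" "k \<in> I" "i \<noteq> k" for i k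
  proof -
    have ind: "indep_var borel (\<xi> i) borel (\<xi> k)"
      using indep_vars_sum[of "{k}" i \<xi>] indep_vars_subset[OF indep, of "{i, k}"] that by simp
    have d: "distr M (borel \<Otimes>\<^sub>M borel) (\<lambda>\<omega>. (\<xi> i \<omega>, \<xi> k \<omega>)) = \<nu> \<Otimes>\<^sub>M \<nu>"
      using ind that by (simp add: indep_var_distribution_eq law)
    have "AE x in \<nu>. AE y in \<nu>. x \<noteq> y"
    proof (rule AE_I2)
      fix x :: real
      have "emeasure \<nu> {x} = 0" using atomless[of x] by (simp add: \<nu>.emeasure_eq_measure)
      then have "{x} \<in> null_sets \<nu>" by (intro null_setsI) auto
      then show "AE y in \<nu>. x \<noteq> y" by (rule AE_I'[of "{x}"]) auto
    qed
    then have "AE z in \<nu> \<Otimes>\<^sub>M \<nu>. fst z \<noteq> snd z"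
    proof (subst (asm) \<nu>\<nu>.AE_pair_iff[of "\<lambda>x y. x \<noteq> y"])
      show "{x \<in> space (\<nu> \<Otimes>\<^sub>M \<nu>). fst x \<noteq> snd x} \<in> sets (\<nu> \<Otimes>\<^sub>M \<nu>)"
        by measurable
    qed
    then have "AE z in distr M (borel \<Otimes>\<^sub>M borel) (\<lambda>\<omega>. (\<xi> i \<omega>, \<xi> k \<omega>)). fst z \<noteq> snd z"
      by (simp only: d)
    then show ?thesis
      by (subst (asm) AE_distr_iff) (use rv that in \<open>auto intro!: measurable_Pair\<close>)
  qed
  then have "AE \<omega> in M. \<forall>i\<in>I. \<forall>k\<in>I. i \<noteq> k \<longrightarrow> \<xi> i \<omega> \<noteq> \<xi> k \<omega>"
    using finite_I by (intro AE_finite_allI) auto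
  then show ?thesis by eventually_elim (auto simp: inj_on_def)
qed

section \<open>Moments of rank indicators and of threshold indicators\<close>

abbreviation "rnk \<omega> \<equiv> rank_in I (\<lambda>i. \<xi> i \<omega>)"

text \<open>Sampling without replacement. Without ties exactly \<open>r\<close> observations have
  rank at most \<open>r\<close>, so both moments in \<open>equivariant_second_moment\<close> are
  deterministic. The factor \<open>r * (card I - r)\<close> vanishes at both ends and later cancels
  the singular weight of the statistic.\<close>

lemma rank_second_moment:
  assumes r: "r \<le> card I" and a: "(\<Sum>i\<in>I. a i) = 0"
  shows "expectation (\<lambda>\<omega>. (\<Sum>i\<in>I. a i * of_bool (rnk \<omega> i \<le> r))\<^sup>2)
    = (\<Sum>i\<in>I. (a i)\<^sup>2) * (real r * (real (card I) - real r) / (real (card I) * (real (card I) - 1)))"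
proof -
  define \<gamma> :: "'i \<Rightarrow> ('i \<Rightarrow> real) \<Rightarrow> real" where "\<gamma> i x = of_bool (rank_in I x i \<le> r)" for i x
  have v: "\<gamma> i (obs \<omega>) = of_bool (rnk \<omega> i \<le> r)" if "i \<in> I" for i \<omega>
    using that by (simp add: \<gamma>_def rank_in_restrict)
  have S: "AE \<omega> in M. (\<Sum>i\<in>I. \<gamma> i (obs \<omega>)) = r"
    using AE_inj
  proof eventually_elim
    case (elim \<omega>)
    have "(\<Sum>i\<in>I. \<gamma> i (obs \<omega>)) = (\<Sum>i\<in>I. of_bool (rnk \<omega> i \<le> r))" by (simp add: v)
    also have "\<dots> = card {i \<in> I. rnk \<omega> i \<le> r}" using finite_I by (simp add: Int_def)
    finally show ?case using card_rank_in_le[OF finite_I elim r] by simp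
  qed
  have m: "\<gamma> i \<in> borel_measurable (Pi\<^sub>M I (\<lambda>_. borel))" if "i \<in> I" for i
  proof -
    have [measurable]: "(\<lambda>x. rank_in I x i) \<in> measurable (Pi\<^sub>M I (\<lambda>_. borel)) (count_space UNIV)"
      by (rule measurable_rank_in[OF finite_I that]) simp
    show ?thesis unfolding \<gamma>_def by measurable
  qed
  have mS: "(\<lambda>\<omega>. \<Sum>i\<in>I. \<gamma> i (obs \<omega>)) \<in> borel_measurable M"
    using measurable_compose[OF measurable_vec m] by simp
  have sq: "(\<gamma> i x)\<^sup>2 = \<gamma> i x" for i x by (simp add: \<gamma>_def of_bool_def)
  have 1: "expectation (\<lambda>\<omega>. \<Sum>i\<in>I. (\<gamma> i (obs \<omega>))\<^sup>2) = r"
  proof -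
    have "expectation (\<lambda>\<omega>. \<Sum>i\<in>I. (\<gamma> i (obs \<omega>))\<^sup>2) = expectation (\<lambda>\<omega>. \<Sum>i\<in>I. \<gamma> i (obs \<omega>))"
      by (simp only: sq)
    also have "\<dots> = expectation (\<lambda>_. real r)" by (rule integral_cong_AE) (use S mS in auto)
    finally show ?thesis by (simp add: prob_space)
  qed
  have 2: "expectation (\<lambda>\<omega>. (\<Sum>i\<in>I. \<gamma> i (obs \<omega>))\<^sup>2) = (real r)\<^sup>2"
  proof -
    have "expectation (\<lambda>\<omega>. (\<Sum>i\<in>I. \<gamma> i (obs \<omega>))\<^sup>2) = expectation (\<lambda>_. (real r)\<^sup>2)"
      by (rule integral_cong_AE) (use S mS in auto)
    then show ?thesis by (simp add: prob_space)
  qed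
  have "expectation (\<lambda>\<omega>. (\<Sum>i\<in>I. a i * of_bool (rnk \<omega> i \<le> r))\<^sup>2)
      = expectation (\<lambda>\<omega>. (\<Sum>i\<in>I. a i * \<gamma> i (obs \<omega>))\<^sup>2)"
    by (simp add: v)
  also have "\<dots> = (\<Sum>i\<in>I. (a i)\<^sup>2) * (real r / card I - ((real r)\<^sup>2 - real r) / (card I * (card I - 1)))"
  proof -
    have bd: "\<bar>\<gamma> i x\<bar> \<le> 1" for i x by (simp add: \<gamma>_def)
    have "\<gamma> i (\<lambda>k\<in>I. x (\<pi> k)) = \<gamma> (\<pi> i) x" if "bij_betw \<pi> I I" "i \<in> I" for \<pi> i x
      using that by (simp add: \<gamma>_def rank_in_reindex)
    from equivariant_second_moment[of \<gamma>, OF m bd this a] show ?thesis by (simp only: 1 2)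
  qed
  also have "real r / card I - ((real r)\<^sup>2 - real r) / (card I * (card I - 1))
      = real r * (real (card I) - real r) / (real (card I) * (real (card I) - 1))"
    using card_I by (simp add: of_nat_diff divide_simps) (simp add: algebra_simps power2_eq_square)
  finally show ?thesis .
qed

lemma indicator_centered:
  assumes "i \<in> I"
  shows "(\<lambda>\<omega>. of_bool (\<xi> i \<omega> \<le> s) - measure \<nu> {..s}) \<in> borel_measurable M"
    "\<bar>of_bool (\<xi> i \<omega> \<le> s) - measure \<nu> {..s}\<bar> \<le> 1"
    "expectation (\<lambda>\<omega>. of_bool (\<xi> i \<omega> \<le> s) - measure \<nu> {..s}) = 0"
proof -
  note [measurable] = rv[OF assms]
  interpret \<nu>: real_distribution \<nu> by (rule real_distribution_law)
  show m: "(\<lambda>\<omega>. of_bool (\<xi> i \<omega> \<le> s) - measure \<nu> {..s}) \<in> borel_measurable M" by measurable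
  show "\<bar>of_bool (\<xi> i \<omega> \<le> s) - measure \<nu> {..s}\<bar> \<le> 1"
  proof -
    have "\<bar>of_bool b - p\<bar> \<le> 1" if "0 \<le> p" "p \<le> 1" for b and p :: real
      using that by (cases b) auto
    then show ?thesis by simp
  qed
  have "measure \<nu> {..s} = measure M (\<xi> i -` {..s} \<inter> space M)"
    unfolding law[OF assms, symmetric] by (subst measure_distr) auto
  also have "\<dots> = expectation (indicator (\<xi> i -` {..s} \<inter> space M))" by simp
  also have "\<dots> = expectation (\<lambda>\<omega>. of_bool (\<xi> i \<omega> \<le> s))"
    by (intro Bochner_Integration.integral_cong) (auto simp: indicator_def)
  finally have e: "measure \<nu> {..s} = expectation (\<lambda>\<omega>. of_bool (\<xi> i \<omega> \<le> s))" .
  have "integrable M (\<lambda>\<omega>. of_bool (\<xi> i \<omega> \<le> s) :: real)"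
    by (rule integrable_const_bound[of _ 1]) auto
  then show "expectation (\<lambda>\<omega>. of_bool (\<xi> i \<omega> \<le> s) - measure \<nu> {..s}) = 0"
    by (simp add: prob_space e)
qed

text \<open>Induction on the index set. In the fourth power the two odd mixed terms vanish, one
  because the new summand is centered and one because the partial sum is, so the mean is part of the
  induction. The step uses \<open>1 + 6 * n + 3 * n * n \<le> 3 * (n + 1) * (n + 1)\<close>.\<close>

lemma independent_sum_moments:
  fixes \<eta> :: "'i \<Rightarrow> 'a \<Rightarrow> real"
  assumes "finite A" "indep_vars (\<lambda>_. borel) \<eta> A"
    and bd: "\<And>i \<omega>. i \<in> A \<Longrightarrow> \<bar>\<eta> i \<omega>\<bar> \<le> 1" and mean: "\<And>i. i \<in> A \<Longrightarrow> expectation (\<eta> i) = 0"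
  shows "expectation (\<lambda>\<omega>. \<Sum>i\<in>A. \<eta> i \<omega>) = 0 \<and> expectation (\<lambda>\<omega>. (\<Sum>i\<in>A. \<eta> i \<omega>)\<^sup>2) \<le> card A \<and>
    expectation (\<lambda>\<omega>. (\<Sum>i\<in>A. \<eta> i \<omega>) ^ 4) \<le> 3 * (real (card A))\<^sup>2"
  using assms
proof (induction A rule: finite_induct)
  case (insert x A)
  let ?S = "\<lambda>\<omega>. \<Sum>i\<in>A. \<eta> i \<omega>"
  have iA: "indep_vars (\<lambda>_. borel) \<eta> A" by (rule indep_vars_subset[OF insert.prems(1)]) auto
  have IH: "expectation ?S = 0" "expectation (\<lambda>\<omega>. (?S \<omega>)\<^sup>2) \<le> card A"
    "expectation (\<lambda>\<omega>. ?S \<omega> ^ 4) \<le> 3 * (real (card A))\<^sup>2"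
    using insert.IH[OF iA insert.prems(2,3)] by auto
  have rvs: "\<eta> i \<in> borel_measurable M" if "i \<in> insert x A" for i
    using insert.prems(1) that unfolding indep_vars_def2 by blast
  have mS: "?S \<in> borel_measurable M" using rvs by simp
  have bS: "\<bar>?S \<omega>\<bar> \<le> card A" for \<omega>
    using sum_bounded_above[of A "\<lambda>i. \<bar>\<eta> i \<omega>\<bar>" 1] insert.prems(2)
    by (intro order_trans[OF sum_abs]) auto
  have ind: "indep_var borel (\<eta> x) borel ?S"
    by (rule indep_vars_sum[OF insert.hyps(1,2) insert.prems(1)])
  have intx: "integrable M (\<lambda>\<omega>. \<eta> x \<omega> ^ p)" for p
    by (rule integrable_const_bound[of _ 1])
      (use rvs insert.prems(2) in \<open>auto simp: power_abs intro!: power_le_one\<close>)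
  have intS: "integrable M (\<lambda>\<omega>. ?S \<omega> ^ q)" for q
    by (rule integrable_const_bound[of _ "real (card A) ^ q"])
      (use mS bS in \<open>auto simp: power_abs intro!: power_mono\<close>)
  have ind': "indep_var borel (\<lambda>\<omega>. \<eta> x \<omega> ^ p) borel (\<lambda>\<omega>. ?S \<omega> ^ q)" for p q
    using indep_var_compose[OF ind, of "\<lambda>u. u ^ p" borel "\<lambda>u. u ^ q" borel] by (simp add: comp_def)
  have prod: "expectation (\<lambda>\<omega>. \<eta> x \<omega> ^ p * ?S \<omega> ^ q) = expectation (\<lambda>\<omega>. \<eta> x \<omega> ^ p) * expectation (\<lambda>\<omega>. ?S \<omega> ^ q)"
    "integrable M (\<lambda>\<omega>. \<eta> x \<omega> ^ p * ?S \<omega> ^ q)" for p q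
    using indep_var_lebesgue_integral[OF ind' intx intS] indep_var_integrable[OF ind' intx intS] by auto
  have ex: "expectation (\<lambda>\<omega>. \<eta> x \<omega> ^ 2) \<le> 1" "expectation (\<lambda>\<omega>. \<eta> x \<omega> ^ 4) \<le> 1"
    "expectation (\<lambda>\<omega>. \<eta> x \<omega> ^ 1) = 0"
  proof -
    have "expectation (\<lambda>\<omega>. \<eta> x \<omega> ^ p) \<le> expectation (\<lambda>_. 1)" for p
    proof (intro integral_mono intx)
      fix \<omega>
      have "\<bar>\<eta> x \<omega>\<bar> ^ p \<le> 1" using insert.prems(2)[of x \<omega>] by (intro power_le_one) auto
      then show "\<eta> x \<omega> ^ p \<le> 1" using abs_ge_self[of "\<eta> x \<omega> ^ p"] by (simp add: power_abs)
    qed simp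
    then show "expectation (\<lambda>\<omega>. \<eta> x \<omega> ^ 2) \<le> 1" "expectation (\<lambda>\<omega>. \<eta> x \<omega> ^ 4) \<le> 1"
      by (simp_all add: prob_space)
    show "expectation (\<lambda>\<omega>. \<eta> x \<omega> ^ 1) = 0" using insert.prems(3)[of x] by simp
  qed
  have "expectation (\<lambda>\<omega>. \<eta> x \<omega> + ?S \<omega>) = 0"
    using intx[of 1] intS[of 1] ex(3) IH(1) by simp
  moreover have "expectation (\<lambda>\<omega>. (\<eta> x \<omega> + ?S \<omega>)\<^sup>2) \<le> card A + 1"
  proof -
    have "expectation (\<lambda>\<omega>. (\<eta> x \<omega> + ?S \<omega>)\<^sup>2)
        = expectation (\<lambda>\<omega>. \<eta> x \<omega> ^ 2 + 2 * (\<eta> x \<omega> ^ 1 * ?S \<omega> ^ 1) + ?S \<omega> ^ 2)"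
      by (simp add: power2_sum algebra_simps)
    also have "\<dots> = expectation (\<lambda>\<omega>. \<eta> x \<omega> ^ 2) + expectation (\<lambda>\<omega>. ?S \<omega> ^ 2)"
      using intx[of 2] intS[of 2] prod(2)[of 1 1] prod(1)[of 1 1] ex(3) by simp
    finally show ?thesis using ex(1) IH(2) by simp
  qed
  moreover have "expectation (\<lambda>\<omega>. (\<eta> x \<omega> + ?S \<omega>) ^ 4) \<le> 3 * (real (card A) + 1)\<^sup>2"
  proof -
    have "(a + b) ^ 4 = a ^ 4 + 4 * (a ^ 3 * b ^ 1) + 6 * (a ^ 2 * b ^ 2) + 4 * (a ^ 1 * b ^ 3) + b ^ 4"
      for a b :: real
      by (simp add: power4_eq_xxxx power3_eq_cube power2_eq_square algebra_simps)
    then have "expectation (\<lambda>\<omega>. (\<eta> x \<omega> + ?S \<omega>) ^ 4) = expectation (\<lambda>\<omega>. \<eta> x \<omega> ^ 4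
        + 4 * (\<eta> x \<omega> ^ 3 * ?S \<omega> ^ 1) + 6 * (\<eta> x \<omega> ^ 2 * ?S \<omega> ^ 2)
        + 4 * (\<eta> x \<omega> ^ 1 * ?S \<omega> ^ 3) + ?S \<omega> ^ 4)"
      by (simp only:)
    also have "\<dots> = expectation (\<lambda>\<omega>. \<eta> x \<omega> ^ 4)
        + 6 * (expectation (\<lambda>\<omega>. \<eta> x \<omega> ^ 2) * expectation (\<lambda>\<omega>. ?S \<omega> ^ 2)) + expectation (\<lambda>\<omega>. ?S \<omega> ^ 4)"
      using intx[of 4] intS[of 4] prod(2)[of 3 1] prod(2)[of 2 2] prod(2)[of 1 3]
        prod(1)[of 3 1] prod(1)[of 2 2] prod(1)[of 1 3] ex(3) IH(1) by simp
    also have "\<dots> \<le> 1 + 6 * (1 * card A) + 3 * (real (card A))\<^sup>2"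
    proof -
      have "expectation (\<lambda>\<omega>. \<eta> x \<omega> ^ 2) * expectation (\<lambda>\<omega>. ?S \<omega> ^ 2) \<le> 1 * real (card A)"
        by (rule mult_mono) (use ex(1) IH(2) in simp_all)
      then show ?thesis using ex(2) IH(3) by linarith
    qed
    also have "\<dots> \<le> 3 * (real (card A) + 1)\<^sup>2"
      by (simp add: power2_eq_square algebra_simps)
    finally show ?thesis .
  qed
  ultimately show ?case using insert.hyps by (simp add: add.commute)
qed (simp add: prob_space)

lemma indicator_sum_moments:
  assumes A: "A \<subseteq> I"
  shows "expectation (\<lambda>\<omega>. (\<Sum>i\<in>A. of_bool (\<xi> i \<omega> \<le> s) - measure \<nu> {..s})\<^sup>2) \<le> card A"
    "expectation (\<lambda>\<omega>. (\<Sum>i\<in>A. of_bool (\<xi> i \<omega> \<le> s) - measure \<nu> {..s}) ^ 4) \<le> 3 * (real (card A))\<^sup>2"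
proof -
  have "indep_vars (\<lambda>_. borel) (\<lambda>i \<omega>. of_bool (\<xi> i \<omega> \<le> s) - measure \<nu> {..s}) A"
    by (rule indep_vars_compose2[OF indep_vars_subset[OF indep A]]) measurable
  from independent_sum_moments[OF finite_subset[OF A finite_I] this indicator_centered(2,3)] A
  show "expectation (\<lambda>\<omega>. (\<Sum>i\<in>A. of_bool (\<xi> i \<omega> \<le> s) - measure \<nu> {..s})\<^sup>2) \<le> card A"
    "expectation (\<lambda>\<omega>. (\<Sum>i\<in>A. of_bool (\<xi> i \<omega> \<le> s) - measure \<nu> {..s}) ^ 4) \<le> 3 * (real (card A))\<^sup>2"
    by auto
qed

text \<open>The observations of rank at most \<open>r\<close> and those that are at most \<open>s\<close> are both lower sets, hence
  nested, so that all the differences of the two indicators have the same sign.\<close>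

lemma rank_indicator_second_moment:
  assumes r: "r \<le> card I" and a: "(\<Sum>i\<in>I. a i) = 0"
  shows "expectation (\<lambda>\<omega>. (\<Sum>i\<in>I. a i * (of_bool (rnk \<omega> i \<le> r) - of_bool (\<xi> i \<omega> \<le> s)))\<^sup>2)
    \<le> (\<Sum>i\<in>I. (a i)\<^sup>2) * (\<bar>real r / card I - measure \<nu> {..s}\<bar> + 1 / sqrt (card I))"
proof -
  define \<gamma> :: "'i \<Rightarrow> ('i \<Rightarrow> real) \<Rightarrow> real"
    where "\<gamma> i x = of_bool (rank_in I x i \<le> r) - of_bool (x i \<le> s)" for i x
  define S where "S \<omega> = (\<Sum>i\<in>I. \<gamma> i (obs \<omega>))" for \<omega>
  define D where "D \<omega> = (\<Sum>i\<in>I. of_bool (\<xi> i \<omega> \<le> s) - measure \<nu> {..s})" for \<omega>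
  have v: "\<gamma> i (obs \<omega>) = of_bool (rnk \<omega> i \<le> r) - of_bool (\<xi> i \<omega> \<le> s)" if "i \<in> I" for i \<omega>
    using that by (simp add: \<gamma>_def rank_in_restrict)
  have m: "\<gamma> i \<in> borel_measurable (Pi\<^sub>M I (\<lambda>_. borel))" if "i \<in> I" for i
  proof -
    have [measurable]: "(\<lambda>x. rank_in I x i) \<in> measurable (Pi\<^sub>M I (\<lambda>_. borel)) (count_space UNIV)"
      by (rule measurable_rank_in[OF finite_I that]) simp
    have [measurable]: "(\<lambda>x. x i) \<in> borel_measurable (Pi\<^sub>M I (\<lambda>_. borel))"
      using that by simp
    show ?thesis unfolding \<gamma>_def by measurable
  qed
  have mv: "(\<lambda>\<omega>. \<gamma> i (obs \<omega>)) \<in> borel_measurable M" if "i \<in> I" for i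
    using measurable_compose[OF measurable_vec m[OF that]] .
  have mS: "S \<in> borel_measurable M" unfolding S_def using mv by simp
  have mD: "D \<in> borel_measurable M" unfolding D_def using indicator_centered(1) by simp
  have bS: "\<bar>S \<omega>\<bar> \<le> card I" for \<omega>
    unfolding S_def using sum_bounded_above[of I "\<lambda>i. \<bar>\<gamma> i (obs \<omega>)\<bar>" 1]
    by (intro order_trans[OF sum_abs]) (auto simp: \<gamma>_def)
  have intS: "integrable M S" "integrable M (\<lambda>\<omega>. (S \<omega>)\<^sup>2)" "integrable M (\<lambda>\<omega>. \<bar>S \<omega>\<bar>)"
    using mS bS
    by (auto intro: integrable_const_bound[of _ "real (card I)"]
        integrable_const_bound[of _ "(real (card I))\<^sup>2"] simp: abs_le_square_iff[symmetric])
  have sq: "(\<Sum>i\<in>I. (\<gamma> i (obs \<omega>))\<^sup>2) = \<bar>S \<omega>\<bar>" for \<omega>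
  proof (cases "\<exists>i\<in>I. rnk \<omega> i \<le> r \<and> \<not> \<xi> i \<omega> \<le> s")
    case True
    then obtain i where i: "i \<in> I" "rnk \<omega> i \<le> r" "s < \<xi> i \<omega>" by auto
    have "rnk \<omega> k \<le> r" if "k \<in> I" "\<xi> k \<omega> \<le> s" for k
      using rank_in_mono[OF finite_I, of "\<lambda>i. \<xi> i \<omega>" k i] i that by auto
    then have "\<gamma> k (obs \<omega>) = (\<gamma> k (obs \<omega>))\<^sup>2" if "k \<in> I" for k
      using that by (auto simp: v)
    then have "S \<omega> = (\<Sum>i\<in>I. (\<gamma> i (obs \<omega>))\<^sup>2)" unfolding S_def by (intro sum.cong) auto
    then show ?thesis by (simp add: sum_nonneg)
  next
    case False
    then have "- \<gamma> k (obs \<omega>) = (\<gamma> k (obs \<omega>))\<^sup>2" if "k \<in> I" for k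
      using that by (auto simp: v)
    then have "- S \<omega> = (\<Sum>i\<in>I. (\<gamma> i (obs \<omega>))\<^sup>2)"
      unfolding S_def sum_negf[symmetric] by (intro sum.cong) auto
    moreover have "0 \<le> (\<Sum>i\<in>I. (\<gamma> i (obs \<omega>))\<^sup>2)" by (simp add: sum_nonneg)
    ultimately show ?thesis by simp
  qed
  have int: "\<bar>S \<omega>\<bar> \<le> (S \<omega>)\<^sup>2" for \<omega>
  proof -
    have "S \<omega> = real_of_int (\<Sum>i\<in>I. of_bool (rank_in I (obs \<omega>) i \<le> r) - of_bool (obs \<omega> i \<le> s))"
      by (simp add: S_def \<gamma>_def)
    then obtain z :: int where z: "S \<omega> = real_of_int z" by blast
    have "\<bar>z\<bar> * 1 \<le> \<bar>z\<bar> * \<bar>z\<bar>" by (cases "z = 0") (simp, intro mult_left_mono, auto)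
    then have "\<bar>z\<bar> \<le> z\<^sup>2" by (simp add: power2_eq_square)
    then have "real_of_int \<bar>z\<bar> \<le> real_of_int (z\<^sup>2)" by (simp only: of_int_le_iff)
    then show ?thesis by (simp add: z)
  qed
  have ES: "expectation (\<lambda>\<omega>. \<bar>S \<omega>\<bar>) / card I \<le> \<bar>real r / card I - measure \<nu> {..s}\<bar> + 1 / sqrt (card I)"
  proof -
    have n: "0 < real (card I)" using card_I by simp
    have D4: "expectation (\<lambda>\<omega>. (D \<omega>)\<^sup>2) \<le> card I"
      unfolding D_def using indicator_sum_moments(1)[of I s] by simp
    have bD: "\<bar>D \<omega>\<bar> \<le> card I" for \<omega>
      unfolding D_def using sum_bounded_above[of I "\<lambda>i. \<bar>of_bool (\<xi> i \<omega> \<le> s) - measure \<nu> {..s}\<bar>" 1]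
        indicator_centered(2)
      by (intro order_trans[OF sum_abs]) auto
    have intD: "integrable M (\<lambda>\<omega>. \<bar>D \<omega>\<bar>)" "integrable M (\<lambda>\<omega>. (D \<omega>)\<^sup>2)"
      using mD bD
      by (auto intro: integrable_const_bound[of _ "real (card I)"]
          integrable_const_bound[of _ "(real (card I))\<^sup>2"] simp: abs_le_square_iff[symmetric])
    \<comment> \<open>Without ties \<open>S\<close> is \<open>r\<close> minus the number of
      observations up to \<open>s\<close>, so \<open>S\<close> is a deterministic offset minus the
      centered count \<open>D\<close>, whose standard deviation is at most the root of the sample
      size.\<close>
    have "expectation (\<lambda>\<omega>. \<bar>S \<omega>\<bar>) \<le> expectation (\<lambda>\<omega>. \<bar>real r - card I * measure \<nu> {..s}\<bar> + \<bar>D \<omega>\<bar>)"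
    proof (rule integral_mono_AE)
      show "AE \<omega> in M. \<bar>S \<omega>\<bar> \<le> \<bar>real r - card I * measure \<nu> {..s}\<bar> + \<bar>D \<omega>\<bar>"
        using AE_inj
      proof eventually_elim
        case (elim \<omega>)
        have "S \<omega> = (\<Sum>i\<in>I. of_bool (rnk \<omega> i \<le> r)) - (\<Sum>i\<in>I. of_bool (\<xi> i \<omega> \<le> s))"
          unfolding S_def sum_subtractf[symmetric] by (intro sum.cong) (auto simp: v)
        also have "(\<Sum>i\<in>I. of_bool (rnk \<omega> i \<le> r)) = real (card {i \<in> I. rnk \<omega> i \<le> r})"
          using finite_I by (simp add: Int_def)
        also have "card {i \<in> I. rnk \<omega> i \<le> r} = r" by (rule card_rank_in_le[OF finite_I elim r])
        finally have "S \<omega> = real r - card I * measure \<nu> {..s} - D \<omega>"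
          by (simp add: D_def sum_subtractf)
        then show ?case by linarith
      qed
    qed (use intS intD in auto)
    also have "\<dots> = \<bar>real r - card I * measure \<nu> {..s}\<bar> + expectation (\<lambda>\<omega>. \<bar>D \<omega>\<bar>)"
      using intD by (simp add: prob_space)
    also have "expectation (\<lambda>\<omega>. \<bar>D \<omega>\<bar>) \<le> sqrt (card I)"
    proof -
      have "0 \<le> expectation (\<lambda>\<omega>. (\<bar>D \<omega>\<bar> - expectation (\<lambda>\<omega>. \<bar>D \<omega>\<bar>))\<^sup>2)" by simp
      also have "\<dots> = expectation (\<lambda>\<omega>. \<bar>D \<omega>\<bar>\<^sup>2) - (expectation (\<lambda>\<omega>. \<bar>D \<omega>\<bar>))\<^sup>2"
        using intD by (intro variance_eq) auto
      finally have "(expectation (\<lambda>\<omega>. \<bar>D \<omega>\<bar>))\<^sup>2 \<le> card I" using D4 by simp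
      then show ?thesis by (rule real_le_rsqrt)
    qed
    finally have "expectation (\<lambda>\<omega>. \<bar>S \<omega>\<bar>) / card I
        \<le> (\<bar>real r - card I * measure \<nu> {..s}\<bar> + sqrt (card I)) / card I"
      using n by (simp add: divide_right_mono)
    also have "\<dots> = \<bar>real r - card I * measure \<nu> {..s}\<bar> / card I + 1 / sqrt (card I)"
      using n by (simp add: add_divide_distrib sqrt_divide_self_eq inverse_eq_divide)
    also have "\<bar>real r - card I * measure \<nu> {..s}\<bar> / card I = \<bar>(real r - card I * measure \<nu> {..s}) / card I\<bar>"
      using n by simp
    also have "(real r - card I * measure \<nu> {..s}) / card I = real r / card I - measure \<nu> {..s}"
      using n by (simp add: field_simps)
    finally show ?thesis .
  qed
  have "expectation (\<lambda>\<omega>. (\<Sum>i\<in>I. a i * (of_bool (rnk \<omega> i \<le> r) - of_bool (\<xi> i \<omega> \<le> s)))\<^sup>2)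
      = expectation (\<lambda>\<omega>. (\<Sum>i\<in>I. a i * \<gamma> i (obs \<omega>))\<^sup>2)"
    by (simp add: v)
  also have "\<dots> = (\<Sum>i\<in>I. (a i)\<^sup>2) * (expectation (\<lambda>\<omega>. \<bar>S \<omega>\<bar>) / card I
      - (expectation (\<lambda>\<omega>. (S \<omega>)\<^sup>2) - expectation (\<lambda>\<omega>. \<bar>S \<omega>\<bar>)) / (card I * (card I - 1)))"
  proof -
    have bd: "\<bar>\<gamma> i x\<bar> \<le> 1" for i x by (simp add: \<gamma>_def)
    have "\<gamma> i (\<lambda>k\<in>I. x (\<pi> k)) = \<gamma> (\<pi> i) x" if "bij_betw \<pi> I I" "i \<in> I" for \<pi> i x
      using that by (simp add: \<gamma>_def rank_in_reindex)
    from equivariant_second_moment[of \<gamma>, OF m bd this a] show ?thesis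
      by (simp only: sq S_def[symmetric])
  qed
  also have "\<dots> \<le> (\<Sum>i\<in>I. (a i)\<^sup>2) * (expectation (\<lambda>\<omega>. \<bar>S \<omega>\<bar>) / card I)"
  proof (intro mult_left_mono)
    have "expectation (\<lambda>\<omega>. \<bar>S \<omega>\<bar>) \<le> expectation (\<lambda>\<omega>. (S \<omega>)\<^sup>2)"
      using intS int by (intro integral_mono) auto
    then show "expectation (\<lambda>\<omega>. \<bar>S \<omega>\<bar>) / card I
      - (expectation (\<lambda>\<omega>. (S \<omega>)\<^sup>2) - expectation (\<lambda>\<omega>. \<bar>S \<omega>\<bar>)) / (card I * (card I - 1))
      \<le> expectation (\<lambda>\<omega>. \<bar>S \<omega>\<bar>) / card I"
      by simp
  qed (simp add: sum_nonneg)
  also have "\<dots> \<le> (\<Sum>i\<in>I. (a i)\<^sup>2) * (\<bar>real r / card I - measure \<nu> {..s}\<bar> + 1 / sqrt (card I))"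
    by (intro mult_left_mono ES) (simp add: sum_nonneg)
  finally show ?thesis .
qed

end

section \<open>The test statistic as a function of the ranks\<close>

lemma borel_measurable_vec_lambda:
  fixes f :: "'k::finite \<Rightarrow> 'a \<Rightarrow> real"
  assumes "\<And>j. f j \<in> borel_measurable M"
  shows "(\<lambda>x. \<chi> j. f j x) \<in> borel_measurable M"
proof (rule borel_measurable_euclidean_space[THEN iffD2], intro ballI)
  fix b :: "(real, 'k) vec" assume "b \<in> Basis"
  have "(\<lambda>x. (\<chi> j. f j x) \<bullet> b) = (\<lambda>x. \<Sum>j\<in>UNIV. f j x * b $ j)"
    by (simp add: inner_vec_def)
  then show "(\<lambda>x. (\<chi> j. f j x) \<bullet> b) \<in> borel_measurable M"
    using assms by simp
qed

text \<open>The empirical cdf is the cdf of the image under \<open>u\<close> of the uniform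
  distribution on the indices; integrals against it are therefore averages, with ties counted with
  multiplicity.\<close>

lemma ecdf_measure:
  assumes "finite I" "I \<noteq> {}"
  shows "interval_measure (ecdf I u) = distr (measure_pmf (pmf_of_set I)) borel u"
proof -
  let ?\<mu> = "distr (measure_pmf (pmf_of_set I)) borel u"
  interpret \<mu>: real_distribution ?\<mu> by (rule prob_space.real_distribution_distr) (auto intro: measure_pmf.prob_space_axioms)
  have cdf: "ecdf I u = cdf ?\<mu>"
  proof
    fix x
    have "cdf ?\<mu> x = measure (measure_pmf (pmf_of_set I)) {i. u i \<le> x}"
      unfolding cdf_def by (subst measure_distr) (auto simp: vimage_def)
    then show "ecdf I u x = cdf ?\<mu> x"
      using assms by (simp add: measure_pmf_of_set ecdf_def Int_def)
  qed
  show ?thesis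
  proof (rule cdf_unique)
    show "real_distribution (interval_measure (ecdf I u))"
      unfolding cdf using \<mu>.cdf_nondecreasing \<mu>.cdf_is_right_cont \<mu>.cdf_lim_at_bot \<mu>.cdf_lim_at_top_prob
      by (intro real_distribution_interval_measure) auto
    show "cdf (interval_measure (ecdf I u)) = cdf ?\<mu>"
      unfolding cdf using \<mu>.cdf_nondecreasing \<mu>.cdf_is_right_cont \<mu>.cdf_lim_at_bot
      by (intro cdf_interval_measure) auto
  qed (rule \<mu>.real_distribution_axioms)
qed

lemma integral_ecdf:
  fixes g :: "real \<Rightarrow> real"
  assumes "finite I" "I \<noteq> {}" "g \<in> borel_measurable borel"
  shows "(LINT x|interval_measure (ecdf I u). g x) = (\<Sum>i\<in>I. g (u i)) / card I"
  unfolding ecdf_measure[OF assms(1,2)]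
  by (subst integral_distr) (use assms in \<open>auto simp: integral_pmf_of_set\<close>)

lemma ln_rpow: "0 < b \<or> e = 0 \<Longrightarrow> ln (rpow b e) = e * ln b"
  by (auto simp: rpow_def ln_powr)

lemma rpow_pos: "0 < b \<or> e = 0 \<Longrightarrow> 0 < rpow b e"
  by (auto simp: rpow_def)

lemma measurable_rpow:
  assumes [measurable]: "f \<in> borel_measurable M" "g \<in> borel_measurable M"
  shows "(\<lambda>x. rpow (f x) (g x)) \<in> borel_measurable M"
  unfolding rpow_def by measurable

locale samples = weights w for w :: "real ^ 'k::{finite,linorder}" +
  fixes N :: "'k \<Rightarrow> nat"
  assumes proportion: "\<And>j. w $ j = real (N j) / real (\<Sum>i\<in>UNIV. N i)"
begin

definition pool :: "('k \<times> nat) set" where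
  "pool = (SIGMA j:UNIV. {..<N j})"

definition size :: nat where
  "size = (\<Sum>j\<in>UNIV. N j)"

text \<open>Without ties this is the vector of sample ecdfs at the \<open>r\<close>-th smallest
  pooled observation, expressed through ranks alone and not through order statistics.\<close>

definition rank_ecdf :: "('k \<times> nat \<Rightarrow> real) \<Rightarrow> nat \<Rightarrow> (real, 'k) vec" where
  "rank_ecdf x r = (\<chi> j. (\<Sum>i<N j. of_bool (rank_in pool x (j, i) \<le> r)) / N j)"

text \<open>Without ties and for \<open>r\<close> from 1 to \<open>size\<close>, this is the value
  of \<open>-2 ln R\<close> at the \<open>r\<close>-th smallest pooled observation.\<close>

definition rank_stat :: "('k \<times> nat \<Rightarrow> real) \<Rightarrow> nat \<Rightarrow> real" where
  "rank_stat x r = 2 * size * (\<Sum>j\<in>UNIV. w $ j * bern_kl (proj (rank_ecdf x r) $ j) (r / size))"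

lemma finite_pool: "finite pool" and card_pool: "card pool = size"
  by (simp_all add: pool_def size_def)

lemma N_pos: "0 < N j"
  using weight_pos[of j] proportion[of j] by (cases "N j") auto

lemma size_pos: "0 < size"
  unfolding size_def using N_pos by (intro sum_pos) auto

lemma N_eq: "real (N j) = w $ j * size"
  using size_pos unfolding proportion size_def by (simp del: of_nat_sum)

lemma pool_nonempty: "pool \<noteq> {}"
  using card_pool size_pos by auto

text \<open>The pooled ecdf is the weighted mean of the sample ecdfs, so the log ratio depends on
  \<open>x\<close> only through the vector of their values; measurability then follows by
  composition.\<close>

definition log_ratio :: "(real, 'k) vec \<Rightarrow> real" where
  "log_ratio y = ln (\<Prod>j\<in>UNIV.
     rpow (wmean y / proj y $ j) (real (N j) * y $ j) *
     rpow ((1 - wmean y) / (1 - proj y $ j)) (real (N j) * (1 - y $ j)))"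

lemma measurable_proj: "(\<lambda>y. proj y $ j) \<in> borel_measurable borel"
  by (intro borel_measurable_continuous_onI continuous_proj)

lemma measurable_log_ratio: "log_ratio \<in> borel_measurable borel"
proof -
  note [measurable] = measurable_proj
  have [measurable]: "wmean \<in> borel_measurable borel"
    by (intro borel_measurable_continuous_onI continuous_wmean)
  have [measurable]: "(\<lambda>y :: (real, 'k) vec. y $ j) \<in> borel_measurable borel" for j
    by (intro borel_measurable_continuous_onI continuous_intros)
  show ?thesis
    unfolding log_ratio_def
    by (intro borel_measurable_ln borel_measurable_prod borel_measurable_times measurable_rpow) measurable
qed

lemma ln_localized_likelihood_ratio:
  "ln (localized_likelihood_ratio w N X x) = log_ratio (\<chi> j. sample_ecdf N X j x)"
proof -
  have "pooled_ecdf N X x = wmean (\<chi> j. sample_ecdf N X j x)"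
    by (simp add: pooled_ecdf_eq[OF proportion N_pos] wmean_def)
  then show ?thesis
    by (simp add: localized_likelihood_ratio_def log_ratio_def isotonized_ecdf_def proj_def)
qed

lemma sample_ecdf_eq: "sample_ecdf N X j x = (\<Sum>i<N j. of_bool (X j i \<le> x)) / N j"
  by (simp add: sample_ecdf_def ecdf_def Int_def lessThan_def)

lemma measurable_sample_ecdf: "(\<lambda>x. \<chi> j. sample_ecdf N X j x) \<in> borel_measurable borel"
  unfolding sample_ecdf_eq by (intro borel_measurable_vec_lambda) measurable

lemma test_statistic_eq:
  "test_statistic w N X
    = - 2 * (\<Sum>(l, m)\<in>pool. log_ratio (\<chi> j. sample_ecdf N X j (X l m))) / size"
proof -
  have "test_statistic w N X = - 2 * (LINT x|interval_measure (ecdf pool (\<lambda>(j, i). X j i)).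
      log_ratio (\<chi> j. sample_ecdf N X j x))"
    by (simp add: test_statistic_def ln_localized_likelihood_ratio pooled_ecdf_def pool_def)
  also have "\<dots> = - 2 * (\<Sum>p\<in>pool. log_ratio (\<chi> j. sample_ecdf N X j (case p of (l, m) \<Rightarrow> X l m))) / size"
    by (subst integral_ecdf[OF finite_pool pool_nonempty
          measurable_compose[OF measurable_sample_ecdf measurable_log_ratio]]) (simp add: card_pool)
  finally show ?thesis by (simp add: case_prod_unfold)
qed

lemma measurable_test_statistic:
  assumes X: "\<And>j i. i < N j \<Longrightarrow> X j i \<in> borel_measurable M"
  shows "(\<lambda>\<omega>. test_statistic w N (\<lambda>j i. X j i \<omega>)) \<in> borel_measurable M"
proof -
  have "(\<lambda>\<omega>. log_ratio (\<chi> j. sample_ecdf N (\<lambda>j i. X j i \<omega>) j (X l m \<omega>))) \<in> borel_measurable M"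
    if "(l, m) \<in> pool" for l m
  proof (rule measurable_compose[OF _ measurable_log_ratio], rule borel_measurable_vec_lambda)
    fix j
    have lm: "X l m \<in> borel_measurable M" using that X by (simp add: pool_def)
    have "(\<lambda>\<omega>. \<Sum>i<N j. of_bool (X j i \<omega> \<le> X l m \<omega>) :: real) \<in> borel_measurable M"
    proof (rule borel_measurable_sum)
      fix i assume "i \<in> {..<N j}"
      then have [measurable]: "X j i \<in> borel_measurable M" "X l m \<in> borel_measurable M"
        using X lm by auto
      show "(\<lambda>\<omega>. of_bool (X j i \<omega> \<le> X l m \<omega>) :: real) \<in> borel_measurable M" by measurable
    qed
    then show "(\<lambda>\<omega>. sample_ecdf N (\<lambda>j i. X j i \<omega>) j (X l m \<omega>)) \<in> borel_measurable M"
      unfolding sample_ecdf_eq by simp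
  qed
  then have "(\<lambda>\<omega>. \<Sum>p\<in>pool. log_ratio (\<chi> j. sample_ecdf N (\<lambda>j i. X j i \<omega>) j (X (fst p) (snd p) \<omega>)))
      \<in> borel_measurable M"
    by (intro borel_measurable_sum) auto
  then show ?thesis
    unfolding test_statistic_eq by (simp add: case_prod_unfold)
qed

text \<open>By the level set property, the exponents \<open>y\<close> of the likelihood ratio may be replaced by the
  projected values, which turns its logarithm into a Kullback--Leibler divergence.\<close>

lemma log_ratio_eq:
  assumes y: "\<And>j. 0 \<le> y $ j" "\<And>j. y $ j \<le> 1" and m: "0 < wmean y"
  shows "- 2 * log_ratio y = 2 * size * (\<Sum>j\<in>UNIV. w $ j * bern_kl (proj y $ j) (wmean y))"
proof (cases "wmean y = 1")
  \<comment> \<open>This happens at the largest observation. Pooled value 1 forces every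
    \<open>y $ j\<close> to be 1, and the second factor of each term is a quotient with zero
    denominator raised to exponent 0.\<close>
  case True
  have "(\<Sum>j\<in>UNIV. w $ j * (1 - y $ j)) = 0"
    using True by (simp add: right_diff_distrib sum_subtractf sum_weights wmean_def)
  then have "\<forall>j\<in>UNIV. w $ j * (1 - y $ j) = 0"
    by (subst (asm) sum_nonneg_eq_0_iff) (auto intro!: mult_nonneg_nonneg weight_nonneg y)
  then have y1: "y $ j = 1" for j
    using weight_pos[of j] by (cases "w $ j = 0") (simp, metis UNIV_I mult_eq_0_iff right_minus_eq)
  then have "proj y $ j = 1" for j
    using proj_ge[of 1 y j] proj_le[of y 1 j] by (simp add: order_antisym)
  moreover from this have "rpow (wmean y / proj y $ j) (real (N j) * y $ j) *
      rpow ((1 - wmean y) / (1 - proj y $ j)) (real (N j) * (1 - y $ j)) = 1" for j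
    by (simp add: True y1 rpow_def)
  ultimately show ?thesis by (simp add: log_ratio_def True bern_kl_def)
next
  case False
  have "wmean y \<le> (\<Sum>j\<in>UNIV. w $ j * 1)"
    unfolding wmean_def by (intro sum_mono mult_left_mono y weight_nonneg)
  then have m1: "wmean y < 1" using False by (simp add: sum_weights)
  let ?z = "proj y" and ?m = "wmean y"
  have z: "0 \<le> ?z $ j" "?z $ j \<le> 1" for j using y by (auto intro: proj_ge proj_le)
  \<comment> \<open>Where the projection reaches 0 or 1, so does the data value, and the
    corresponding exponent is zero.\<close>
  have pos: "0 < ?m / ?z $ j \<or> real (N j) * y $ j = 0"
    "0 < (1 - ?m) / (1 - ?z $ j) \<or> real (N j) * (1 - y $ j) = 0" for j
  proof -
    show "0 < ?m / ?z $ j \<or> real (N j) * y $ j = 0"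
      using z(1)[of j] m proj_eq_lower[of 0 y j] y by (cases "?z $ j = 0") auto
    show "0 < (1 - ?m) / (1 - ?z $ j) \<or> real (N j) * (1 - y $ j) = 0"
      using z(2)[of j] m1 proj_eq_upper[of y 1 j] y by (cases "?z $ j = 1") auto
  qed
  \<comment> \<open>Difference of the log odds of \<open>u\<close> and \<open>?m\<close>. Exchanging
    \<open>y\<close> for the projection in the exponents costs \<open>(y - z) * h z\<close> in each
    coordinate, and these terms sum to zero by \<open>proj_level_sets\<close>.\<close>
  define h where "h u = ln (u / ?m) - ln ((1 - u) / (1 - ?m))" for u
  have ln1: "real (N j) * y $ j * ln (?m / ?z $ j) = - (size * (w $ j * y $ j * ln (?z $ j / ?m)))" for j
    using z(1)[of j] m by (cases "?z $ j = 0") (auto simp: N_eq ln_div algebra_simps)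
  have ln2: "real (N j) * (1 - y $ j) * ln ((1 - ?m) / (1 - ?z $ j))
      = - (size * (w $ j * (1 - y $ j) * ln ((1 - ?z $ j) / (1 - ?m))))" for j
    using z(2)[of j] m1 by (cases "?z $ j = 1") (auto simp: N_eq ln_div algebra_simps)
  have "log_ratio y = (\<Sum>j\<in>UNIV. ln (rpow (?m / ?z $ j) (real (N j) * y $ j) *
      rpow ((1 - ?m) / (1 - ?z $ j)) (real (N j) * (1 - y $ j))))"
  proof -
    have "0 < rpow (?m / ?z $ j) (real (N j) * y $ j) * rpow ((1 - ?m) / (1 - ?z $ j)) (real (N j) * (1 - y $ j))"
      for j
      by (intro mult_pos_pos rpow_pos pos)
    then show ?thesis unfolding log_ratio_def by (intro ln_prod finite) (metis order_less_irrefl)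
  qed
  also have "\<dots> = (\<Sum>j\<in>UNIV. real (N j) * y $ j * ln (?m / ?z $ j)
      + real (N j) * (1 - y $ j) * ln ((1 - ?m) / (1 - ?z $ j)))"
    by (simp add: ln_mult_pos[OF rpow_pos[OF pos(1)] rpow_pos[OF pos(2)]] ln_rpow[OF pos(1)] ln_rpow[OF pos(2)])
  also have "\<dots> = - (size * (\<Sum>j\<in>UNIV. w $ j * bern_kl (?z $ j) ?m + w $ j * (y $ j - ?z $ j) * h (?z $ j)))"
    unfolding ln1 ln2 bern_kl_def h_def sum_distrib_left sum_negf[symmetric]
    by (intro sum.cong refl) (simp add: algebra_simps)
  also have "\<dots> = - (size * (\<Sum>j\<in>UNIV. w $ j * bern_kl (?z $ j) ?m))"
    by (simp add: sum.distrib proj_level_sets)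
  finally show ?thesis by simp
qed

lemma rank_ecdf_bounds: "0 \<le> rank_ecdf x r $ j" "rank_ecdf x r $ j \<le> 1"
proof -
  show "0 \<le> rank_ecdf x r $ j" by (simp add: rank_ecdf_def sum_nonneg)
  have "(\<Sum>i<N j. of_bool (rank_in pool x (j, i) \<le> r)) \<le> (\<Sum>i<N j. 1 :: real)"
    by (intro sum_mono) auto
  then show "rank_ecdf x r $ j \<le> 1" using N_pos[of j] by (simp add: rank_ecdf_def)
qed

lemma sum_pool: "(\<Sum>p\<in>pool. f p) = (\<Sum>j\<in>UNIV. \<Sum>i<N j. f (j, i))"
  unfolding pool_def by (subst sum.Sigma) auto

lemma wmean_ecdf: "wmean (\<chi> j. (\<Sum>i<N j. f (j, i)) / N j) = (\<Sum>p\<in>pool. f p) / size"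
proof -
  have "w $ j * ((\<Sum>i<N j. f (j, i)) / N j) = (\<Sum>i<N j. f (j, i)) / size" for j
    using N_eq[of j] N_pos[of j] size_pos weight_pos[of j] by (simp add: field_simps)
  then show ?thesis by (simp add: wmean_def sum_pool sum_divide_distrib)
qed

lemma wmean_rank_ecdf:
  assumes "inj_on x pool" "r \<le> size"
  shows "wmean (rank_ecdf x r) = r / size"
proof -
  have "wmean (rank_ecdf x r) = card {p \<in> pool. rank_in pool x p \<le> r} / size"
    unfolding rank_ecdf_def using finite_pool
    by (subst wmean_ecdf[of "\<lambda>p. of_bool (rank_in pool x p \<le> r)"]) (simp add: Int_def)
  then show ?thesis
    using card_rank_in_le[OF finite_pool assms(1)] assms(2) by (simp add: card_pool)
qed

text \<open>Each observation contributes the value at its own rank, and without ties the ranks run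
  exactly once through \<open>1, ..., size\<close>.\<close>

lemma test_statistic_ranks:
  assumes inj: "inj_on x pool"
  shows "test_statistic w N (\<lambda>j i. x (j, i)) = (\<Sum>r=1..size. rank_stat x r) / size"
proof -
  have "- 2 * log_ratio (\<chi> j. sample_ecdf N (\<lambda>j i. x (j, i)) j (x p)) = rank_stat x (rank_in pool x p)"
    if p: "p \<in> pool" for p
  proof -
    let ?r = "rank_in pool x p"
    have r: "1 \<le> ?r" "?r \<le> size"
      using bij_betw_rank_in[OF finite_pool inj] p by (auto simp: bij_betw_def card_pool)
    have y: "(\<chi> j. sample_ecdf N (\<lambda>j i. x (j, i)) j (x p)) = rank_ecdf x ?r"
      unfolding sample_ecdf_eq rank_ecdf_def vec_eq_iff
      using rank_in_le_iff[OF finite_pool _ p] by (simp add: pool_def)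
    have wm: "wmean (rank_ecdf x ?r) = ?r / size" by (rule wmean_rank_ecdf[OF inj r(2)])
    show ?thesis
      unfolding y rank_stat_def wm[symmetric]
      by (rule log_ratio_eq) (use rank_ecdf_bounds r size_pos in \<open>auto simp: wm\<close>)
  qed
  then have "test_statistic w N (\<lambda>j i. x (j, i)) = (\<Sum>p\<in>pool. rank_stat x (rank_in pool x p)) / size"
    unfolding test_statistic_eq by (simp add: sum_distrib_left case_prod_unfold)
  also have "(\<Sum>p\<in>pool. rank_stat x (rank_in pool x p)) = (\<Sum>r=1..size. rank_stat x r)"
    using sum.reindex_bij_betw[OF bij_betw_rank_in[OF finite_pool inj], of "rank_stat x"]
    by (simp add: card_pool)
  finally show ?thesis .
qed

end

section \<open>Riemann sums of random integrands\<close>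

text \<open>The integrand is compared with the step function that equals \<open>Q l\<close> on the
  \<open>l\<close>-th cell and 0 on the outer strips of width \<open>a / K\<close>. The strips cost
  \<open>2 * C * a / K\<close> by the bound \<open>C\<close>, the inner cells at most
  \<open>e\<close>; Fubini turns these bounds at fixed \<open>t\<close> into one for the integral
  and also yields its almost sure existence.\<close>

lemma (in prob_space) riemann_sum_approximation:
  fixes G :: "real \<Rightarrow> 'a \<Rightarrow> real" and Q :: "nat \<Rightarrow> 'a \<Rightarrow> real"
  assumes G: "(\<lambda>(t, \<omega>). G t \<omega>) \<in> borel_measurable (lborel \<Otimes>\<^sub>M M)"
    and G0: "\<And>t \<omega>. t \<notin> {0<..<1} \<Longrightarrow> G t \<omega> = 0"
    and Q: "\<And>l. l \<in> {a..<K - a} \<Longrightarrow> Q l \<in> borel_measurable M"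
    and a: "0 < a" "2 * a \<le> K" and C: "0 \<le> C" and e: "0 \<le> e"
    and ends: "\<And>t. t \<in> {0<..<1} \<Longrightarrow> (\<integral>\<^sup>+\<omega>. ennreal \<bar>G t \<omega>\<bar> \<partial>M) \<le> ennreal C"
    and cell: "\<And>l t. l \<in> {a..<K - a} \<Longrightarrow> t \<in> {0<..<1} \<Longrightarrow> real l / K < t \<Longrightarrow> t \<le> (real l + 1) / K \<Longrightarrow>
      (\<integral>\<^sup>+\<omega>. ennreal \<bar>G t \<omega> - Q l \<omega>\<bar> \<partial>M) \<le> ennreal e"
  shows "AE \<omega> in M. integrable lborel (\<lambda>t. G t \<omega>)"
    and "integrable M (\<lambda>\<omega>. LINT t|lborel. G t \<omega>)"
    and "(\<integral>\<^sup>+\<omega>. ennreal \<bar>(LINT t|lborel. G t \<omega>) - (\<Sum>l=a..<K - a. Q l \<omega>) / K\<bar> \<partial>M)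
      \<le> ennreal (2 * C * a / K + e)"
proof -
  interpret PP: pair_sigma_finite "lborel :: real measure" M ..
  have K: "0 < real K" using a by simp
  have Gt: "(\<lambda>\<omega>. G t \<omega>) \<in> borel_measurable M" for t
    using measurable_compose[OF measurable_Pair1'[of t lborel M] G] by simp
  have "(\<integral>\<^sup>+z. ennreal (norm (case z of (t, \<omega>) \<Rightarrow> G t \<omega>)) \<partial>(lborel \<Otimes>\<^sub>M M))
      = (\<integral>\<^sup>+t. \<integral>\<^sup>+\<omega>. ennreal \<bar>G t \<omega>\<bar> \<partial>M \<partial>lborel)"
  proof -
    have "(\<lambda>z. ennreal (norm (case z of (t, \<omega>) \<Rightarrow> G t \<omega>))) \<in> borel_measurable (lborel \<Otimes>\<^sub>M M)"
      using G by measurable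
    from nn_integral_fst[OF this] show ?thesis by simp
  qed
  also have "\<dots> \<le> (\<integral>\<^sup>+t. ennreal C * indicator {0<..<1::real} t \<partial>lborel)"
  proof (rule nn_integral_mono)
    fix t :: real
    show "(\<integral>\<^sup>+\<omega>. ennreal \<bar>G t \<omega>\<bar> \<partial>M) \<le> ennreal C * indicator {0<..<1} t"
      using ends[of t] G0[of t] by (cases "t \<in> {0<..<1}") simp_all
  qed
  also have "\<dots> < \<infinity>" by (subst nn_integral_cmult_indicator) auto
  finally have intG: "integrable (lborel \<Otimes>\<^sub>M M) (\<lambda>(t, \<omega>). G t \<omega>)"
    using G by (intro integrableI_bounded) auto
  show AEG: "AE \<omega> in M. integrable lborel (\<lambda>t. G t \<omega>)"
    using PP.AE_integrable_snd[OF intG] .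
  show "integrable M (\<lambda>\<omega>. LINT t|lborel. G t \<omega>)"
    using PP.integrable_snd[OF intG] .
  \<comment> \<open>The cells are half-open on the left, so they are disjoint and every
    \<open>t\<close> in the inner range lies in exactly one of them.\<close>
  define R where "R t \<omega> = (\<Sum>l=a..<K - a. indicator {real l / K<..(real l + 1) / K} t * Q l \<omega>)" for t \<omega>
  have R: "(\<lambda>(t, \<omega>). R t \<omega>) \<in> borel_measurable (lborel \<Otimes>\<^sub>M M)"
    unfolding R_def case_prod_unfold
  proof (intro borel_measurable_sum borel_measurable_times)
    fix l assume l: "l \<in> {a..<K - a}"
    show "(\<lambda>z. Q l (snd z)) \<in> borel_measurable (lborel \<Otimes>\<^sub>M M)"
      using measurable_compose[OF measurable_snd Q[OF l]] .
    show "(\<lambda>z. indicator {real l / K<..(real l + 1) / K} (fst z) :: real) \<in> borel_measurable (lborel \<Otimes>\<^sub>M M)"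
      by measurable
  qed
  have R0: "R t \<omega> = 0" if "t \<le> real a / K \<or> 1 - real a / K < t" for t \<omega>
    unfolding R_def
  proof (intro sum.neutral ballI)
    fix l assume "l \<in> {a..<K - a}"
    then have "real a \<le> real l" "real l + 1 \<le> real K - real a" by auto
    then have "real a / K \<le> real l / K" "(real l + 1) / K \<le> (real K - real a) / K"
      using K by (auto intro: divide_right_mono)
    moreover have "(real K - real a) / K = 1 - real a / K" using K by (simp add: diff_divide_distrib)
    ultimately show "indicator {real l / K<..(real l + 1) / K} t * Q l \<omega> = 0"
      using that by (auto simp: indicator_def)
  qed
  have Rl: "R t \<omega> = Q l \<omega>" if l: "l \<in> {a..<K - a}" "real l / K < t" "t \<le> (real l + 1) / K" for l t \<omega>
  proof -
    have "indicator {real l' / K<..(real l' + 1) / K} t * Q l' \<omega> = (if l' = l then Q l \<omega> else 0)" for l'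
    proof -
      have "real l' < t * K \<and> t * K \<le> real l' + 1 \<longleftrightarrow> l' = l"
        using that K by (auto simp: field_simps)
      then have "t \<in> {real l' / K<..(real l' + 1) / K} \<longleftrightarrow> l' = l"
        using K by (simp add: pos_divide_less_eq pos_le_divide_eq)
      then show ?thesis by (auto simp: indicator_def)
    qed
    then show ?thesis using l(1) by (simp add: R_def)
  qed
  have ind: "integrable lborel (indicat_real {u<..v})" for u v :: real
    by (cases "u \<le> v") (auto intro!: integrable_real_indicator)
  have intR: "integrable lborel (\<lambda>t. R t \<omega>)" for \<omega>
    unfolding R_def by (intro Bochner_Integration.integrable_sum integrable_mult_left ind)
  have IR: "(LINT t|lborel. R t \<omega>) = (\<Sum>l=a..<K - a. Q l \<omega>) / K" for \<omega>
  proof -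
    have "(LINT t|lborel. R t \<omega>) = (\<Sum>l=a..<K - a. LINT t|lborel. indicator {real l / K<..(real l + 1) / K} t * Q l \<omega>)"
      unfolding R_def by (intro Bochner_Integration.integral_sum integrable_mult_left ind)
    also have "\<dots> = (\<Sum>l=a..<K - a. Q l \<omega> / K)"
    proof (intro sum.cong refl)
      fix l
      have "real l / K \<le> (real l + 1) / K" using K by (simp add: divide_right_mono)
      then have "measure lborel {real l / K<..(real l + 1) / K} = 1 / K"
        by (simp add: add_divide_distrib)
      then show "(LINT t|lborel. indicator {real l / K<..(real l + 1) / K} t * Q l \<omega>) = Q l \<omega> / K"
        by simp
    qed
    finally show ?thesis by (simp add: sum_divide_distrib)
  qed
  have bound: "(\<integral>\<^sup>+\<omega>. ennreal \<bar>G t \<omega> - R t \<omega>\<bar> \<partial>M) \<le> ennreal C * indicator {0<..real a / K} t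
      + ennreal e * indicator {real a / K<..1 - real a / K} t
      + ennreal C * indicator {1 - real a / K<..1} t" (is "?l \<le> ?r") for t
  proof -
    have aK: "0 < real a / K" "real a / K \<le> 1 - real a / K"
      using a K by (auto simp: field_simps)
    consider "t \<notin> {0<..<1}" | "0 < t" "t \<le> real a / K" | "1 - real a / K < t" "t < 1"
      | "real a / K < t" "t \<le> 1 - real a / K"
      by fastforce
    then show ?thesis
    proof cases
      case 1
      then have "t \<le> real a / K \<or> 1 - real a / K < t" using aK by auto
      then have "?l = 0" using R0 G0[OF 1] by simp
      then show ?thesis by simp
    next
      case 2
      then have "?l \<le> ennreal C" using R0 aK ends[of t] by simp
      with 2 aK show ?thesis by simp
    next
      case 3
      then have "?l \<le> ennreal C" using R0 aK ends[of t] by simp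
      with 3 aK show ?thesis by simp
    next
      case 4
      \<comment> \<open>Ceiling minus one rather than floor, because a mesh point belongs to the
        cell on its left.\<close>
      define l where "l = nat (\<lceil>t * K\<rceil> - 1)"
      have tK: "real a < t * K" "t * K \<le> real K - real a" using 4 K by (auto simp: field_simps)
      then have l: "real l < t * K" "t * K \<le> real l + 1"
        using a unfolding l_def by linarith+
      have "real a < real l + 1" "real l < real K - real a" using l tK by linarith+
      then have mem: "l \<in> {a..<K - a}" using a by auto
      have lt: "real l / K < t" "t \<le> (real l + 1) / K"
        using l K by (simp_all add: pos_divide_less_eq pos_le_divide_eq)
      have "?l = (\<integral>\<^sup>+\<omega>. ennreal \<bar>G t \<omega> - Q l \<omega>\<bar> \<partial>M)"
        by (simp add: Rl[OF mem lt])
      also have "\<dots> \<le> ennreal e" using 4 aK by (intro cell[OF mem _ lt]) auto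
      finally show ?thesis using 4 aK by simp
    qed
  qed
  have "(\<integral>\<^sup>+\<omega>. ennreal \<bar>(LINT t|lborel. G t \<omega>) - (\<Sum>l=a..<K - a. Q l \<omega>) / K\<bar> \<partial>M)
      \<le> (\<integral>\<^sup>+\<omega>. \<integral>\<^sup>+t. ennreal \<bar>G t \<omega> - R t \<omega>\<bar> \<partial>lborel \<partial>M)"
  proof (rule nn_integral_mono_AE)
    show "AE \<omega> in M. ennreal \<bar>(LINT t|lborel. G t \<omega>) - (\<Sum>l=a..<K - a. Q l \<omega>) / K\<bar>
        \<le> (\<integral>\<^sup>+t. ennreal \<bar>G t \<omega> - R t \<omega>\<bar> \<partial>lborel)"
      using AEG
    proof eventually_elim
      case (elim \<omega>)
      have "ennreal \<bar>(LINT t|lborel. G t \<omega>) - (\<Sum>l=a..<K - a. Q l \<omega>) / K\<bar>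
          = ennreal (norm (LINT t|lborel. G t \<omega> - R t \<omega>))"
        using elim intR by (simp add: IR)
      also have "\<dots> \<le> (\<integral>\<^sup>+t. ennreal (norm (G t \<omega> - R t \<omega>)) \<partial>lborel)"
        using elim intR by (intro integral_norm_bound_ennreal) auto
      finally show ?case by simp
    qed
  qed
  also have "\<dots> = (\<integral>\<^sup>+t. \<integral>\<^sup>+\<omega>. ennreal \<bar>G t \<omega> - R t \<omega>\<bar> \<partial>M \<partial>lborel)"
  proof (rule PP.Fubini'[where f="\<lambda>t \<omega>. ennreal \<bar>G t \<omega> - R t \<omega>\<bar>"])
    show "(\<lambda>(t, \<omega>). ennreal \<bar>G t \<omega> - R t \<omega>\<bar>) \<in> borel_measurable (lborel \<Otimes>\<^sub>M M)"
      using G R unfolding case_prod_unfold by measurable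
  qed
  also have "\<dots> \<le> (\<integral>\<^sup>+t. ennreal C * indicator {0<..real a / K} t
      + ennreal e * indicator {real a / K<..1 - real a / K} t
      + ennreal C * indicator {1 - real a / K<..1} t \<partial>lborel)"
    by (intro nn_integral_mono bound)
  also have "\<dots> = ennreal C * ennreal (real a / K) + ennreal e * ennreal (1 - real a / K - real a / K)
      + ennreal C * ennreal (real a / K)"
  proof -
    have "0 \<le> real a / K" "real a / K \<le> 1 - real a / K" "1 - real a / K \<le> 1"
      using a K by (auto simp: field_simps)
    then show ?thesis by (simp add: nn_integral_add nn_integral_cmult_indicator)
  qed
  also have "\<dots> = ennreal (C * (real a / K) + e * (1 - real a / K - real a / K) + C * (real a / K))"
  proof -
    have sum: "ennreal C * ennreal x + ennreal e * ennreal y + ennreal C * ennreal x = ennreal (C * x + e * y + C * x)"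
      if "0 \<le> x" "0 \<le> y" for x y
      using that C e by (simp add: ennreal_mult[symmetric] ennreal_plus[symmetric] del: ennreal_plus)
    have "0 \<le> 1 - real a / K - real a / K" using a K by (auto simp: field_simps)
    then show ?thesis by (intro sum) auto
  qed
  also have "\<dots> \<le> ennreal (2 * C * a / K + e)"
  proof (rule ennreal_leI)
    have "e * (1 - real a / K - real a / K) \<le> e * 1"
      using e K by (intro mult_left_mono) auto
    then show "C * (real a / K) + e * (1 - real a / K - real a / K) + C * (real a / K) \<le> 2 * C * a / K + e"
      by simp
  qed
  finally show "(\<integral>\<^sup>+\<omega>. ennreal \<bar>(LINT t|lborel. G t \<omega>) - (\<Sum>l=a..<K - a. Q l \<omega>) / K\<bar> \<partial>M)
      \<le> ennreal (2 * C * a / K + e)" .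
qed

text \<open>Mean error caused by a variation \<open>d\<close> at distance at least \<open>c\<close>
  from the endpoints: the first term comes from changing the vector, the second from changing the
  weight \<open>1 / (t * (1 - t))\<close>. The parameter \<open>k\<close> bounds the second
  moments.\<close>

definition cell_error :: "real \<Rightarrow> real \<Rightarrow> real \<Rightarrow> real" where
  "cell_error k c d = 3 * k * sqrt d / c\<^sup>2 + k * d / c ^ 4"

section \<open>Mean difference of two weighted squared deviations\<close>

context weights
begin

lemma continuous_center: "continuous_on UNIV center"
  unfolding center_def by (intro continuous_intros continuous_wmean)

lemma continuous_wsq_center: "continuous_on UNIV (\<lambda>v. wsq (center v))"
  by (rule continuous_on_compose2[OF continuous_wsq continuous_center]) auto

lemma measurable_iso_dev: "iso_dev \<in> borel_measurable borel"
  by (intro borel_measurable_continuous_onI continuous_iso_dev)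

lemma measurable_wsq_center: "(\<lambda>v. wsq (center v)) \<in> borel_measurable borel"
  by (intro borel_measurable_continuous_onI continuous_wsq_center)

lemma integrable_iso_dev:
  assumes "U \<in> borel_measurable M" "integrable M (\<lambda>\<omega>. wsq (center (U \<omega>)))"
  shows "integrable M (\<lambda>\<omega>. iso_dev (U \<omega>))"
proof (rule Bochner_Integration.integrable_bound[OF assms(2)])
  show "(\<lambda>\<omega>. iso_dev (U \<omega>)) \<in> borel_measurable M"
    by (rule measurable_compose[OF assms(1) measurable_iso_dev])
  show "AE \<omega> in M. norm (iso_dev (U \<omega>)) \<le> norm (wsq (center (U \<omega>)))"
    using iso_dev_le iso_dev_nonneg by (intro AE_I2) (simp add: wsq_nonneg)
qed

text \<open>Used twice: for the statistic, with a rank vector against a quantile vector, and for the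
  limit, with the bridges at two times. The choice \<open>l = sqrt d\<close> in
  \<open>iso_dev_diff\<close> yields one \<open>k * sqrt d\<close> from the difference and two from
  the norms, hence the factor 3.\<close>

lemma iso_dev_ratio_diff:
  fixes U V :: "'a \<Rightarrow> (real, 'k) vec" and s t :: real
  assumes prob: "prob_space M"
    and U: "U \<in> borel_measurable M" and V: "V \<in> borel_measurable M"
    and i: "integrable M (\<lambda>\<omega>. wsq (center (U \<omega>)))" "integrable M (\<lambda>\<omega>. wsq (center (V \<omega>)))"
      "integrable M (\<lambda>\<omega>. wsq (center (U \<omega> - V \<omega>)))"
    and b: "(LINT \<omega>|M. wsq (center (U \<omega>))) \<le> k" "(LINT \<omega>|M. wsq (center (V \<omega>))) \<le> k"
      "(LINT \<omega>|M. wsq (center (U \<omega> - V \<omega>))) \<le> k * d"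
    and d: "0 < d" "\<bar>s - t\<bar> \<le> d" and c: "0 < c" "c \<le> s" "c \<le> 1 - s" "c \<le> t" "c \<le> 1 - t"
  shows "integrable M (\<lambda>\<omega>. \<bar>iso_dev (U \<omega>) / (s * (1 - s)) - iso_dev (V \<omega>) / (t * (1 - t))\<bar>)"
    and "(LINT \<omega>|M. \<bar>iso_dev (U \<omega>) / (s * (1 - s)) - iso_dev (V \<omega>) / (t * (1 - t))\<bar>)
      \<le> cell_error k c d"
proof -
  interpret prob_space M by fact
  note iU = integrable_iso_dev[OF U i(1)] and iV = integrable_iso_dev[OF V i(2)]
  show int: "integrable M (\<lambda>\<omega>. \<bar>iso_dev (U \<omega>) / (s * (1 - s)) - iso_dev (V \<omega>) / (t * (1 - t))\<bar>)"
    using iU iV by auto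
  have cs: "c\<^sup>2 \<le> s * (1 - s)" and ct: "c\<^sup>2 \<le> t * (1 - t)"
    unfolding power2_eq_square using c by (auto intro!: mult_mono)
  have c2: "0 < c\<^sup>2" using c by simp
  have l: "0 < sqrt d" using d by simp
  have "\<bar>1 / (s * (1 - s)) - 1 / (t * (1 - t))\<bar> \<le> d / c ^ 4"
  proof -
    have p: "0 < s * (1 - s)" "0 < t * (1 - t)" using cs ct c2 by linarith+
    have "1 / (s * (1 - s)) - 1 / (t * (1 - t)) = (t * (1 - t) - s * (1 - s)) / (s * (1 - s) * (t * (1 - t)))"
      using p by (subst diff_frac_eq) auto
    also have "t * (1 - t) - s * (1 - s) = (t - s) * (1 - t - s)" by (simp add: algebra_simps)
    finally have "\<bar>1 / (s * (1 - s)) - 1 / (t * (1 - t))\<bar>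
        = \<bar>t - s\<bar> * \<bar>1 - t - s\<bar> / (s * (1 - s) * (t * (1 - t)))"
      by (simp only: abs_divide abs_mult[of "t - s"] abs_of_pos[OF mult_pos_pos[OF p]])
    also have "\<dots> \<le> d * 1 / (c\<^sup>2 * c\<^sup>2)"
      using d c cs ct c2 by (intro frac_le mult_mono) auto
    finally show ?thesis by (simp add: power4_eq_xxxx power2_eq_square mult_ac)
  qed
  note ratio = this
  have pt: "\<bar>iso_dev (U \<omega>) / (s * (1 - s)) - iso_dev (V \<omega>) / (t * (1 - t))\<bar>
      \<le> (wsq (center (U \<omega> - V \<omega>)) / sqrt d + sqrt d * (wsq (center (U \<omega>)) + wsq (center (V \<omega>)))) / c\<^sup>2
        + wsq (center (V \<omega>)) * (d / c ^ 4)" for \<omega>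
  proof -
    have "iso_dev (U \<omega>) / (s * (1 - s)) - iso_dev (V \<omega>) / (t * (1 - t))
        = (iso_dev (U \<omega>) - iso_dev (V \<omega>)) / (s * (1 - s))
          + iso_dev (V \<omega>) * (1 / (s * (1 - s)) - 1 / (t * (1 - t)))"
      by (simp add: diff_divide_distrib right_diff_distrib)
    also have "\<bar>\<dots>\<bar> \<le> \<bar>iso_dev (U \<omega>) - iso_dev (V \<omega>)\<bar> / (s * (1 - s))
          + iso_dev (V \<omega>) * \<bar>1 / (s * (1 - s)) - 1 / (t * (1 - t))\<bar>"
      using c iso_dev_nonneg[of "V \<omega>"]
      by (intro order_trans[OF abs_triangle_ineq]) (simp add: abs_mult)
    also have "\<dots> \<le> (wsq (center (U \<omega> - V \<omega>)) / sqrt d + sqrt d * (wsq (center (U \<omega>)) + wsq (center (V \<omega>)))) / c\<^sup>2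
        + wsq (center (V \<omega>)) * (d / c ^ 4)"
      using c2 cs ratio iso_dev_diff[OF l] iso_dev_le wsq_nonneg
      by (intro add_mono frac_le mult_mono) (auto intro: order_trans[OF abs_ge_zero])
    finally show ?thesis .
  qed
  have "(LINT \<omega>|M. \<bar>iso_dev (U \<omega>) / (s * (1 - s)) - iso_dev (V \<omega>) / (t * (1 - t))\<bar>)
      \<le> (LINT \<omega>|M. (wsq (center (U \<omega> - V \<omega>)) / sqrt d + sqrt d * (wsq (center (U \<omega>)) + wsq (center (V \<omega>)))) / c\<^sup>2
        + wsq (center (V \<omega>)) * (d / c ^ 4))"
    using i by (intro integral_mono int pt) auto
  also have "\<dots> = ((LINT \<omega>|M. wsq (center (U \<omega> - V \<omega>))) / sqrt d
      + sqrt d * ((LINT \<omega>|M. wsq (center (U \<omega>))) + (LINT \<omega>|M. wsq (center (V \<omega>))))) / c\<^sup>2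
      + (LINT \<omega>|M. wsq (center (V \<omega>))) * (d / c ^ 4)"
    using i by simp
  also have "\<dots> \<le> (k * d / sqrt d + sqrt d * (k + k)) / c\<^sup>2 + k * (d / c ^ 4)"
    using b d c l by (intro add_mono divide_right_mono mult_left_mono mult_right_mono) auto
  also have "k * d / sqrt d = k * sqrt d"
    using d by (simp add: real_div_sqrt flip: times_divide_eq_right)
  finally show "(LINT \<omega>|M. \<bar>iso_dev (U \<omega>) / (s * (1 - s)) - iso_dev (V \<omega>) / (t * (1 - t))\<bar>)
      \<le> cell_error k c d"
    by (simp add: cell_error_def algebra_simps)
qed

end

section \<open>Approximation of the test statistic\<close>

context weights
begin

definition inv_weights :: real where
  "inv_weights = (\<Sum>j\<in>UNIV. 1 / w $ j)"

lemma inv_weights_ge: "1 / w $ j \<le> inv_weights"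
  unfolding inv_weights_def
  by (rule member_le_sum[of j UNIV "\<lambda>j. 1 / w $ j"]) (auto simp: weight_nonneg)

lemma weight_le_one: "w $ j \<le> 1"
  using member_le_sum[of j UNIV "\<lambda>j. w $ j"] by (simp add: weight_nonneg sum_weights)

lemma inv_weights_nonneg: "0 \<le> inv_weights"
  unfolding inv_weights_def by (intro sum_nonneg) (simp add: weight_nonneg)

section \<open>Inequalities for the weighted norm and for the divergence sum\<close>

lemma wsq_add_le: "wsq (u + v) \<le> 2 * wsq u + 2 * wsq v"
proof -
  have "wsq (u + v) \<le> (\<Sum>j\<in>UNIV. w $ j * (2 * (u $ j)\<^sup>2 + 2 * (v $ j)\<^sup>2))"
    unfolding wsq_def
  proof (intro sum_mono mult_left_mono weight_nonneg)
    fix j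
    have "2 * u $ j * v $ j \<le> (u $ j)\<^sup>2 + (v $ j)\<^sup>2" by (rule sum_squares_bound)
    then show "((u + v) $ j)\<^sup>2 \<le> 2 * (u $ j)\<^sup>2 + 2 * (v $ j)\<^sup>2" by (simp add: power2_sum)
  qed
  also have "\<dots> = 2 * wsq u + 2 * wsq v"
    unfolding wsq_def sum_distrib_left sum.distrib[symmetric]
    by (intro sum.cong) (auto simp: algebra_simps)
  finally show ?thesis .
qed

text \<open>Jensen's inequality for the probability weights \<open>w\<close>, in the form that a
  variance is nonnegative.\<close>

lemma wsq_square_le: "(wsq v)\<^sup>2 \<le> (\<Sum>j\<in>UNIV. w $ j * (v $ j) ^ 4)"
proof -
  have "0 \<le> (\<Sum>j\<in>UNIV. w $ j * ((v $ j)\<^sup>2 - wsq v)\<^sup>2)"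
    by (intro sum_nonneg mult_nonneg_nonneg weight_nonneg) auto
  also have "\<dots> = (\<Sum>j\<in>UNIV. w $ j * (v $ j) ^ 4 - 2 * wsq v * (w $ j * (v $ j)\<^sup>2) + (wsq v)\<^sup>2 * w $ j)"
    by (intro sum.cong) (auto simp: power2_eq_square power4_eq_xxxx algebra_simps)
  also have "\<dots> = (\<Sum>j\<in>UNIV. w $ j * (v $ j) ^ 4) - 2 * wsq v * wsq v + (wsq v)\<^sup>2"
    by (simp only: sum.distrib sum_subtractf sum_distrib_left[symmetric] sum_weights
        wsq_def[symmetric] mult_1_right)
  finally show ?thesis by (simp add: power2_eq_square)
qed

text \<open>If \<open>d\<close> dominates, one factor of the cube is bounded by 1 and the rest is of
  second order in \<open>d\<close>. Otherwise \<open>y\<close> is comparable to \<open>f\<close>,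
  and the cube is interpolated between second and fourth powers. The weights
  \<open>1 / sqrt n\<close> and \<open>sqrt n\<close> are chosen so that both terms have order
  n^(-3/2) when \<open>wsq f\<close> has order \<open>1 / n\<close>.\<close>

lemma cubic_split:
  assumes n: "0 < (n :: real)" and y: "wsq y \<le> 1" and y_eq: "y = f + d"
  shows "sqrt (wsq y) ^ 3 \<le> 4 * wsq d + 4 * (wsq f / sqrt n + sqrt n * (wsq f)\<^sup>2)"
proof -
  let ?u = "sqrt (wsq f)"
  have u2: "wsq f = ?u\<^sup>2" by (simp add: wsq_nonneg)
  have u: "0 \<le> wsq f / sqrt n + sqrt n * (wsq f)\<^sup>2"
    using n by (intro add_nonneg_nonneg) (auto simp: wsq_nonneg)
  have le: "wsq y \<le> 2 * wsq f + 2 * wsq d" unfolding y_eq by (rule wsq_add_le)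
  show ?thesis
  proof (cases "wsq f \<le> wsq d")
    case True
    have "sqrt (wsq y) ^ 3 = wsq y * sqrt (wsq y)"
      using wsq_nonneg[of y] by (simp add: power3_eq_cube)
    also have "\<dots> \<le> wsq y * 1" using y by (intro mult_left_mono) (auto simp: wsq_nonneg)
    also have "\<dots> \<le> 4 * wsq d" using le True by simp
    also have "\<dots> \<le> 4 * wsq d + 4 * (wsq f / sqrt n + sqrt n * (wsq f)\<^sup>2)"
      using u by (simp only: le_add_same_cancel1 zero_le_mult_iff) simp
    finally show ?thesis .
  next
    case False
    then have "wsq y \<le> 4 * wsq f" using le by simp
    then have "sqrt (wsq y) \<le> sqrt (4 * wsq f)" by (rule real_sqrt_le_mono)
    then have "sqrt (wsq y) \<le> 2 * ?u" by (simp add: real_sqrt_mult)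
    then have "sqrt (wsq y) ^ 3 \<le> (2 * ?u) ^ 3" by (intro power_mono) (simp_all add: wsq_nonneg)
    also have "\<dots> = 4 * (2 * (?u / sqrt (sqrt n)) * (sqrt (sqrt n) * ?u\<^sup>2))"
      using n by (simp add: power3_eq_cube power2_eq_square)
    also have "\<dots> \<le> 4 * ((?u / sqrt (sqrt n))\<^sup>2 + (sqrt (sqrt n) * ?u\<^sup>2)\<^sup>2)"
      by (intro mult_left_mono sum_squares_bound) auto
    also have "\<dots> = 4 * (wsq f / sqrt n + sqrt n * (wsq f)\<^sup>2)"
      using n by (simp add: power_divide power_mult_distrib wsq_nonneg)
    finally show ?thesis using wsq_nonneg[of d] by simp
  qed
qed

lemma wsq_center_le_one:
  assumes "\<And>j. 0 \<le> y $ j" "\<And>j. y $ j \<le> 1"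
  shows "wsq (center y) \<le> 1"
proof -
  have "wsq (center y) \<le> wsq y" by (rule wsq_center_le)
  also have "\<dots> \<le> (\<Sum>j\<in>UNIV. w $ j * 1)"
    unfolding wsq_def using assms
    by (intro sum_mono mult_left_mono weight_nonneg) (simp add: power_le_one)
  finally show ?thesis by (simp add: sum_weights)
qed

text \<open>The chi-square bound is for the ranks near the ends, the expansion with cubic error for
  those with margin \<open>c\<close>. The factor \<open>inv_weights\<close> passes from a single
  coordinate to the weighted norm.\<close>

lemma sum_kl_bounds:
  assumes y: "\<And>j. 0 \<le> y $ j" "\<And>j. y $ j \<le> 1" and m: "wmean y = m" "0 < m" "m < 1"
  shows "0 \<le> (\<Sum>j\<in>UNIV. w $ j * bern_kl (proj y $ j) m)"
    and "(\<Sum>j\<in>UNIV. w $ j * bern_kl (proj y $ j) m) \<le> wsq (center y) / (m * (1 - m))"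
    and "0 < c \<Longrightarrow> c \<le> m \<Longrightarrow> c \<le> 1 - m \<Longrightarrow>
      \<bar>(\<Sum>j\<in>UNIV. w $ j * bern_kl (proj y $ j) m) - iso_dev y / (2 * (m * (1 - m)))\<bar>
      \<le> 16 * inv_weights * sqrt (wsq (center y)) ^ 3 / c\<^sup>2"
proof -
  have z: "0 \<le> proj y $ j" "proj y $ j \<le> 1" for j using y by (auto intro: proj_ge proj_le)
  have dev: "iso_dev y = (\<Sum>j\<in>UNIV. w $ j * (proj y $ j - m)\<^sup>2)"
    by (simp add: iso_dev_def m(1))
  show "0 \<le> (\<Sum>j\<in>UNIV. w $ j * bern_kl (proj y $ j) m)"
    using m z by (intro sum_nonneg mult_nonneg_nonneg weight_nonneg bern_kl_nonneg)
  have "(\<Sum>j\<in>UNIV. w $ j * bern_kl (proj y $ j) m) \<le> (\<Sum>j\<in>UNIV. w $ j * ((proj y $ j - m)\<^sup>2 / (m * (1 - m))))"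
    using m z by (intro sum_mono mult_left_mono weight_nonneg bern_kl_le)
  also have "\<dots> = iso_dev y / (m * (1 - m))" by (simp add: dev sum_divide_distrib)
  also have "\<dots> \<le> wsq (center y) / (m * (1 - m))"
    using m by (intro divide_right_mono iso_dev_le) auto
  finally show "(\<Sum>j\<in>UNIV. w $ j * bern_kl (proj y $ j) m) \<le> wsq (center y) / (m * (1 - m))" .
  assume c: "0 < c" "c \<le> m" "c \<le> 1 - m"
  let ?x = "sqrt (wsq (center y))"
  have q: "\<bar>proj y $ j - m\<bar> \<le> ?x * inv_weights" for j
  proof -
    have "w $ j * (proj y $ j - m)\<^sup>2 \<le> iso_dev y"
      unfolding dev using member_le_sum[of j UNIV "\<lambda>j. w $ j * (proj y $ j - m)\<^sup>2"]
      by (simp add: weight_nonneg)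
    also have "\<dots> \<le> wsq (center y)" by (rule iso_dev_le)
    finally have "(proj y $ j - m)\<^sup>2 \<le> wsq (center y) * (1 / w $ j)"
      using weight_pos[of j] by (simp add: field_simps)
    also have "\<dots> \<le> wsq (center y) * (inv_weights)\<^sup>2"
    proof (intro mult_left_mono wsq_nonneg)
      \<comment> \<open>Since \<open>1 / w $ j\<close> lies between 1 and
        \<open>inv_weights\<close>, it is at most the square of \<open>inv_weights\<close>, which
        avoids a square root in the bound.\<close>
      have "1 \<le> 1 / w $ j" using weight_pos[of j] weight_le_one[of j] by simp
      then have "1 / w $ j * 1 \<le> inv_weights * inv_weights"
        using inv_weights_ge[of j] weight_nonneg[of j] by (intro mult_mono) auto
      then show "1 / w $ j \<le> inv_weights\<^sup>2" by (simp add: power2_eq_square)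
    qed
    finally have "sqrt ((proj y $ j - m)\<^sup>2) \<le> sqrt (wsq (center y) * inv_weights\<^sup>2)"
      by (rule real_sqrt_le_mono)
    then show ?thesis using inv_weights_nonneg by (simp add: real_sqrt_mult)
  qed
  have "\<bar>(\<Sum>j\<in>UNIV. w $ j * bern_kl (proj y $ j) m) - iso_dev y / (2 * (m * (1 - m)))\<bar>
      = \<bar>\<Sum>j\<in>UNIV. w $ j * (bern_kl (proj y $ j) m - (proj y $ j - m)\<^sup>2 / (2 * (m * (1 - m))))\<bar>"
    by (simp add: dev right_diff_distrib sum_subtractf sum_divide_distrib)
  also have "\<dots> \<le> (\<Sum>j\<in>UNIV. \<bar>w $ j * (bern_kl (proj y $ j) m - (proj y $ j - m)\<^sup>2 / (2 * (m * (1 - m))))\<bar>)"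
    by (rule sum_abs)
  also have "\<dots> = (\<Sum>j\<in>UNIV. w $ j * \<bar>bern_kl (proj y $ j) m - (proj y $ j - m)\<^sup>2 / (2 * (m * (1 - m)))\<bar>)"
    by (simp add: abs_mult weight_nonneg)
  also have "\<dots> \<le> (\<Sum>j\<in>UNIV. w $ j * (16 * \<bar>proj y $ j - m\<bar> ^ 3 / c\<^sup>2))"
    using m z c by (intro sum_mono mult_left_mono weight_nonneg bern_kl_quadratic) auto
  also have "\<dots> = 16 * (\<Sum>j\<in>UNIV. w $ j * (proj y $ j - m)\<^sup>2 * \<bar>proj y $ j - m\<bar>) / c\<^sup>2"
    unfolding sum_distrib_left sum_divide_distrib
    by (intro sum.cong refl) (simp add: power3_eq_cube power2_eq_square flip: abs_mult)
  also have "\<dots> \<le> 16 * (\<Sum>j\<in>UNIV. w $ j * (proj y $ j - m)\<^sup>2 * (?x * inv_weights)) / c\<^sup>2"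
    by (intro divide_right_mono mult_left_mono sum_mono q) (auto simp: weight_nonneg)
  also have "\<dots> = 16 * (iso_dev y * (?x * inv_weights)) / c\<^sup>2"
    by (simp add: dev sum_distrib_right)
  also have "\<dots> \<le> 16 * (wsq (center y) * (?x * inv_weights)) / c\<^sup>2"
    using inv_weights_nonneg
    by (intro divide_right_mono mult_left_mono mult_right_mono iso_dev_le) (auto simp: wsq_nonneg)
  also have "wsq (center y) * (?x * inv_weights) = inv_weights * ?x ^ 3"
    using wsq_nonneg[of "center y"] by (simp add: power3_eq_cube)
  finally show "\<bar>(\<Sum>j\<in>UNIV. w $ j * bern_kl (proj y $ j) m) - iso_dev y / (2 * (m * (1 - m)))\<bar>
      \<le> 16 * inv_weights * ?x ^ 3 / c\<^sup>2"
    by simp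
qed

end

locale sample_model = samples w N + iid_pool M "samples.pool N" \<xi> \<nu>
  for w :: "real ^ 'k::{finite,linorder}" and N and M :: "'a measure"
    and \<xi> :: "'k \<times> nat \<Rightarrow> 'a \<Rightarrow> real" and \<nu>
begin

text \<open>Coefficients of the contrast between the mean of sample \<open>j\<close> and the pooled
  mean. They sum to zero, as \<open>equivariant_second_moment\<close> requires.\<close>

definition coef :: "'k \<Rightarrow> 'k \<times> nat \<Rightarrow> real" where
  "coef j p = of_bool (fst p = j) / N j - 1 / size"

definition ranked :: "nat \<Rightarrow> 'a \<Rightarrow> (real, 'k) vec" where
  "ranked r \<omega> = rank_ecdf (\<lambda>p. \<xi> p \<omega>) r"

definition emp :: "real \<Rightarrow> 'a \<Rightarrow> (real, 'k) vec" where
  "emp s \<omega> = (\<chi> j. (\<Sum>i<N j. of_bool (\<xi> (j, i) \<omega> \<le> s)) / N j)"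

section \<open>Moments of the centered empirical vectors at ranks and at fixed thresholds\<close>

lemma sum_group:
  fixes f :: "'k \<times> nat \<Rightarrow> real"
  shows "(\<Sum>p\<in>pool. of_bool (fst p = j) * f p) = (\<Sum>i<N j. f (j, i))"
proof -
  have "(\<Sum>p\<in>pool. of_bool (fst p = j) * f p) = (\<Sum>l\<in>UNIV. if l = j then \<Sum>i<N l. f (l, i) else 0)"
    unfolding sum_pool by (intro sum.cong) auto
  then show ?thesis by simp
qed

lemma center_ecdf:
  "center (\<chi> j. (\<Sum>i<N j. f (j, i)) / N j) $ j = (\<Sum>p\<in>pool. coef j p * f p)"
proof -
  have "(\<Sum>p\<in>pool. coef j p * f p) = (\<Sum>p\<in>pool. of_bool (fst p = j) * f p) / N j - (\<Sum>p\<in>pool. f p) / size"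
    by (simp add: coef_def left_diff_distrib sum_subtractf sum_divide_distrib)
  then show ?thesis by (simp add: center_def wmean_ecdf sum_group)
qed

lemma sum_coef: "(\<Sum>p\<in>pool. coef j p) = 0"
  using sum_group[of j "\<lambda>_. 1"] N_pos[of j] size_pos
  by (simp add: coef_def sum_subtractf card_pool flip: sum_divide_distrib)

lemma sum_coef_square: "(\<Sum>p\<in>pool. (coef j p)\<^sup>2) \<le> 1 / N j"
proof -
  have "(\<Sum>p\<in>pool. (coef j p)\<^sup>2) = (\<Sum>p\<in>pool. of_bool (fst p = j) * coef j p / N j - coef j p / size)"
    by (intro sum.cong) (auto simp: coef_def power2_eq_square field_simps)
  also have "\<dots> = (\<Sum>p\<in>pool. of_bool (fst p = j) * coef j p) / N j"
    by (simp add: sum_subtractf sum_coef flip: sum_divide_distrib)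
  also have "\<dots> = 1 / N j - 1 / size"
    using N_pos[of j] size_pos unfolding sum_group by (simp add: coef_def)
  finally show ?thesis by simp
qed

lemma weight_div_N: "w $ j / N j = 1 / size"
  using N_eq[of j] weight_pos[of j] N_pos[of j] size_pos by (simp add: field_simps)

lemma components_measurable:
  assumes "\<And>p. p \<in> pool \<Longrightarrow> f p \<in> borel_measurable M"
  shows "(\<lambda>\<omega>. \<chi> j. (\<Sum>i<N j. f (j, i) \<omega>) / N j) \<in> borel_measurable M"
  by (intro borel_measurable_vec_lambda borel_measurable_divide borel_measurable_sum
      borel_measurable_const assms) (auto simp: pool_def)

lemma integrable_bounded_vector:
  fixes g :: "(real, 'k) vec \<Rightarrow> real"
  assumes V: "V \<in> borel_measurable M" and b: "\<And>\<omega> j. \<bar>V \<omega> $ j\<bar> \<le> b" and g: "continuous_on UNIV g"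
  shows "integrable M (\<lambda>\<omega>. g (V \<omega>))"
proof -
  have "compact (g ` cbox (\<chi> j. - b) (\<chi> j. b))"
    by (intro compact_continuous_image continuous_on_subset[OF g]) auto
  then have "bounded (g ` cbox (\<chi> j. - b) (\<chi> j. b))" by (rule compact_imp_bounded)
  then obtain B where "\<forall>y\<in>g ` cbox (\<chi> j. - b) (\<chi> j. b). norm y \<le> B"
    unfolding bounded_iff ..
  then have B: "\<And>y. y \<in> g ` cbox (\<chi> j. - b) (\<chi> j. b) \<Longrightarrow> norm y \<le> B" by (rule bspec)
  have "- b \<le> V \<omega> $ j \<and> V \<omega> $ j \<le> b" for \<omega> j
    using b[of \<omega> j] by linarith
  then have "V \<omega> \<in> cbox (\<chi> j. - b) (\<chi> j. b)" for \<omega>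
    by (simp add: mem_box_cart)
  then have "norm (g (V \<omega>)) \<le> B" for \<omega> by (intro B imageI)
  then show ?thesis
    by (intro integrable_const_bound[of _ B] AE_I2 borel_measurable_continuous_on[OF g V])
qed

text \<open>Coordinate \<open>j\<close> has weight \<open>w $ j\<close> and contrast norm at most
  \<open>1 / N j\<close>, and the product is \<open>1 / size\<close> for every \<open>j\<close>; the
  number of samples therefore appears as the only constant.\<close>

lemma expectation_wsq_center:
  assumes f: "\<And>p. p \<in> pool \<Longrightarrow> f p \<in> borel_measurable M" and b: "\<And>p \<omega>. p \<in> pool \<Longrightarrow> \<bar>f p \<omega>\<bar> \<le> 1"
    and m: "\<And>j. expectation (\<lambda>\<omega>. (\<Sum>p\<in>pool. coef j p * f p \<omega>)\<^sup>2) \<le> (\<Sum>p\<in>pool. (coef j p)\<^sup>2) * \<rho>"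
    and \<rho>: "0 \<le> \<rho>"
  defines "V \<equiv> \<lambda>\<omega>. \<chi> j. (\<Sum>i<N j. f (j, i) \<omega>) / N j"
  shows "integrable M (\<lambda>\<omega>. wsq (center (V \<omega>)))"
    and "expectation (\<lambda>\<omega>. wsq (center (V \<omega>))) \<le> real CARD('k) / size * \<rho>"
proof -
  have V: "V \<in> borel_measurable M" unfolding V_def by (rule components_measurable[OF f])
  have bV: "\<bar>V \<omega> $ j\<bar> \<le> 1" for \<omega> j
  proof -
    have "\<bar>\<Sum>i<N j. f (j, i) \<omega>\<bar> \<le> (\<Sum>i<N j. 1)"
      using b by (intro order_trans[OF sum_abs] sum_mono) (auto simp: pool_def)
    then show ?thesis using N_pos[of j] by (simp add: V_def)
  qed
  show "integrable M (\<lambda>\<omega>. wsq (center (V \<omega>)))"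
    by (rule integrable_bounded_vector[OF V bV continuous_wsq_center])
  have "integrable M (\<lambda>\<omega>. (center (V \<omega>) $ j)\<^sup>2)" for j
    by (rule integrable_bounded_vector[OF V bV])
      (intro continuous_intros continuous_on_compose2[OF continuous_on_component[OF continuous_on_id] continuous_center], auto)
  then have "expectation (\<lambda>\<omega>. wsq (center (V \<omega>))) = (\<Sum>j\<in>UNIV. w $ j * expectation (\<lambda>\<omega>. (center (V \<omega>) $ j)\<^sup>2))"
    unfolding wsq_def by simp
  also have "\<dots> = (\<Sum>j\<in>UNIV. w $ j * expectation (\<lambda>\<omega>. (\<Sum>p\<in>pool. coef j p * f p \<omega>)\<^sup>2))"
    unfolding V_def by (subst center_ecdf) simp
  also have "\<dots> \<le> (\<Sum>j\<in>UNIV. w $ j * (1 / N j * \<rho>))"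
    using \<rho> by (intro sum_mono mult_left_mono weight_nonneg order_trans[OF m] mult_right_mono sum_coef_square)
  also have "\<dots> = (\<Sum>j\<in>(UNIV :: 'k set). 1 / size * \<rho>)"
  proof (intro sum.cong refl)
    fix j
    have "w $ j * (1 / N j * \<rho>) = w $ j / N j * \<rho>" by simp
    then show "w $ j * (1 / N j * \<rho>) = 1 / size * \<rho>" by (simp only: weight_div_N)
  qed
  finally show "expectation (\<lambda>\<omega>. wsq (center (V \<omega>))) \<le> real CARD('k) / size * \<rho>" by simp
qed

lemma measurable_rnk: "p \<in> pool \<Longrightarrow> (\<lambda>\<omega>. of_bool (rnk \<omega> p \<le> r) :: real) \<in> borel_measurable M"
proof -
  assume "p \<in> pool"
  then have [measurable]: "(\<lambda>\<omega>. rnk \<omega> p) \<in> measurable M (count_space UNIV)"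
    by (intro measurable_rank_in finite_pool rv)
  show ?thesis by measurable
qed

lemma measurable_le: "p \<in> pool \<Longrightarrow> (\<lambda>\<omega>. of_bool (\<xi> p \<omega> \<le> s) :: real) \<in> borel_measurable M"
proof -
  assume "p \<in> pool"
  then have [measurable]: "\<xi> p \<in> borel_measurable M" by (rule rv)
  show ?thesis by measurable
qed

lemma ranked_measurable: "ranked r \<in> borel_measurable M"
  unfolding ranked_def rank_ecdf_def
  by (rule components_measurable[where f="\<lambda>p \<omega>. of_bool (rnk \<omega> p \<le> r)", OF measurable_rnk])

lemma emp_measurable: "emp s \<in> borel_measurable M"
  unfolding emp_def
  by (rule components_measurable[where f="\<lambda>p \<omega>. of_bool (\<xi> p \<omega> \<le> s)", OF measurable_le])

lemma size_ge_2: "2 \<le> size"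
  using card_I card_pool by simp

text \<open>\<open>rank_second_moment\<close> in the weighted norm; the factor 2 bounds
  \<open>size / (size - 1)\<close>.\<close>

lemma ranked_moment:
  assumes r: "r \<le> size"
  shows "integrable M (\<lambda>\<omega>. wsq (center (ranked r \<omega>)))"
    and "expectation (\<lambda>\<omega>. wsq (center (ranked r \<omega>))) \<le> real CARD('k) / size * (2 * (r / size * (1 - r / size)))"
proof -
  let ?\<rho> = "real r * (real size - real r) / (real size * (real size - 1))"
  have m: "expectation (\<lambda>\<omega>. (\<Sum>p\<in>pool. coef j p * of_bool (rnk \<omega> p \<le> r))\<^sup>2) \<le> (\<Sum>p\<in>pool. (coef j p)\<^sup>2) * ?\<rho>" for j
    using rank_second_moment[of r "coef j"] r sum_coef[of j] by (simp add: card_pool)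
  have \<rho>: "0 \<le> ?\<rho>" using r size_ge_2 by (intro divide_nonneg_nonneg mult_nonneg_nonneg) auto
  have eq: "ranked r \<omega> = (\<chi> j. (\<Sum>i<N j. of_bool (rnk \<omega> (j, i) \<le> r)) / N j)" for \<omega>
    by (simp add: ranked_def rank_ecdf_def)
  note * = expectation_wsq_center[where f="\<lambda>p \<omega>. of_bool (rnk \<omega> p \<le> r)", OF measurable_rnk _ m \<rho>]
  show "integrable M (\<lambda>\<omega>. wsq (center (ranked r \<omega>)))"
    unfolding eq by (rule *(1)) auto
  have "expectation (\<lambda>\<omega>. wsq (center (ranked r \<omega>))) \<le> real CARD('k) / size * ?\<rho>"
    unfolding eq by (rule *(2)) auto
  also have "\<dots> \<le> real CARD('k) / size * (2 * (r / size * (1 - r / size)))"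
  proof (intro mult_left_mono)
    have s: "2 \<le> real size" using size_ge_2 by simp
    have "?\<rho> = (r / size * (1 - r / size)) * (size / (size - 1))"
      using s by (simp add: field_simps)
    also have "\<dots> \<le> (r / size * (1 - r / size)) * 2"
      using s r by (intro mult_left_mono mult_nonneg_nonneg) (auto simp: field_simps)
    finally show "?\<rho> \<le> 2 * (r / size * (1 - r / size))" by (simp only: mult.commute)
  qed auto
  finally show "expectation (\<lambda>\<omega>. wsq (center (ranked r \<omega>))) \<le> real CARD('k) / size * (2 * (r / size * (1 - r / size)))" .
qed

text \<open>When \<open>s\<close> is the quantile of level \<open>r / size\<close>, only
  \<open>1 / sqrt size\<close> remains in the bracket, and the bound has order n^(-3/2), smaller by
  \<open>1 / sqrt size\<close> than that for either vector alone.\<close>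

lemma ranked_emp_moment:
  assumes r: "r \<le> size"
  shows "integrable M (\<lambda>\<omega>. wsq (center (ranked r \<omega> - emp s \<omega>)))"
    and "expectation (\<lambda>\<omega>. wsq (center (ranked r \<omega> - emp s \<omega>)))
      \<le> real CARD('k) / size * (\<bar>r / size - measure \<nu> {..s}\<bar> + 1 / sqrt size)"
proof -
  let ?f = "\<lambda>p \<omega>. of_bool (rnk \<omega> p \<le> r) - of_bool (\<xi> p \<omega> \<le> s) :: real"
  let ?\<rho> = "\<bar>r / size - measure \<nu> {..s}\<bar> + 1 / sqrt size"
  have m: "expectation (\<lambda>\<omega>. (\<Sum>p\<in>pool. coef j p * ?f p \<omega>)\<^sup>2) \<le> (\<Sum>p\<in>pool. (coef j p)\<^sup>2) * ?\<rho>" for j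
    using rank_indicator_second_moment[of r "coef j" s] r sum_coef[of j] by (simp add: card_pool)
  have f: "?f p \<in> borel_measurable M" if "p \<in> pool" for p
    using measurable_rnk[OF that] measurable_le[OF that] by simp
  have eq: "ranked r \<omega> - emp s \<omega> = (\<chi> j. (\<Sum>i<N j. ?f (j, i) \<omega>) / N j)" for \<omega>
    by (simp add: ranked_def emp_def rank_ecdf_def vec_eq_iff sum_subtractf diff_divide_distrib)
  note * = expectation_wsq_center[where f="?f", OF f _ m]
  show "integrable M (\<lambda>\<omega>. wsq (center (ranked r \<omega> - emp s \<omega>)))"
    unfolding eq by (rule *(1)) auto
  show "expectation (\<lambda>\<omega>. wsq (center (ranked r \<omega> - emp s \<omega>))) \<le> real CARD('k) / size * ?\<rho>"
    unfolding eq by (rule *(2)) auto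
qed

lemma emp_bounds: "\<bar>emp s \<omega> $ j - measure \<nu> {..s}\<bar> \<le> 1"
proof -
  interpret \<nu>: real_distribution \<nu> by (rule real_distribution_law)
  have "(\<Sum>i<N j. of_bool (\<xi> (j, i) \<omega> \<le> s)) \<le> (\<Sum>i<N j. 1 :: real)" by (intro sum_mono) auto
  then have "0 \<le> emp s \<omega> $ j" "emp s \<omega> $ j \<le> 1"
    using N_pos[of j] by (simp_all add: emp_def sum_nonneg)
  moreover have "0 \<le> p \<Longrightarrow> p \<le> 1 \<Longrightarrow> 0 \<le> q \<Longrightarrow> q \<le> 1 \<Longrightarrow> \<bar>p - q\<bar> \<le> 1" for p q :: real by linarith
  ultimately show ?thesis by simp
qed

lemma emp_component_moments:
  shows "integrable M (\<lambda>\<omega>. (emp s \<omega> $ j - measure \<nu> {..s}) ^ q)"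
    and "expectation (\<lambda>\<omega>. (emp s \<omega> $ j - measure \<nu> {..s})\<^sup>2) \<le> 1 / N j"
    and "expectation (\<lambda>\<omega>. (emp s \<omega> $ j - measure \<nu> {..s}) ^ 4) \<le> 3 / (real (N j))\<^sup>2"
proof -
  have m: "(\<lambda>\<omega>. emp s \<omega> $ j) \<in> borel_measurable M"
    using measurable_compose[OF emp_measurable borel_measurable_continuous_onI[OF continuous_on_component[OF continuous_on_id]]] .
  show "integrable M (\<lambda>\<omega>. (emp s \<omega> $ j - measure \<nu> {..s}) ^ q)"
    by (rule integrable_const_bound[of _ 1])
      (use m emp_bounds in \<open>auto simp: power_abs intro!: power_le_one\<close>)
  let ?A = "Pair j ` {..<N j}"
  have A: "?A \<subseteq> pool" "card ?A = N j"
    by (auto simp: pool_def card_image inj_on_def)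
  have re: "(\<Sum>p\<in>?A. g p) = (\<Sum>i<N j. g (j, i))" for g :: "'k \<times> nat \<Rightarrow> real"
    by (subst sum.reindex) (auto simp: inj_on_def)
  have eq: "emp s \<omega> $ j - measure \<nu> {..s} = (\<Sum>p\<in>?A. of_bool (\<xi> p \<omega> \<le> s) - measure \<nu> {..s}) / N j" for \<omega>
    unfolding re using N_pos[of j] by (simp add: emp_def sum_subtractf diff_divide_distrib)
  have n: "0 < real (N j)" using N_pos[of j] by simp
  have "expectation (\<lambda>\<omega>. (emp s \<omega> $ j - measure \<nu> {..s})\<^sup>2)
      = expectation (\<lambda>\<omega>. (\<Sum>p\<in>?A. of_bool (\<xi> p \<omega> \<le> s) - measure \<nu> {..s})\<^sup>2) / (N j)\<^sup>2"
    unfolding eq power_divide by simp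
  also have "\<dots> \<le> N j / (N j)\<^sup>2"
    using indicator_sum_moments(1)[OF A(1), of s] A(2) by (intro divide_right_mono) auto
  finally show "expectation (\<lambda>\<omega>. (emp s \<omega> $ j - measure \<nu> {..s})\<^sup>2) \<le> 1 / N j"
    using n by (simp add: power2_eq_square)
  have "expectation (\<lambda>\<omega>. (emp s \<omega> $ j - measure \<nu> {..s}) ^ 4)
      = expectation (\<lambda>\<omega>. (\<Sum>p\<in>?A. of_bool (\<xi> p \<omega> \<le> s) - measure \<nu> {..s}) ^ 4) / (N j) ^ 4"
    unfolding eq power_divide by simp
  also have "\<dots> \<le> 3 * (N j)\<^sup>2 / (N j) ^ 4"
    using indicator_sum_moments(2)[OF A(1), of s] A(2) by (intro divide_right_mono) auto
  finally show "expectation (\<lambda>\<omega>. (emp s \<omega> $ j - measure \<nu> {..s}) ^ 4) \<le> 3 / (real (N j))\<^sup>2"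
    using n by (simp add: power2_eq_square power4_eq_xxxx)
qed

lemma center_shift: "center (\<chi> j. y $ j + c) = center y"
  by (simp add: center_def wmean_shift)

lemma wsq_center_emp: "wsq (center (emp s \<omega>)) \<le> wsq (\<chi> j. emp s \<omega> $ j - measure \<nu> {..s})"
  using wsq_center_le[of "\<chi> j. emp s \<omega> $ j - measure \<nu> {..s}"]
    center_shift[of "emp s \<omega>" "- measure \<nu> {..s}"] by simp

lemma emp_moment:
  shows "integrable M (\<lambda>\<omega>. wsq (center (emp s \<omega>)))"
    and "expectation (\<lambda>\<omega>. wsq (center (emp s \<omega>))) \<le> real CARD('k) / size"
    and "integrable M (\<lambda>\<omega>. (wsq (center (emp s \<omega>)))\<^sup>2)"
    and "expectation (\<lambda>\<omega>. (wsq (center (emp s \<omega>)))\<^sup>2) \<le> 3 * inv_weights / (real size)\<^sup>2"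
proof -
  let ?p = "measure \<nu> {..s}"
  interpret \<nu>: real_distribution \<nu> by (rule real_distribution_law)
  have b: "\<bar>emp s \<omega> $ j\<bar> \<le> 2" for \<omega> j
  proof -
    have "0 \<le> ?p \<Longrightarrow> ?p \<le> 1 \<Longrightarrow> \<bar>emp s \<omega> $ j - ?p\<bar> \<le> 1 \<Longrightarrow> \<bar>emp s \<omega> $ j\<bar> \<le> 2" by linarith
    then show ?thesis using emp_bounds by simp
  qed
  show i1: "integrable M (\<lambda>\<omega>. wsq (center (emp s \<omega>)))"
    by (rule integrable_bounded_vector[OF emp_measurable b continuous_wsq_center])
  show i2: "integrable M (\<lambda>\<omega>. (wsq (center (emp s \<omega>)))\<^sup>2)"
    by (rule integrable_bounded_vector[OF emp_measurable b]) (intro continuous_intros continuous_wsq_center)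
  have "expectation (\<lambda>\<omega>. wsq (center (emp s \<omega>))) \<le> expectation (\<lambda>\<omega>. \<Sum>j\<in>UNIV. w $ j * (emp s \<omega> $ j - ?p)\<^sup>2)"
    using wsq_center_emp by (intro integral_mono i1) (auto simp: wsq_def intro!: emp_component_moments)
  also have "\<dots> = (\<Sum>j\<in>UNIV. w $ j * expectation (\<lambda>\<omega>. (emp s \<omega> $ j - ?p)\<^sup>2))"
    by (simp add: emp_component_moments)
  also have "\<dots> \<le> (\<Sum>j\<in>UNIV. w $ j * (1 / N j))"
    by (intro sum_mono mult_left_mono weight_nonneg emp_component_moments)
  also have "\<dots> = real CARD('k) / size" by (simp add: weight_div_N)
  finally show "expectation (\<lambda>\<omega>. wsq (center (emp s \<omega>))) \<le> real CARD('k) / size" .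
  have "expectation (\<lambda>\<omega>. (wsq (center (emp s \<omega>)))\<^sup>2) \<le> expectation (\<lambda>\<omega>. \<Sum>j\<in>UNIV. w $ j * (emp s \<omega> $ j - ?p) ^ 4)"
  proof (intro integral_mono i2)
    show "integrable M (\<lambda>\<omega>. \<Sum>j\<in>UNIV. w $ j * (emp s \<omega> $ j - ?p) ^ 4)"
      by (auto intro!: emp_component_moments)
    fix \<omega>
    have "(wsq (center (emp s \<omega>)))\<^sup>2 \<le> (wsq (\<chi> j. emp s \<omega> $ j - ?p))\<^sup>2"
      by (intro power_mono wsq_center_emp wsq_nonneg)
    also have "\<dots> \<le> (\<Sum>j\<in>UNIV. w $ j * (emp s \<omega> $ j - ?p) ^ 4)"
      using wsq_square_le[of "\<chi> j. emp s \<omega> $ j - ?p"] by simp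
    finally show "(wsq (center (emp s \<omega>)))\<^sup>2 \<le> (\<Sum>j\<in>UNIV. w $ j * (emp s \<omega> $ j - ?p) ^ 4)" .
  qed
  also have "\<dots> = (\<Sum>j\<in>UNIV. w $ j * expectation (\<lambda>\<omega>. (emp s \<omega> $ j - ?p) ^ 4))"
    by (simp add: emp_component_moments)
  also have "\<dots> \<le> (\<Sum>j\<in>UNIV. w $ j * (3 / (real (N j))\<^sup>2))"
    by (intro sum_mono mult_left_mono weight_nonneg emp_component_moments)
  also have "\<dots> = 3 * inv_weights / (real size)\<^sup>2"
    unfolding inv_weights_def sum_distrib_left sum_divide_distrib
  proof (intro sum.cong refl)
    fix j
    show "w $ j * (3 / (real (N j))\<^sup>2) = 3 * (1 / w $ j) / (real size)\<^sup>2"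
      using weight_pos[of j] size_pos by (simp add: N_eq power_mult_distrib power2_eq_square)
  qed
  finally show "expectation (\<lambda>\<omega>. (wsq (center (emp s \<omega>)))\<^sup>2) \<le> 3 * inv_weights / (real size)\<^sup>2" .
qed

end

context samples
begin

text \<open>At the last rank the weight \<open>1 / (m * (1 - m))\<close> is singular, but every
  sample ecdf, and hence every projected value, equals 1 and the divergence vanishes.\<close>

lemma rank_stat_size: "rank_stat x size = 0"
proof -
  have "rank_in pool x p \<le> size" for p
    unfolding rank_in_def card_pool[symmetric] by (intro card_mono finite_pool) auto
  then have y: "rank_ecdf x size $ j = 1" for j
    using N_pos[of j] by (simp add: rank_ecdf_def)
  have "proj (rank_ecdf x size) $ j = 1" for j
    using proj_ge[of 1 "rank_ecdf x size" j] proj_le[of "rank_ecdf x size" 1 j] y by simp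
  then show ?thesis using size_pos by (simp add: rank_stat_def bern_kl_def)
qed

end

context sample_model
begin

section \<open>The statistic as the integral of a step function and its Riemann sums\<close>

definition stat :: "nat \<Rightarrow> 'a \<Rightarrow> real" where
  "stat r \<omega> = rank_stat (\<lambda>p. \<xi> p \<omega>) r"

text \<open>The rank belonging to \<open>t\<close> is the ceiling of \<open>t * size\<close>; each
  rank occupies an interval of length \<open>1 / size\<close>, so the integral is the average over
  the ranks.\<close>

definition step_stat :: "real \<Rightarrow> 'a \<Rightarrow> real" where
  "step_stat t \<omega> = (\<Sum>r=1..size. indicator {(real r - 1) / size<..real r / size} t * stat r \<omega>)"

text \<open>Intermediate value theorem for the continuous cdf. Besides the absence of ties, this is
  where continuity of the common distribution is used.\<close>

lemma exists_quantile:
  assumes "0 < p" "p < 1"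
  shows "\<exists>x. measure \<nu> {..x} = p"
proof -
  interpret \<nu>: real_distribution \<nu> by (rule real_distribution_law)
  have cont: "isCont (cdf \<nu>) x" for x using atomless by (simp add: \<nu>.isCont_cdf)
  have "\<forall>\<^sub>F x in at_bot. cdf \<nu> x < p" "\<forall>\<^sub>F x in at_top. p < cdf \<nu> x"
    using order_tendstoD[OF \<nu>.cdf_lim_at_bot] order_tendstoD[OF \<nu>.cdf_lim_at_top_prob] assms by auto
  then obtain l u where l: "cdf \<nu> l < p" and u: "p < cdf \<nu> u"
    by (auto simp: eventually_at_bot_linorder eventually_at_top_linorder)
  have "l \<le> u"
  proof (rule ccontr)
    assume "\<not> l \<le> u"
    then have "cdf \<nu> u \<le> cdf \<nu> l" by (intro \<nu>.cdf_nondecreasing) auto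
    then show False using l u by simp
  qed
  then obtain x where "cdf \<nu> x = p"
    using IVT[of "cdf \<nu>" l p u] l u cont by auto
  then show ?thesis by (auto simp: cdf_def)
qed

lemma AE_ranked:
  assumes "r \<le> size" shows "AE \<omega> in M. wmean (ranked r \<omega>) = r / size"
  using AE_inj by eventually_elim (simp add: ranked_def wmean_rank_ecdf assms)

lemma stat_measurable: "stat r \<in> borel_measurable M"
proof -
  define g where "g y = 2 * size * (\<Sum>j\<in>UNIV. w $ j * bern_kl (proj y $ j) (r / size))" for y
  note [measurable] = measurable_proj
  have "g \<in> borel_measurable borel" unfolding g_def bern_kl_def by measurable
  from measurable_compose[OF ranked_measurable this, of r]
  show ?thesis by (simp add: g_def stat_def[abs_def] rank_stat_def ranked_def)
qed

text \<open>The chi-square bound carries the weight \<open>1 / (m * (1 - m))\<close>, and the second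
  moment of the rank vector carries \<open>m * (1 - m)\<close>. They cancel, so the bound is uniform
  over all ranks including the extreme ones.\<close>

lemma stat_bound:
  assumes r: "1 \<le> r" "r \<le> size"
  shows "(\<integral>\<^sup>+\<omega>. ennreal \<bar>stat r \<omega>\<bar> \<partial>M) \<le> ennreal (4 * real CARD('k))"
proof (cases "r = size")
  case True
  then show ?thesis by (simp add: stat_def rank_stat_size)
next
  case False
  let ?m = "real r / size"
  have n: "0 < real size" using size_pos by simp
  have m: "0 < ?m" "?m < 1" using r False n by auto
  have p: "0 < ?m * (1 - ?m)" using m by (intro mult_pos_pos) auto
  have "(\<integral>\<^sup>+\<omega>. ennreal \<bar>stat r \<omega>\<bar> \<partial>M)
      \<le> (\<integral>\<^sup>+\<omega>. ennreal (2 * size * (wsq (center (ranked r \<omega>)) / (?m * (1 - ?m)))) \<partial>M)"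
  proof (rule nn_integral_mono_AE)
    show "AE \<omega> in M. ennreal \<bar>stat r \<omega>\<bar> \<le> ennreal (2 * size * (wsq (center (ranked r \<omega>)) / (?m * (1 - ?m))))"
      using AE_ranked[OF r(2)]
    proof eventually_elim
      case (elim \<omega>)
      note b = sum_kl_bounds[OF rank_ecdf_bounds elim[unfolded ranked_def] m]
      have "\<bar>stat r \<omega>\<bar> = 2 * size * (\<Sum>j\<in>UNIV. w $ j * bern_kl (proj (ranked r \<omega>) $ j) ?m)"
        using b(1) by (simp add: stat_def rank_stat_def ranked_def)
      also have "\<dots> \<le> 2 * size * (wsq (center (ranked r \<omega>)) / (?m * (1 - ?m)))"
        using b(2) by (intro mult_left_mono) (auto simp: ranked_def)
      finally show ?case by (rule ennreal_leI)
    qed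
  qed
  also have "\<dots> = ennreal (expectation (\<lambda>\<omega>. 2 * size * (wsq (center (ranked r \<omega>)) / (?m * (1 - ?m)))))"
    using ranked_moment(1)[OF r(2)] m
    by (intro nn_integral_eq_integral) (auto simp: wsq_nonneg intro!: AE_I2)
  also have "\<dots> \<le> ennreal (4 * real CARD('k))"
  proof (rule ennreal_leI)
    have "expectation (\<lambda>\<omega>. 2 * size * (wsq (center (ranked r \<omega>)) / (?m * (1 - ?m))))
        = 2 * size * (expectation (\<lambda>\<omega>. wsq (center (ranked r \<omega>))) / (?m * (1 - ?m)))"
      by simp
    also have "\<dots> \<le> 2 * size * (real CARD('k) / size * (2 * (?m * (1 - ?m))) / (?m * (1 - ?m)))"
      using p by (intro mult_left_mono divide_right_mono ranked_moment(2)[OF r(2)]) auto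
    also have "\<dots> = 2 * size * (real CARD('k) / size * 2)"
    proof -
      have "x * (2 * y) / y = x * 2" if "0 < y" for x y :: real using that by simp
      from this[OF p] show ?thesis by (simp only:)
    qed
    also have "\<dots> = 4 * real CARD('k)" using n by simp
    finally show "expectation (\<lambda>\<omega>. 2 * size * (wsq (center (ranked r \<omega>)) / (?m * (1 - ?m))))
        \<le> 4 * real CARD('k)" .
  qed
  finally show ?thesis .
qed

text \<open>\<open>cubic_split\<close> with the empirical vector at the exact quantile of level
  \<open>r / size\<close> as \<open>f\<close>: it supplies fourth moments, and the difference to the
  rank vector has second moment of order n^(-3/2).\<close>

lemma ranked_cubic:
  assumes r: "0 < r" "r < size"
  shows "integrable M (\<lambda>\<omega>. size * sqrt (wsq (center (ranked r \<omega>))) ^ 3)"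
    and "expectation (\<lambda>\<omega>. size * sqrt (wsq (center (ranked r \<omega>))) ^ 3)
      \<le> (8 * real CARD('k) + 12 * inv_weights) / sqrt size"
proof -
  let ?k = "real CARD('k)" and ?n = "real size"
  have n: "0 < ?n" using size_pos by simp
  obtain s where s: "measure \<nu> {..s} = r / ?n"
    using exists_quantile[of "r / ?n"] r n by auto
  have b: "\<bar>ranked r \<omega> $ j\<bar> \<le> 1" for \<omega> j
    using rank_ecdf_bounds[of "\<lambda>p. \<xi> p \<omega>" r j] by (simp add: ranked_def)
  show i0: "integrable M (\<lambda>\<omega>. size * sqrt (wsq (center (ranked r \<omega>))) ^ 3)"
    by (rule integrable_bounded_vector[OF ranked_measurable b])
      (intro continuous_intros continuous_wsq_center)
  note i = ranked_emp_moment(1)[of r s] emp_moment(1)[of s] emp_moment(3)[of s]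
  let ?U = "\<lambda>\<omega>. ?n * (4 * wsq (center (ranked r \<omega> - emp s \<omega>))
      + 4 * (wsq (center (emp s \<omega>)) / sqrt ?n + sqrt ?n * (wsq (center (emp s \<omega>)))\<^sup>2))"
  have "expectation (\<lambda>\<omega>. size * sqrt (wsq (center (ranked r \<omega>))) ^ 3) \<le> expectation ?U"
  proof (intro integral_mono i0)
    show "integrable M ?U" using i r by auto
    fix \<omega>
    have "center (ranked r \<omega>) = center (emp s \<omega>) + center (ranked r \<omega> - emp s \<omega>)"
      by (simp add: center_diff)
    then show "size * sqrt (wsq (center (ranked r \<omega>))) ^ 3 \<le> ?U \<omega>"
      using n rank_ecdf_bounds by (intro mult_left_mono cubic_split wsq_center_le_one) (auto simp: ranked_def)
  qed
  also have "\<dots> = ?n * (4 * expectation (\<lambda>\<omega>. wsq (center (ranked r \<omega> - emp s \<omega>)))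
      + 4 * (expectation (\<lambda>\<omega>. wsq (center (emp s \<omega>))) / sqrt ?n
        + sqrt ?n * expectation (\<lambda>\<omega>. (wsq (center (emp s \<omega>)))\<^sup>2)))"
    using i r by simp
  also have "\<dots> \<le> ?n * (4 * (?k / ?n * (\<bar>r / ?n - measure \<nu> {..s}\<bar> + 1 / sqrt ?n))
      + 4 * (?k / ?n / sqrt ?n + sqrt ?n * (3 * inv_weights / ?n\<^sup>2)))"
    using r n by (intro mult_left_mono add_mono divide_right_mono ranked_emp_moment(2) emp_moment(2,4)) auto
  also have "\<dots> = 8 * ?k / sqrt ?n + 12 * inv_weights * (sqrt ?n / ?n)"
    using n by (simp add: s power2_eq_square algebra_simps)
  also have "sqrt ?n / ?n = 1 / sqrt ?n"
    using n by (simp add: sqrt_divide_self_eq inverse_eq_divide)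
  finally show "expectation (\<lambda>\<omega>. size * sqrt (wsq (center (ranked r \<omega>))) ^ 3)
      \<le> (8 * ?k + 12 * inv_weights) / sqrt size"
    by (simp add: add_divide_distrib)
qed

text \<open>Two replacements: \<open>?E1\<close> covers the passage from the divergence to its
  quadratic term at the rank, with cubic error, and \<open>?E2\<close> the passage from rank
  \<open>r\<close> and weight at \<open>r / size\<close> to the fixed threshold \<open>s\<close> and
  weight at \<open>t\<close>.\<close>

lemma stat_cell:
  assumes c: "0 < c" and r: "c \<le> r / size" "c \<le> 1 - r / size"
    and t: "c \<le> t" "c \<le> 1 - t" and s: "measure \<nu> {..s} = t"
    and d: "\<bar>r / size - t\<bar> + 1 / sqrt size \<le> d"
  shows "(\<integral>\<^sup>+\<omega>. ennreal \<bar>stat r \<omega> - iso_dev (sqrt size *\<^sub>R emp s \<omega>) / (t * (1 - t))\<bar> \<partial>M)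
    \<le> ennreal (32 * inv_weights * (8 * real CARD('k) + 12 * inv_weights) / (c\<^sup>2 * sqrt size) + cell_error (real CARD('k)) c d)"
proof -
  let ?k = "real CARD('k)" and ?n = "real size"
  let ?m = "real r / ?n"
  let ?U = "\<lambda>\<omega>. sqrt ?n *\<^sub>R ranked r \<omega>" and ?V = "\<lambda>\<omega>. sqrt ?n *\<^sub>R emp s \<omega>"
  have n: "0 < ?n" using size_pos by simp
  have m: "0 < ?m" "?m < 1" using c r by auto
  have r': "0 < r" "r < size"
    using m n by (cases "r = 0", auto)
  have scale: "wsq (center (sqrt ?n *\<^sub>R v)) = ?n * wsq (center v)" for v :: "(real, 'k) vec"
  proof -
    have "center (sqrt ?n *\<^sub>R v) = sqrt ?n *\<^sub>R center v"
      by (simp add: center_def wmean_scale vec_eq_iff right_diff_distrib)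
    then show ?thesis by (simp add: wsq_scale)
  qed
  have k: "?n * (?k / ?n * x) = ?k * x" for x using n by simp
  have mom: "expectation (\<lambda>\<omega>. wsq (center (?U \<omega>))) \<le> ?k" "expectation (\<lambda>\<omega>. wsq (center (?V \<omega>))) \<le> ?k"
    "expectation (\<lambda>\<omega>. wsq (center (?U \<omega> - ?V \<omega>))) \<le> ?k * d"
  proof -
    have "?n * expectation (\<lambda>\<omega>. wsq (center (ranked r \<omega>))) \<le> ?n * (?k / ?n * (2 * (?m * (1 - ?m))))"
      using r' by (intro mult_left_mono ranked_moment(2)) auto
    also have "\<dots> \<le> ?k * 1"
    proof (unfold k, intro mult_left_mono)
      have "0 \<le> (1 - 2 * ?m)\<^sup>2" by simp
      then have "4 * (?m * (1 - ?m)) \<le> 1" by (simp add: power2_eq_square algebra_simps)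
      then show "2 * (?m * (1 - ?m)) \<le> 1" by simp
    qed simp
    finally show "expectation (\<lambda>\<omega>. wsq (center (?U \<omega>))) \<le> ?k" by (simp add: scale)
    have "?n * expectation (\<lambda>\<omega>. wsq (center (emp s \<omega>))) \<le> ?n * (?k / ?n)"
      by (intro mult_left_mono emp_moment(2)) auto
    then show "expectation (\<lambda>\<omega>. wsq (center (?V \<omega>))) \<le> ?k" using n by (simp add: scale)
    have "?n * expectation (\<lambda>\<omega>. wsq (center (ranked r \<omega> - emp s \<omega>)))
        \<le> ?n * (?k / ?n * (\<bar>?m - measure \<nu> {..s}\<bar> + 1 / sqrt ?n))"
      using r' by (intro mult_left_mono ranked_emp_moment(2)) auto
    also have "\<dots> \<le> ?k * d"
      unfolding k s by (intro mult_left_mono d) auto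
    finally show "expectation (\<lambda>\<omega>. wsq (center (?U \<omega> - ?V \<omega>))) \<le> ?k * d"
      by (simp add: scale flip: scaleR_diff_right)
  qed
  have int: "integrable M (\<lambda>\<omega>. wsq (center (?U \<omega>)))" "integrable M (\<lambda>\<omega>. wsq (center (?V \<omega>)))"
    "integrable M (\<lambda>\<omega>. wsq (center (?U \<omega> - ?V \<omega>)))"
    using ranked_moment(1)[of r] emp_moment(1)[of s] ranked_emp_moment(1)[of r s] r'
    by (simp_all add: scale flip: scaleR_diff_right)
  have meas: "?U \<in> borel_measurable M" "?V \<in> borel_measurable M"
    using ranked_measurable emp_measurable by simp_all
  have d': "0 < d" "\<bar>?m - t\<bar> \<le> d"
  proof -
    have "0 < 1 / sqrt ?n" using n by simp
    then show "0 < d" "\<bar>?m - t\<bar> \<le> d" using d by linarith+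
  qed
  note diff = iso_dev_ratio_diff[OF prob_space_axioms meas int mom d' c r t]
  let ?E1 = "\<lambda>\<omega>. 32 * inv_weights / c\<^sup>2 * (?n * sqrt (wsq (center (ranked r \<omega>))) ^ 3)"
  let ?E2 = "\<lambda>\<omega>. \<bar>iso_dev (?U \<omega>) / (?m * (1 - ?m)) - iso_dev (?V \<omega>) / (t * (1 - t))\<bar>"
  have iE1: "integrable M ?E1" by (intro integrable_mult_right ranked_cubic r')
  have "(\<integral>\<^sup>+\<omega>. ennreal \<bar>stat r \<omega> - iso_dev (?V \<omega>) / (t * (1 - t))\<bar> \<partial>M) \<le> (\<integral>\<^sup>+\<omega>. ennreal (?E1 \<omega> + ?E2 \<omega>) \<partial>M)"
  proof (rule nn_integral_mono_AE)
    show "AE \<omega> in M. ennreal \<bar>stat r \<omega> - iso_dev (?V \<omega>) / (t * (1 - t))\<bar> \<le> ennreal (?E1 \<omega> + ?E2 \<omega>)"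
      using AE_ranked[OF less_imp_le[OF r'(2)]]
    proof eventually_elim
      case (elim \<omega>)
      then have wm: "wmean (rank_ecdf (\<lambda>p. \<xi> p \<omega>) r) = ?m" using r' by (simp add: ranked_def)
      let ?S = "\<Sum>j\<in>UNIV. w $ j * bern_kl (proj (ranked r \<omega>) $ j) ?m"
      have st: "stat r \<omega> = 2 * ?n * ?S" by (simp add: stat_def rank_stat_def ranked_def)
      have dv: "iso_dev (?U \<omega>) / (?m * (1 - ?m)) = 2 * ?n * (iso_dev (ranked r \<omega>) / (2 * (?m * (1 - ?m))))"
        using n by (simp add: iso_dev_scale)
      have "\<bar>stat r \<omega> - iso_dev (?U \<omega>) / (?m * (1 - ?m))\<bar>
          = 2 * ?n * \<bar>?S - iso_dev (ranked r \<omega>) / (2 * (?m * (1 - ?m)))\<bar>"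
        unfolding st dv right_diff_distrib[symmetric] using n by (simp add: abs_mult)
      also have "\<dots> \<le> 2 * ?n * (16 * inv_weights * sqrt (wsq (center (ranked r \<omega>))) ^ 3 / c\<^sup>2)"
        using sum_kl_bounds(3)[OF rank_ecdf_bounds wm m c r]
        by (intro mult_left_mono) (auto simp: ranked_def)
      also have "\<dots> = ?E1 \<omega>" by simp
      finally show ?case by (intro ennreal_leI) linarith
    qed
  qed
  also have "\<dots> = ennreal (expectation (\<lambda>\<omega>. ?E1 \<omega> + ?E2 \<omega>))"
    using iE1 diff(1) inv_weights_nonneg
    by (intro nn_integral_eq_integral Bochner_Integration.integrable_add AE_I2 add_nonneg_nonneg) (auto simp: wsq_nonneg)
  also have "expectation (\<lambda>\<omega>. ?E1 \<omega> + ?E2 \<omega>) = 32 * inv_weights / c\<^sup>2 *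
      expectation (\<lambda>\<omega>. ?n * sqrt (wsq (center (ranked r \<omega>))) ^ 3) + expectation ?E2"
    using iE1 diff(1) by (subst Bochner_Integration.integral_add) auto
  also have "ennreal \<dots> \<le> ennreal (32 * inv_weights / c\<^sup>2 * ((8 * ?k + 12 * inv_weights) / sqrt ?n)
      + cell_error ?k c d)"
    using inv_weights_nonneg by (intro ennreal_leI add_mono mult_left_mono ranked_cubic(2) r' diff(2)) auto
  finally show ?thesis by simp
qed

lemma step_stat_eq:
  assumes "0 < t" "t \<le> 1"
  shows "step_stat t \<omega> = stat (nat \<lceil>t * size\<rceil>) \<omega>"
proof -
  have n: "0 < real size" using size_pos by simp
  let ?r = "nat \<lceil>t * size\<rceil>"
  have pos: "0 < t * size" using assms n by simp
  have le: "t * size \<le> real size" using assms n by (simp add: mult_left_le_one_le)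
  have r: "real ?r - 1 < t * size" "t * size \<le> real ?r" using pos by linarith+
  have mem: "?r \<in> {1..size}" using r pos le by (auto simp: Suc_le_eq)
  have "indicator {(real q - 1) / size<..real q / size} t * stat q \<omega> = (if q = ?r then stat ?r \<omega> else 0)" for q
  proof -
    have "real q - 1 < t * size \<and> t * size \<le> real q \<longleftrightarrow> q = ?r"
    proof
      assume "real q - 1 < t * size \<and> t * size \<le> real q"
      then have "real q < real ?r + 1" "real ?r < real q + 1" using r by linarith+
      then show "q = ?r" by linarith
    qed (use r in blast)
    then have "t \<in> {(real q - 1) / size<..real q / size} \<longleftrightarrow> q = ?r"
      using n by (simp add: pos_divide_less_eq pos_le_divide_eq)
    then show ?thesis by (auto simp: indicator_def)
  qed
  then show ?thesis using mem by (simp add: step_stat_def)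
qed

lemma test_statistic_eq_integral:
  "AE \<omega> in M. test_statistic w N (\<lambda>j i. \<xi> (j, i) \<omega>) = (LINT t|lborel. step_stat t \<omega>)"
  using AE_inj
proof eventually_elim
  case (elim \<omega>)
  have n: "0 < real size" using size_pos by simp
  have le: "(real r - 1) / size \<le> real r / size" for r using n by (simp add: divide_right_mono)
  have "(LINT t|lborel. step_stat t \<omega>)
      = (\<Sum>r=1..size. LINT t|lborel. indicator {(real r - 1) / size<..real r / size} t * stat r \<omega>)"
    unfolding step_stat_def
    by (intro Bochner_Integration.integral_sum integrable_mult_left integrable_real_indicator)
      (use le in auto)
  also have "\<dots> = (\<Sum>r=1..size. stat r \<omega> / size)"
  proof (intro sum.cong refl)
    fix r
    have "measure lborel {(real r - 1) / size<..real r / size} = 1 / size"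
      using le[of r] by (simp add: diff_divide_distrib)
    then show "(LINT t|lborel. indicator {(real r - 1) / size<..real r / size} t * stat r \<omega>) = stat r \<omega> / size"
      by simp
  qed
  finally show ?case
    using test_statistic_ranks[OF elim] by (simp add: stat_def sum_divide_distrib)
qed

text \<open>Inner mesh points have distance at least \<open>a / K\<close> from 0 and 1. Half of this
  is given up as the margin, since by \<open>large\<close> rounding up to a rank moves a point by at
  most that half. The end strips cost \<open>2 * (4 * k) * a / K\<close> with the bound of
  \<open>stat_bound\<close>.\<close>

lemma test_statistic_approximation:
  assumes a: "0 < a" "2 * a \<le> K" and large: "1 / real size \<le> real a / (2 * real K)"
    and s: "\<And>l. l \<in> {a..<K - a} \<Longrightarrow> measure \<nu> {..s l} = real l / K"
  shows "(\<integral>\<^sup>+\<omega>. ennreal \<bar>test_statistic w N (\<lambda>j i. \<xi> (j, i) \<omega>)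
      - (\<Sum>l=a..<K - a. iso_dev (sqrt size *\<^sub>R emp (s l) \<omega>) / (real l / K * (1 - real l / K))) / K\<bar> \<partial>M)
    \<le> ennreal (8 * real CARD('k) * a / K
      + (32 * inv_weights * (8 * real CARD('k) + 12 * inv_weights) / ((real a / (2 * real K))\<^sup>2 * sqrt size)
        + cell_error (real CARD('k)) (real a / (2 * real K)) (1 / K + 2 / sqrt size)))"
proof -
  let ?k = "real CARD('k)" and ?n = "real size"
  define c where "c = real a / (2 * real K)"
  define e where "e = 32 * inv_weights * (8 * ?k + 12 * inv_weights) / (c\<^sup>2 * sqrt ?n) + cell_error ?k c (1 / K + 2 / sqrt ?n)"
  define Q where "Q l \<omega> = iso_dev (sqrt ?n *\<^sub>R emp (s l) \<omega>) / (real l / K * (1 - real l / K))" for l \<omega>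
  have n: "0 < ?n" "1 / ?n \<le> 1 / sqrt ?n"
  proof -
    show "0 < ?n" using size_pos by simp
    have "sqrt ?n \<le> ?n" using size_pos by (simp add: real_le_lsqrt sqrt_le_D self_le_power)
    then show "1 / ?n \<le> 1 / sqrt ?n" using size_pos by (intro divide_left_mono) auto
  qed
  have K: "0 < real K" using a by simp
  have c: "0 < c" "1 / ?n \<le> c" using a K large by (auto simp: c_def)
  have e: "0 \<le> e"
    unfolding e_def cell_error_def using inv_weights_nonneg c K n
    by (intro add_nonneg_nonneg divide_nonneg_nonneg mult_nonneg_nonneg) auto
  have "(\<integral>\<^sup>+\<omega>. ennreal \<bar>(LINT t|lborel. step_stat t \<omega>) - (\<Sum>l=a..<K - a. Q l \<omega>) / K\<bar> \<partial>M)
      \<le> ennreal (2 * (4 * ?k) * a / K + e)"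
  proof (rule riemann_sum_approximation(3)[OF _ _ _ a _ e])
    show "(\<lambda>(t, \<omega>). step_stat t \<omega>) \<in> borel_measurable (lborel \<Otimes>\<^sub>M M)"
      unfolding step_stat_def case_prod_unfold
    proof (intro borel_measurable_sum borel_measurable_times)
      fix r
      show "(\<lambda>z. stat r (snd z)) \<in> borel_measurable (lborel \<Otimes>\<^sub>M M)"
        using measurable_compose[OF measurable_snd stat_measurable] .
      show "(\<lambda>z. indicator {(real r - 1) / size<..real r / size} (fst z) :: real) \<in> borel_measurable (lborel \<Otimes>\<^sub>M M)"
        by measurable
    qed
    show "step_stat t \<omega> = 0" if t: "t \<notin> {0<..<1}" for t \<omega>
    proof (cases "t = 1")
      case True
      then show ?thesis using step_stat_eq[of 1 \<omega>] by (simp add: stat_def rank_stat_size)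
    next
      case False
      have "indicator {(real r - 1) / size<..real r / size} t * stat r \<omega> = 0" if "r \<in> {1..size}" for r
      proof -
        have "0 \<le> (real r - 1) / size" "real r / size \<le> 1" using that n(1) by auto
        then have "t \<notin> {(real r - 1) / size<..real r / size}" using t False by auto
        then show ?thesis by simp
      qed
      then show ?thesis unfolding step_stat_def by (intro sum.neutral) auto
    qed
    show "Q l \<in> borel_measurable M" for l
    proof -
      have "(\<lambda>\<omega>. sqrt ?n *\<^sub>R emp (s l) \<omega>) \<in> borel_measurable M" using emp_measurable by simp
      from measurable_compose[OF this measurable_iso_dev] show ?thesis by (simp add: Q_def[abs_def])
    qed
    show "0 \<le> 4 * ?k" by simp
    show "(\<integral>\<^sup>+\<omega>. ennreal \<bar>step_stat t \<omega>\<bar> \<partial>M) \<le> ennreal (4 * ?k)" if t: "t \<in> {0<..<1}" for t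
    proof -
      have "0 < t * ?n" "t * ?n \<le> ?n" using t n(1) by (auto simp: mult_left_le_one_le)
      then have "1 \<le> nat \<lceil>t * ?n\<rceil>" "nat \<lceil>t * ?n\<rceil> \<le> size" by (auto simp: Suc_le_eq)
      then show ?thesis using t by (simp add: step_stat_eq stat_bound)
    qed
    fix l t assume l: "l \<in> {a..<K - a}" and t: "t \<in> {0<..<1}" "real l / K < t" "t \<le> (real l + 1) / K"
    define r where "r = nat \<lceil>t * ?n\<rceil>"
    have pos: "0 < t * ?n" using t n by simp
    have rt: "t * ?n \<le> real r" "real r < t * ?n + 1" unfolding r_def using pos by linarith+
    have m: "t \<le> r / ?n" "r / ?n \<le> t + 1 / ?n"
      using rt n by (simp_all add: field_simps)
    have l': "real a \<le> real l" "real l + 1 \<le> real K - real a" using l by auto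
    have "real a / K \<le> real l / K" "(real l + 1) / K \<le> (real K - real a) / K"
      using l' K by (auto intro: divide_right_mono)
    moreover have "(real K - real a) / K = 1 - real a / K" using K by (simp add: diff_divide_distrib)
    moreover have "real a / K = 2 * c" using K by (simp add: c_def)
    moreover have "(real l + 1) / K = real l / K + 1 / K" by (simp add: add_divide_distrib)
    moreover have "0 \<le> 1 / real K" by simp
    ultimately have tl: "2 * c \<le> real l / K" "real l / K \<le> 1 - 2 * c" "t \<le> 1 - 2 * c" "t \<le> real l / K + 1 / K"
      using t by linarith+
    have "(\<integral>\<^sup>+\<omega>. ennreal \<bar>stat r \<omega> - Q l \<omega>\<bar> \<partial>M) \<le> ennreal e"
      unfolding Q_def e_def
    proof (rule stat_cell[OF c(1) _ _ _ _ s[OF l]])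
      show "c \<le> r / size" "c \<le> 1 - r / size" "c \<le> real l / K" "c \<le> 1 - real l / K"
        using tl m c t by linarith+
      \<comment> \<open>Here \<open>1 / K\<close> is the width of the cell and \<open>1 / ?n\<close>
        the rounding to a rank. The latter is enlarged to \<open>1 / sqrt ?n\<close> and joins the
        equal term from \<open>ranked_emp_moment\<close>.\<close>
      have "\<bar>r / ?n - real l / K\<bar> \<le> 1 / K + 1 / ?n" using m t tl by linarith
      then have "\<bar>r / ?n - real l / K\<bar> + 1 / sqrt ?n \<le> 1 / K + (1 / sqrt ?n + 1 / sqrt ?n)" using n(2) by linarith
      then show "\<bar>r / size - real l / K\<bar> + 1 / sqrt size \<le> 1 / K + 2 / sqrt ?n" by simp
    qed
    then show "(\<integral>\<^sup>+\<omega>. ennreal \<bar>step_stat t \<omega> - Q l \<omega>\<bar> \<partial>M) \<le> ennreal e"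
      using t by (simp add: step_stat_eq r_def)
  qed
  moreover have "(\<integral>\<^sup>+\<omega>. ennreal \<bar>test_statistic w N (\<lambda>j i. \<xi> (j, i) \<omega>) - (\<Sum>l=a..<K - a. Q l \<omega>) / K\<bar> \<partial>M)
      = (\<integral>\<^sup>+\<omega>. ennreal \<bar>(LINT t|lborel. step_stat t \<omega>) - (\<Sum>l=a..<K - a. Q l \<omega>) / K\<bar> \<partial>M)"
    using test_statistic_eq_integral by (intro nn_integral_cong_AE) (auto elim!: eventually_mono)
  ultimately show ?thesis by (simp add: Q_def e_def c_def)
qed

end

section \<open>The central limit theorem for the empirical distribution functions\<close>

lemma exp_minus_linear: "0 \<le> x \<Longrightarrow> \<bar>exp (- x) - (1 - x)\<bar> \<le> x\<^sup>2 / 2" for x :: real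
proof -
  assume x: "0 \<le> x"
  have "(\<lambda>x. 1 - x + x\<^sup>2 / 2 - exp (- x)) 0 \<le> 1 - x + x\<^sup>2 / 2 - exp (- x)"
  proof (rule DERIV_nonneg_imp_nondecreasing[OF x])
    fix y :: real assume "0 \<le> y"
    have "((\<lambda>x. 1 - x + x\<^sup>2 / 2 - exp (- x)) has_real_derivative (y - 1 + exp (- y))) (at y)"
      by (auto intro!: derivative_eq_intros)
    moreover have "0 \<le> y - 1 + exp (- y)" using exp_ge_add_one_self[of "- y"] by simp
    ultimately show "\<exists>d. ((\<lambda>x. 1 - x + x\<^sup>2 / 2 - exp (- x)) has_real_derivative d) (at y) \<and> 0 \<le> d"
      by blast
  qed
  then show ?thesis using exp_ge_add_one_self[of "- x"] by simp
qed

context sample_model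
begin

lemma indicator_covariance:
  assumes p: "p \<in> pool"
  shows "expectation (\<lambda>\<omega>. (of_bool (\<xi> p \<omega> \<le> s) - measure \<nu> {..s}) * (of_bool (\<xi> p \<omega> \<le> s') - measure \<nu> {..s'}))
    = min (measure \<nu> {..s}) (measure \<nu> {..s'}) - measure \<nu> {..s} * measure \<nu> {..s'}"
proof -
  interpret \<nu>: real_distribution \<nu> by (rule real_distribution_law)
  define F where "F u \<omega> = (of_bool (\<xi> p \<omega> \<le> u) :: real)" for u \<omega>
  have int: "integrable M (F u)" for u
    unfolding F_def[abs_def] using measurable_le[OF p] by (intro integrable_const_bound[of _ 1]) auto
  have ex: "expectation (F u) = measure \<nu> {..u}" for u
    using indicator_centered(3)[OF p, of u] int[of u] by (simp add: prob_space F_def[abs_def])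
  have prod: "F s \<omega> * F s' \<omega> = F (min s s') \<omega>" for \<omega>
    by (auto simp: F_def of_bool_def)
  have "expectation (\<lambda>\<omega>. (F s \<omega> - measure \<nu> {..s}) * (F s' \<omega> - measure \<nu> {..s'}))
      = expectation (\<lambda>\<omega>. F (min s s') \<omega> - measure \<nu> {..s'} * F s \<omega>
          - measure \<nu> {..s} * F s' \<omega> + measure \<nu> {..s} * measure \<nu> {..s'})"
    by (intro Bochner_Integration.integral_cong refl) (simp add: prod[symmetric] algebra_simps)
  also have "\<dots> = measure \<nu> {..min s s'} - measure \<nu> {..s} * measure \<nu> {..s'}"
    using int by (simp add: ex prob_space)
  also have "measure \<nu> {..min s s'} = min (measure \<nu> {..s}) (measure \<nu> {..s'})"
  proof (cases "s \<le> s'")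
    case True
    then have "measure \<nu> {..s} \<le> measure \<nu> {..s'}" by (intro \<nu>.finite_measure_mono) auto
    with True show ?thesis by simp
  next
    case False
    then have "measure \<nu> {..s'} \<le> measure \<nu> {..s}" by (intro \<nu>.finite_measure_mono) auto
    with False show ?thesis by simp
  qed
  finally show ?thesis by (simp add: F_def)
qed

text \<open>Central limit theorem with an explicit error. The characteristic function of the sum is
  a product over the observations, each factor is compared with a Gaussian one, and the errors add
  up because all factors have modulus at most 1. Explicit constants allow the underlying probability
  space to change with the sample size.\<close>

lemma emp_linear_char:
  fixes c :: "'k \<Rightarrow> nat \<Rightarrow> real"
  assumes L: "finite L" and s: "\<And>l. l \<in> L \<Longrightarrow> measure \<nu> {..s l} = t l"
  defines "G \<equiv> (\<Sum>j\<in>UNIV. \<Sum>l\<in>L. \<bar>c j l\<bar>) * inv_weights"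
  defines "v \<equiv> \<Sum>j\<in>UNIV. \<Sum>l\<in>L. \<Sum>l'\<in>L. c j l * c j l' / w $ j * (min (t l) (t l') - t l * t l')"
  shows "cmod (char (distr M borel (\<lambda>\<omega>. \<Sum>j\<in>UNIV. \<Sum>l\<in>L. c j l * (sqrt size * (emp (s l) \<omega> $ j - t l)))) 1
      - complex_of_real (exp (- v / 2))) \<le> G ^ 3 / (6 * sqrt size) + G ^ 4 / (8 * size)"
proof -
  let ?n = "real size"
  have n: "0 < ?n" using size_pos by simp
  \<comment> \<open>Contribution of one observation of sample \<open>j\<close>, up to the factor
    \<open>1 / sqrt ?n\<close>; the division by \<open>w $ j\<close> arises from
    \<open>sqrt ?n / N j = 1 / (w $ j * sqrt ?n)\<close>. The constant \<open>G\<close> bounds all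
    these contributions.\<close>
  define g where "g j x = (\<Sum>l\<in>L. c j l / w $ j * (of_bool (x \<le> s l) - t l))" for j x
  define \<eta> where "\<eta> p \<omega> = g (fst p) (\<xi> p \<omega>) / sqrt ?n" for p \<omega>
  define u where "u j = (\<Sum>l\<in>L. \<Sum>l'\<in>L. c j l / w $ j * (c j l' / w $ j) * (min (t l) (t l') - t l * t l'))" for j
  have gm [measurable]: "g j \<in> borel_measurable borel" for j
    unfolding g_def by measurable
  have \<eta>m: "\<eta> p \<in> borel_measurable M" if "p \<in> pool" for p
    unfolding \<eta>_def[abs_def] using measurable_compose[OF rv[OF that] gm] by simp
  have cent: "\<bar>of_bool (\<xi> p \<omega> \<le> s l) - t l\<bar> \<le> 1" if "p \<in> pool" "l \<in> L" for p \<omega> l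
    using indicator_centered(2)[OF that(1), of \<omega> "s l"] s[OF that(2)] by simp
  have intc: "integrable M (\<lambda>\<omega>. of_bool (\<xi> p \<omega> \<le> s l) - t l)" if "p \<in> pool" "l \<in> L" for p l
    using indicator_centered(1)[OF that(1), of "s l"] s[OF that(2)] cent[OF that]
    by (intro integrable_const_bound[of _ 1]) auto
  have intcc: "integrable M (\<lambda>\<omega>. (of_bool (\<xi> p \<omega> \<le> s l) - t l) * (of_bool (\<xi> p \<omega> \<le> s l') - t l'))"
    if "p \<in> pool" "l \<in> L" "l' \<in> L" for p l l'
  proof (rule integrable_const_bound[of _ 1])
    show "AE \<omega> in M. norm ((of_bool (\<xi> p \<omega> \<le> s l) - t l) * (of_bool (\<xi> p \<omega> \<le> s l') - t l')) \<le> 1"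
      using cent[OF that(1,2)] cent[OF that(1,3)] unfolding real_norm_def abs_mult
      by (intro AE_I2 mult_le_one) auto
    show "(\<lambda>\<omega>. (of_bool (\<xi> p \<omega> \<le> s l) - t l) * (of_bool (\<xi> p \<omega> \<le> s l') - t l')) \<in> borel_measurable M"
      using borel_measurable_integrable[OF intc[OF that(1,2)]] borel_measurable_integrable[OF intc[OF that(1,3)]]
      by (rule borel_measurable_times)
  qed
  have G0: "0 \<le> G" unfolding G_def using inv_weights_nonneg by (intro mult_nonneg_nonneg sum_nonneg) auto
  have gb: "\<bar>g (fst p) (\<xi> p \<omega>)\<bar> \<le> G" if p: "p \<in> pool" for p \<omega>
  proof -
    have "\<bar>g (fst p) (\<xi> p \<omega>)\<bar> \<le> (\<Sum>l\<in>L. \<bar>c (fst p) l / w $ fst p * (of_bool (\<xi> p \<omega> \<le> s l) - t l)\<bar>)"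
      unfolding g_def by (rule sum_abs)
    also have "\<dots> \<le> (\<Sum>l\<in>L. \<bar>c (fst p) l\<bar> * inv_weights)"
    proof (rule sum_mono)
      fix l assume l: "l \<in> L"
      have "\<bar>c (fst p) l / w $ fst p * (of_bool (\<xi> p \<omega> \<le> s l) - t l)\<bar>
          = \<bar>c (fst p) l\<bar> * (1 / w $ fst p * \<bar>of_bool (\<xi> p \<omega> \<le> s l) - t l\<bar>)"
        using weight_nonneg[of "fst p"] by (simp add: abs_mult)
      also have "\<dots> \<le> \<bar>c (fst p) l\<bar> * (inv_weights * 1)"
        using cent[OF p l] inv_weights_ge[of "fst p"] inv_weights_nonneg weight_nonneg[of "fst p"]
        by (intro mult_left_mono mult_mono) auto
      finally show "\<bar>c (fst p) l / w $ fst p * (of_bool (\<xi> p \<omega> \<le> s l) - t l)\<bar> \<le> \<bar>c (fst p) l\<bar> * inv_weights"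
        by simp
    qed
    also have "\<dots> = (\<Sum>l\<in>L. \<bar>c (fst p) l\<bar>) * inv_weights" by (simp add: sum_distrib_right)
    also have "\<dots> \<le> G"
      unfolding G_def using inv_weights_nonneg
      by (intro mult_right_mono member_le_sum[of "fst p" UNIV "\<lambda>j. \<Sum>l\<in>L. \<bar>c j l\<bar>"]) (auto intro: sum_nonneg)
    finally show ?thesis .
  qed
  have \<eta>b: "\<bar>\<eta> p \<omega>\<bar> \<le> G / sqrt ?n" if "p \<in> pool" for p \<omega>
    using gb[OF that, of \<omega>] n by (simp add: \<eta>_def divide_right_mono)
  have eg: "expectation (\<lambda>\<omega>. g (fst p) (\<xi> p \<omega>)) = 0" if p: "p \<in> pool" for p
  proof -
    have "expectation (\<lambda>\<omega>. g (fst p) (\<xi> p \<omega>))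
        = (\<Sum>l\<in>L. c (fst p) l / w $ fst p * expectation (\<lambda>\<omega>. of_bool (\<xi> p \<omega> \<le> s l) - t l))"
      unfolding g_def by (subst Bochner_Integration.integral_sum) (auto intro!: integrable_mult_right intc p)
    also have "\<dots> = 0"
    proof (intro sum.neutral ballI)
      fix l assume "l \<in> L"
      then show "c (fst p) l / w $ fst p * expectation (\<lambda>\<omega>. of_bool (\<xi> p \<omega> \<le> s l) - t l) = 0"
        using indicator_centered(3)[OF p, of "s l"] s[of l] by simp
    qed
    finally show ?thesis .
  qed
  have eg2: "expectation (\<lambda>\<omega>. (g (fst p) (\<xi> p \<omega>))\<^sup>2) = u (fst p)" if p: "p \<in> pool" for p
  proof -
    let ?d = "\<lambda>l. c (fst p) l / w $ fst p" and ?x = "\<lambda>l \<omega>. of_bool (\<xi> p \<omega> \<le> s l) - t l :: real"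
    have "expectation (\<lambda>\<omega>. (g (fst p) (\<xi> p \<omega>))\<^sup>2)
        = expectation (\<lambda>\<omega>. \<Sum>l\<in>L. \<Sum>l'\<in>L. ?d l * ?d l' * (?x l \<omega> * ?x l' \<omega>))"
      unfolding g_def power2_eq_square sum_product by (simp add: mult_ac)
    also have "\<dots> = (\<Sum>l\<in>L. expectation (\<lambda>\<omega>. \<Sum>l'\<in>L. ?d l * ?d l' * (?x l \<omega> * ?x l' \<omega>)))"
      by (intro Bochner_Integration.integral_sum Bochner_Integration.integrable_sum
          integrable_mult_right intcc p)
    also have "\<dots> = (\<Sum>l\<in>L. \<Sum>l'\<in>L. expectation (\<lambda>\<omega>. ?d l * ?d l' * (?x l \<omega> * ?x l' \<omega>)))"
      by (intro sum.cong refl Bochner_Integration.integral_sum integrable_mult_right intcc p)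
    also have "\<dots> = (\<Sum>l\<in>L. \<Sum>l'\<in>L. ?d l * ?d l' * expectation (\<lambda>\<omega>. ?x l \<omega> * ?x l' \<omega>))"
      by (simp only: integral_mult_right_zero)
    also have "\<dots> = u (fst p)"
      unfolding u_def
    proof (intro sum.cong refl arg_cong2[where f="(*)"])
      fix l l' assume "l \<in> L" "l' \<in> L"
      then show "expectation (\<lambda>\<omega>. ?x l \<omega> * ?x l' \<omega>) = min (t l) (t l') - t l * t l'"
        using indicator_covariance[OF p, of "s l" "s l'"] s[of l] s[of l'] by simp
    qed
    finally show ?thesis .
  qed
  have \<eta>int: "integrable M (\<eta> p)" "integrable M (\<lambda>\<omega>. (\<eta> p \<omega>)\<^sup>2)" if p: "p \<in> pool" for p
  proof -
    show "integrable M (\<eta> p)"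
      using \<eta>b[OF p] by (intro integrable_const_bound[of _ "G / sqrt ?n"] \<eta>m p) auto
    have "(\<eta> p \<omega>)\<^sup>2 \<le> (G / sqrt ?n)\<^sup>2" for \<omega>
      using \<eta>b[OF p, of \<omega>] G0 n by (subst abs_le_square_iff[symmetric]) auto
    then show "integrable M (\<lambda>\<omega>. (\<eta> p \<omega>)\<^sup>2)"
      using \<eta>m[OF p] by (intro integrable_const_bound[of _ "(G / sqrt ?n)\<^sup>2"]) auto
  qed
  have mean: "expectation (\<eta> p) = 0" if "p \<in> pool" for p
    using eg[OF that] by (simp add: \<eta>_def[abs_def])
  have var: "variance (\<eta> p) = u (fst p) / ?n" if "p \<in> pool" for p
    using eg2[OF that] n by (simp add: mean[OF that]) (simp add: \<eta>_def power_divide)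
  have u0: "0 \<le> u j" and uG: "u j \<le> G\<^sup>2" for j
  proof -
    have p: "(j, 0) \<in> pool" using N_pos[of j] by (simp add: pool_def)
    show "0 \<le> u j" using eg2[OF p] by (metis fst_conv Bochner_Integration.integral_nonneg zero_le_power2)
    have "expectation (\<lambda>\<omega>. (g j (\<xi> (j, 0) \<omega>))\<^sup>2) \<le> expectation (\<lambda>_. G\<^sup>2)"
    proof (rule integral_mono')
      show "(g j (\<xi> (j, 0) \<omega>))\<^sup>2 \<le> G\<^sup>2" for \<omega>
        using gb[OF p, of \<omega>] G0 by (subst abs_le_square_iff[symmetric]) auto
    qed auto
    then show "u j \<le> G\<^sup>2" using eg2[OF p] by (simp add: prob_space)
  qed
  have approx: "cmod (char (distr M borel (\<eta> p)) 1 - complex_of_real (exp (- (u (fst p) / ?n) / 2)))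
      \<le> G ^ 3 / (6 * sqrt ?n ^ 3) + G ^ 4 / (8 * ?n\<^sup>2)" if p: "p \<in> pool" for p
  proof -
    let ?x = "u (fst p) / ?n / 2"
    have x: "0 \<le> ?x" using u0 n by simp
    have "cmod (char (distr M borel (\<eta> p)) 1 - (1 - 1\<^sup>2 * (u (fst p) / ?n) / 2))
        \<le> 1\<^sup>2 / 6 * expectation (\<lambda>\<omega>. min (6 * (\<eta> p \<omega>)\<^sup>2) (\<bar>1\<bar> * \<bar>\<eta> p \<omega>\<bar> ^ 3))"
      by (rule char_approx3'[OF \<eta>m[OF p] \<eta>int(1)[OF p] \<eta>int(2)[OF p] mean[OF p] var[OF p] refl])
    also have "\<dots> \<le> 1\<^sup>2 / 6 * expectation (\<lambda>_. (G / sqrt ?n) ^ 3)"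
    proof (intro mult_left_mono integral_mono')
      show "min (6 * (\<eta> p \<omega>)\<^sup>2) (\<bar>1\<bar> * \<bar>\<eta> p \<omega>\<bar> ^ 3) \<le> (G / sqrt ?n) ^ 3" for \<omega>
        using power_mono[OF \<eta>b[OF p, of \<omega>], of 3] by simp
    qed (use G0 n in auto)
    also have "\<dots> = G ^ 3 / (6 * sqrt ?n ^ 3)" by (simp add: power_divide prob_space)
    finally have 1: "cmod (char (distr M borel (\<eta> p)) 1 - complex_of_real (1 - ?x)) \<le> G ^ 3 / (6 * sqrt ?n ^ 3)"
      by simp
    have "\<bar>exp (- ?x) - (1 - ?x)\<bar> \<le> ?x\<^sup>2 / 2" by (rule exp_minus_linear[OF x])
    also have "\<dots> = (u (fst p))\<^sup>2 / (8 * ?n\<^sup>2)" by (simp add: power_divide)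
    also have "\<dots> \<le> (G\<^sup>2)\<^sup>2 / (8 * ?n\<^sup>2)" by (intro divide_right_mono power_mono uG u0) auto
    finally have 2: "\<bar>(1 - ?x) - exp (- ?x)\<bar> \<le> G ^ 4 / (8 * ?n\<^sup>2)"
      by (simp add: abs_minus_commute)
    have "dist (char (distr M borel (\<eta> p)) 1) (complex_of_real (exp (- ?x)))
        \<le> dist (char (distr M borel (\<eta> p)) 1) (complex_of_real (1 - ?x))
          + dist (complex_of_real (1 - ?x)) (complex_of_real (exp (- ?x)))"
      by (rule dist_triangle)
    also have "dist (complex_of_real (1 - ?x)) (complex_of_real (exp (- ?x))) = \<bar>(1 - ?x) - exp (- ?x)\<bar>"
      unfolding dist_norm of_real_diff[symmetric] norm_of_real ..
    finally have "cmod (char (distr M borel (\<eta> p)) 1 - complex_of_real (exp (- ?x)))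
        \<le> G ^ 3 / (6 * sqrt ?n ^ 3) + G ^ 4 / (8 * ?n\<^sup>2)"
      using 1 2 unfolding dist_norm by linarith
    moreover have "- ?x = - (u (fst p) / ?n) / 2" by simp
    ultimately show ?thesis by (simp only:)
  qed
  have V: "(\<Sum>j\<in>UNIV. \<Sum>l\<in>L. c j l * (sqrt ?n * (emp (s l) \<omega> $ j - t l))) = (\<Sum>p\<in>pool. \<eta> p \<omega>)" for \<omega>
    unfolding sum_pool
  proof (rule sum.cong[OF refl])
    fix j
    have Nj: "0 < real (N j)" using N_pos[of j] by simp
    have sq: "sqrt ?n / N j = 1 / (w $ j * sqrt ?n)"
      using n weight_pos[of j] unfolding N_eq by (simp add: field_simps)
    have "c j l * (sqrt ?n * (emp (s l) \<omega> $ j - t l))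
        = (\<Sum>i<N j. c j l / w $ j * (of_bool (\<xi> (j, i) \<omega> \<le> s l) - t l) / sqrt ?n)" for l
    proof -
      have "emp (s l) \<omega> $ j - t l = (\<Sum>i<N j. of_bool (\<xi> (j, i) \<omega> \<le> s l) - t l) / N j"
        using Nj by (simp add: emp_def sum_subtractf diff_divide_distrib)
      then have "c j l * (sqrt ?n * (emp (s l) \<omega> $ j - t l))
          = c j l * (sqrt ?n / N j) * (\<Sum>i<N j. of_bool (\<xi> (j, i) \<omega> \<le> s l) - t l)" by simp
      also have "\<dots> = c j l / w $ j / sqrt ?n * (\<Sum>i<N j. of_bool (\<xi> (j, i) \<omega> \<le> s l) - t l)"
        by (simp add: sq)
      finally show ?thesis by (simp only: sum_distrib_left) (simp add: mult_ac)
    qed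
    then have "(\<Sum>l\<in>L. c j l * (sqrt ?n * (emp (s l) \<omega> $ j - t l)))
        = (\<Sum>i<N j. \<Sum>l\<in>L. c j l / w $ j * (of_bool (\<xi> (j, i) \<omega> \<le> s l) - t l) / sqrt ?n)"
      by (simp only: sum.swap[of _ L])
    then show "(\<Sum>l\<in>L. c j l * (sqrt ?n * (emp (s l) \<omega> $ j - t l))) = (\<Sum>i<N j. \<eta> (j, i) \<omega>)"
      by (simp add: \<eta>_def g_def sum_divide_distrib)
  qed
  have ind: "indep_vars (\<lambda>_. borel) \<eta> pool"
  proof -
    have "(\<lambda>x. g j x / sqrt ?n) \<in> borel_measurable borel" for j using gm[of j] by simp
    from indep_vars_compose2[OF indep, of "\<lambda>p x. g (fst p) x / sqrt ?n" "\<lambda>_. borel", OF this]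
    show ?thesis by (simp add: \<eta>_def[abs_def])
  qed
  have "char (distr M borel (\<lambda>\<omega>. \<Sum>p\<in>pool. \<eta> p \<omega>)) 1 = (\<Prod>p\<in>pool. char (distr M borel (\<eta> p)) 1)"
    by (rule char_distr_sum[OF ind])
  moreover have "complex_of_real (exp (- v / 2)) = (\<Prod>p\<in>pool. complex_of_real (exp (- (u (fst p) / ?n) / 2)))"
  proof -
    have "(\<Sum>p\<in>pool. u (fst p) / ?n) = (\<Sum>j\<in>UNIV. w $ j * u j)"
      unfolding sum_pool using n by (simp add: N_eq)
    also have "\<dots> = v"
      unfolding v_def u_def sum_distrib_left
      by (intro sum.cong refl) (use weight_pos in \<open>simp add: less_imp_neq[symmetric]\<close>)
    finally have "- v / 2 = (\<Sum>p\<in>pool. - (u (fst p) / ?n) / 2)"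
      by (simp add: sum_negf flip: sum_divide_distrib)
    then show ?thesis by (simp only: exp_sum[OF finite_pool] of_real_prod)
  qed
  moreover have "cmod ((\<Prod>p\<in>pool. char (distr M borel (\<eta> p)) 1) - (\<Prod>p\<in>pool. complex_of_real (exp (- (u (fst p) / ?n) / 2))))
      \<le> (\<Sum>p\<in>pool. cmod (char (distr M borel (\<eta> p)) 1 - complex_of_real (exp (- (u (fst p) / ?n) / 2))))"
  proof (rule norm_prod_diff)
    fix p assume "p \<in> pool"
    then interpret D: real_distribution "distr M borel (\<eta> p)" by (intro real_distribution_distr \<eta>m)
    show "cmod (char (distr M borel (\<eta> p)) 1) \<le> 1" by (rule D.cmod_char_le_1)
    show "cmod (complex_of_real (exp (- (u (fst p) / ?n) / 2))) \<le> 1" using u0 n by simp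
  qed
  moreover have "(\<Sum>p\<in>pool. cmod (char (distr M borel (\<eta> p)) 1 - complex_of_real (exp (- (u (fst p) / ?n) / 2))))
      \<le> (\<Sum>p\<in>pool. G ^ 3 / (6 * sqrt ?n ^ 3) + G ^ 4 / (8 * ?n\<^sup>2))"
    by (intro sum_mono approx)
  moreover have "(\<Sum>p\<in>pool. G ^ 3 / (6 * sqrt ?n ^ 3) + G ^ 4 / (8 * ?n\<^sup>2)) = G ^ 3 / (6 * sqrt size) + G ^ 4 / (8 * size)"
  proof -
    have "sqrt ?n ^ 3 = ?n * sqrt ?n" using n by (simp add: power3_eq_cube)
    then show ?thesis using n by (simp add: card_pool distrib_left power2_eq_square)
  qed
  ultimately show ?thesis by (simp add: V)
qed

end

section \<open>The limit variable\<close>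

text \<open>A point mass with mean zero sits at 0 and has \<open>v = 0\<close>, so the Gaussian
  formula covers the degenerate case as well.\<close>

lemma (in prob_space) char_gaussian_rv:
  assumes g: "gaussian_rv M Y" and i: "integrable M (\<lambda>\<omega>. (Y \<omega>)\<^sup>2)"
    and m: "expectation Y = 0" and v: "expectation (\<lambda>\<omega>. (Y \<omega>)\<^sup>2) = v"
  shows "char (distr M borel Y) 1 = complex_of_real (exp (- v / 2))"
proof -
  have Y [measurable]: "Y \<in> borel_measurable M" using g by (simp add: gaussian_rv_def)
  from g obtain \<mu> where "(AE \<omega> in M. Y \<omega> = \<mu>) \<or> (\<exists>\<sigma>>0. distributed M lborel Y (normal_density \<mu> \<sigma>))"
    by (auto simp: gaussian_rv_def)
  then show ?thesis
  proof (elim disjE exE conjE)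
    assume ae: "AE \<omega> in M. Y \<omega> = \<mu>"
    have "expectation Y = expectation (\<lambda>_. \<mu>)" by (rule integral_cong_AE) (use ae in auto)
    then have "\<mu> = 0" using m by (simp add: prob_space)
    with ae have ae: "AE \<omega> in M. Y \<omega> = 0" by simp
    have "expectation (\<lambda>\<omega>. (Y \<omega>)\<^sup>2) = expectation (\<lambda>_. 0)" by (rule integral_cong_AE) (use ae in auto)
    then have "v = 0" using v by simp
    have "distr M borel Y = distr M borel (\<lambda>_. 0)"
      by (rule distr_cong_AE) (use ae in simp_all)
    then have "char (distr M borel Y) 1 = (CLINT \<omega>|M. iexp (1 * 0))"
      unfolding char_def by (simp only:) (subst integral_distr, auto)
    then show ?thesis using \<open>v = 0\<close> by (simp add: prob_space)
  next
    fix \<sigma> :: real assume \<sigma>: "0 < \<sigma>" and d: "distributed M lborel Y (normal_density \<mu> \<sigma>)"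
    have \<mu>: "\<mu> = 0" using normal_distributed_expectation[OF \<sigma> d] m by simp
    have v\<sigma>: "v = \<sigma>\<^sup>2" using normal_distributed_variance[OF \<sigma> d] m v by simp
    have "distributed M lborel (\<lambda>\<omega>. (Y \<omega> - \<mu>) / \<sigma>) std_normal_density"
      using d normal_standard_normal_convert[OF \<sigma>, of Y \<mu>] by blast
    then have "distributed M lborel (\<lambda>\<omega>. Y \<omega> / \<sigma>) std_normal_density"
      by (simp only: \<mu> diff_zero)
    then have "distr M lborel (\<lambda>\<omega>. Y \<omega> / \<sigma>) = std_normal_distribution"
      by (rule distributed_distr_eq_density)
    moreover have "distr M borel (\<lambda>\<omega>. Y \<omega> / \<sigma>) = distr M lborel (\<lambda>\<omega>. Y \<omega> / \<sigma>)"
      by (rule distr_cong) auto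
    ultimately have std: "distr M borel (\<lambda>\<omega>. Y \<omega> / \<sigma>) = std_normal_distribution" by simp
    have "char (distr M borel Y) 1 = (CLINT \<omega>|M. iexp (\<sigma> * (Y \<omega> / \<sigma>)))"
      unfolding char_def using \<sigma> by (subst integral_distr) auto
    also have "\<dots> = char (distr M borel (\<lambda>\<omega>. Y \<omega> / \<sigma>)) \<sigma>"
      unfolding char_def by (subst integral_distr) auto
    finally show ?thesis by (simp add: std char_std_normal_distribution v\<sigma>)
  qed
qed

locale bridges = weights w + prob_space P
  for w :: "real ^ 'k::{finite,linorder}" and P :: "'b measure" +
  fixes B :: "'k \<Rightarrow> real \<Rightarrow> 'b \<Rightarrow> real"
  assumes bridge: "\<And>j. brownian_bridge P (B j)"
    and bridges_indep: "indep_processes P {0..1} B"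
begin

section \<open>Moments and linear combinations of the bridges\<close>

lemma B_gaussian: "finite S \<Longrightarrow> S \<subseteq> {0..1} \<Longrightarrow> gaussian_rv P (\<lambda>\<omega>. \<Sum>t\<in>S. c t * B j t \<omega>)"
  using bridge[of j] by (simp add: brownian_bridge_def gaussian_process_def)

lemma B_measurable: "t \<in> {0..1} \<Longrightarrow> B j t \<in> borel_measurable P"
  using B_gaussian[of "{t}" "\<lambda>_. 1" j] by (simp add: gaussian_rv_def)

lemma B_mean: "t \<in> {0..1} \<Longrightarrow> expectation (B j t) = 0"
  using bridge[of j] by (simp add: brownian_bridge_def)

lemma B_cov: "s \<in> {0..1} \<Longrightarrow> t \<in> {0..1} \<Longrightarrow> expectation (\<lambda>\<omega>. B j s \<omega> * B j t \<omega>) = min s t - s * t"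
  using bridge[of j] by (simp add: brownian_bridge_def)

text \<open>Square integrability follows from the covariance: the Bochner integral of a
  nonintegrable function is 0, whereas the variance \<open>t * (1 - t)\<close> is positive inside
  the unit interval.\<close>

lemma B_square_integrable:
  assumes t: "t \<in> {0<..<1}" shows "integrable P (\<lambda>\<omega>. (B j t \<omega>)\<^sup>2)"
proof (rule ccontr)
  assume "\<not> integrable P (\<lambda>\<omega>. (B j t \<omega>)\<^sup>2)"
  then have "expectation (\<lambda>\<omega>. (B j t \<omega>)\<^sup>2) = 0" by (rule not_integrable_integral_eq)
  then have "t - t * t = 0" using B_cov[of t t j] t by (simp add: power2_eq_square)
  then have "t * (1 - t) = 0" by (simp add: algebra_simps)
  then show False using t by simp
qed

lemma B_integrable: "t \<in> {0<..<1} \<Longrightarrow> integrable P (B j t)"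
  by (rule square_integrable_imp_integrable[OF B_measurable B_square_integrable]) auto

lemma B_product_integrable:
  assumes "s \<in> {0<..<1}" "t \<in> {0<..<1}" shows "integrable P (\<lambda>\<omega>. B j s \<omega> * B i t \<omega>)"
proof (rule Bochner_Integration.integrable_bound)
  show "integrable P (\<lambda>\<omega>. (B j s \<omega>)\<^sup>2 + (B i t \<omega>)\<^sup>2)"
    using assms by (intro Bochner_Integration.integrable_add B_square_integrable)
  show "(\<lambda>\<omega>. B j s \<omega> * B i t \<omega>) \<in> borel_measurable P"
    using assms by (intro borel_measurable_times B_measurable) auto
  show "AE \<omega> in P. norm (B j s \<omega> * B i t \<omega>) \<le> norm ((B j s \<omega>)\<^sup>2 + (B i t \<omega>)\<^sup>2)"
  proof (rule AE_I2)
    fix \<omega>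
    have "\<bar>B j s \<omega>\<bar> * \<bar>B i t \<omega>\<bar> \<le> 2 * \<bar>B j s \<omega>\<bar> * \<bar>B i t \<omega>\<bar>" by simp
    also have "\<dots> \<le> \<bar>B j s \<omega>\<bar>\<^sup>2 + \<bar>B i t \<omega>\<bar>\<^sup>2" by (rule sum_squares_bound)
    finally show "norm (B j s \<omega> * B i t \<omega>) \<le> norm ((B j s \<omega>)\<^sup>2 + (B i t \<omega>)\<^sup>2)"
      by (simp add: abs_mult)
  qed
qed

text \<open>Independence gives a product over \<open>j\<close>, and each factor is centered
  Gaussian; the exponent \<open>v\<close> is that of \<open>emp_linear_char\<close>. Injectivity of
  \<open>t\<close> is needed because \<open>gaussian_process\<close> takes sums over sets of
  times.\<close>

lemma bridge_linear_char:
  fixes c :: "'k \<Rightarrow> nat \<Rightarrow> real"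
  assumes L: "finite L" and t: "\<And>l. l \<in> L \<Longrightarrow> t l \<in> {0<..<1}" and inj: "inj_on t L"
  defines "v \<equiv> \<Sum>j\<in>UNIV. \<Sum>l\<in>L. \<Sum>l'\<in>L. c j l * c j l' / w $ j * (min (t l) (t l') - t l * t l')"
  shows "char (distr P borel (\<lambda>\<omega>. \<Sum>j\<in>UNIV. \<Sum>l\<in>L. c j l * (B j (t l) \<omega> / sqrt (w $ j)))) 1
    = complex_of_real (exp (- v / 2))"
proof -
  define d where "d j l = c j l / sqrt (w $ j)" for j l
  define Y where "Y j \<omega> = (\<Sum>l\<in>L. d j l * B j (t l) \<omega>)" for j \<omega>
  define u where "u j = (\<Sum>l\<in>L. \<Sum>l'\<in>L. d j l * d j l' * (min (t l) (t l') - t l * t l'))" for j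
  have t01: "t l \<in> {0..1}" if "l \<in> L" for l using t[OF that] by auto
  have gauss: "gaussian_rv P (Y j)" for j
  proof -
    have "Y j = (\<lambda>\<omega>. \<Sum>r\<in>t ` L. d j (inv_into L t r) * B j r \<omega>)"
      unfolding Y_def[abs_def] using inj by (simp add: sum.reindex inv_into_f_f)
    moreover have "gaussian_rv P (\<lambda>\<omega>. \<Sum>r\<in>t ` L. d j (inv_into L t r) * B j r \<omega>)"
      using L t01 by (intro B_gaussian) auto
    ultimately show ?thesis by (simp only:)
  qed
  have sq: "(\<lambda>\<omega>. (Y j \<omega>)\<^sup>2) = (\<lambda>\<omega>. \<Sum>l\<in>L. \<Sum>l'\<in>L. d j l * d j l' * (B j (t l) \<omega> * B j (t l') \<omega>))" for j
    unfolding Y_def power2_eq_square sum_product by (simp add: mult_ac)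
  have int2: "integrable P (\<lambda>\<omega>. (Y j \<omega>)\<^sup>2)" for j
    unfolding sq by (intro Bochner_Integration.integrable_sum integrable_mult_right B_product_integrable t)
  have mean: "expectation (Y j) = 0" for j
  proof -
    have "expectation (Y j) = (\<Sum>l\<in>L. expectation (\<lambda>\<omega>. d j l * B j (t l) \<omega>))"
      unfolding Y_def[abs_def]
      by (intro Bochner_Integration.integral_sum integrable_mult_right B_integrable t)
    also have "\<dots> = 0"
    proof (intro sum.neutral ballI)
      fix l assume "l \<in> L"
      then show "expectation (\<lambda>\<omega>. d j l * B j (t l) \<omega>) = 0" using B_mean[OF t01] by simp
    qed
    finally show ?thesis .
  qed
  have var: "expectation (\<lambda>\<omega>. (Y j \<omega>)\<^sup>2) = u j" for j
  proof -
    have "expectation (\<lambda>\<omega>. (Y j \<omega>)\<^sup>2) = (\<Sum>l\<in>L. expectation (\<lambda>\<omega>. \<Sum>l'\<in>L. d j l * d j l' * (B j (t l) \<omega> * B j (t l') \<omega>)))"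
      unfolding sq
      by (intro Bochner_Integration.integral_sum Bochner_Integration.integrable_sum integrable_mult_right
          B_product_integrable t)
    also have "\<dots> = (\<Sum>l\<in>L. \<Sum>l'\<in>L. expectation (\<lambda>\<omega>. d j l * d j l' * (B j (t l) \<omega> * B j (t l') \<omega>)))"
      by (intro sum.cong refl Bochner_Integration.integral_sum integrable_mult_right B_product_integrable t)
    also have "\<dots> = u j"
      unfolding u_def
    proof (intro sum.cong refl)
      fix l l' assume "l \<in> L" "l' \<in> L"
      then show "expectation (\<lambda>\<omega>. d j l * d j l' * (B j (t l) \<omega> * B j (t l') \<omega>))
          = d j l * d j l' * (min (t l) (t l') - t l * t l')"
        using B_cov[OF t01 t01, of l l' j] by simp
    qed
    finally show ?thesis .
  qed
  have ind: "indep_vars (\<lambda>_. borel) Y UNIV"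
  proof -
    have "(\<lambda>f. \<Sum>l\<in>L. d j l * f (t l)) \<in> borel_measurable (Pi\<^sub>M {0..1} (\<lambda>_. borel))" for j
      by (intro borel_measurable_sum borel_measurable_times borel_measurable_const
          measurable_component_singleton t01)
    from indep_vars_compose2[OF bridges_indep[unfolded indep_processes_def],
        of "\<lambda>j f. \<Sum>l\<in>L. d j l * f (t l)" "\<lambda>_. borel", OF this]
    have "indep_vars (\<lambda>_. borel) (\<lambda>j \<omega>. \<Sum>l\<in>L. d j l * (\<lambda>r\<in>{0..1}. B j r \<omega>) (t l)) UNIV" .
    moreover have "(\<Sum>l\<in>L. d j l * (\<lambda>r\<in>{0..1}. B j r \<omega>) (t l)) = Y j \<omega>" for j \<omega>
      unfolding Y_def by (intro sum.cong refl) (use t01 in auto)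
    ultimately show ?thesis by (simp add: Y_def[abs_def])
  qed
  have "(\<lambda>\<omega>. \<Sum>j\<in>UNIV. \<Sum>l\<in>L. c j l * (B j (t l) \<omega> / sqrt (w $ j))) = (\<lambda>\<omega>. \<Sum>j\<in>UNIV. Y j \<omega>)"
    by (simp add: Y_def d_def)
  then have "char (distr P borel (\<lambda>\<omega>. \<Sum>j\<in>UNIV. \<Sum>l\<in>L. c j l * (B j (t l) \<omega> / sqrt (w $ j)))) 1
      = (\<Prod>j\<in>UNIV. char (distr P borel (Y j)) 1)"
    using char_distr_sum[OF ind] by simp
  also have "\<dots> = (\<Prod>j\<in>UNIV. complex_of_real (exp (- u j / 2)))"
    by (intro prod.cong refl char_gaussian_rv gauss int2 mean var)
  also have "\<dots> = complex_of_real (exp (\<Sum>j\<in>UNIV. - u j / 2))"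
    by (simp only: exp_sum[OF finite] of_real_prod)
  also have "(\<Sum>j\<in>UNIV. - u j / 2) = - v / 2"
  proof -
    have dd: "d j l * d j l' = c j l * c j l' / w $ j" for j l l'
      using weight_nonneg[of j] by (simp add: d_def)
    have "v = (\<Sum>j\<in>UNIV. u j)" by (simp only: u_def v_def dd)
    then show ?thesis by (simp only: sum_divide_distrib[symmetric] sum_negf)
  qed
  finally show ?thesis .
qed

definition scaled :: "real \<Rightarrow> 'b \<Rightarrow> (real, 'k) vec" where
  "scaled t \<omega> = (\<chi> j. B j t \<omega> / sqrt (w $ j))"

lemma scaled_measurable: "t \<in> {0..1} \<Longrightarrow> scaled t \<in> borel_measurable P"
  unfolding scaled_def[abs_def]
  by (intro borel_measurable_vec_lambda borel_measurable_divide borel_measurable_const B_measurable)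

lemma wsq_scaled: "wsq (scaled t \<omega>) = (\<Sum>j\<in>UNIV. (B j t \<omega>)\<^sup>2)"
  unfolding wsq_def scaled_def
  by (intro sum.cong refl) (use weight_pos in \<open>simp add: power_divide less_imp_le less_imp_neq[symmetric]\<close>)

lemma wsq_scaled_diff: "wsq (scaled t \<omega> - scaled s \<omega>) = (\<Sum>j\<in>UNIV. (B j t \<omega> - B j s \<omega>)\<^sup>2)"
proof -
  have "w $ j * ((scaled t \<omega> - scaled s \<omega>) $ j)\<^sup>2 = (B j t \<omega> - B j s \<omega>)\<^sup>2" for j
    using weight_pos[of j] by (simp add: scaled_def power_divide flip: diff_divide_distrib)
  then show ?thesis by (simp add: wsq_def)
qed

lemma integrable_wsq_center_bound:
  assumes "U \<in> borel_measurable P" "integrable P (\<lambda>\<omega>. wsq (U \<omega>))"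
  shows "integrable P (\<lambda>\<omega>. wsq (center (U \<omega>)))"
    and "expectation (\<lambda>\<omega>. wsq (center (U \<omega>))) \<le> expectation (\<lambda>\<omega>. wsq (U \<omega>))"
proof -
  show "integrable P (\<lambda>\<omega>. wsq (center (U \<omega>)))"
  proof (rule Bochner_Integration.integrable_bound[OF assms(2)])
    show "(\<lambda>\<omega>. wsq (center (U \<omega>))) \<in> borel_measurable P"
      by (rule measurable_compose[OF assms(1) measurable_wsq_center])
    show "AE \<omega> in P. norm (wsq (center (U \<omega>))) \<le> norm (wsq (U \<omega>))"
      by (intro AE_I2) (simp add: wsq_nonneg wsq_center_le)
  qed
  then show "expectation (\<lambda>\<omega>. wsq (center (U \<omega>))) \<le> expectation (\<lambda>\<omega>. wsq (U \<omega>))"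
    by (intro integral_mono assms(2) wsq_center_le)
qed

lemma scaled_moment:
  assumes t: "t \<in> {0<..<1}"
  shows "integrable P (\<lambda>\<omega>. wsq (center (scaled t \<omega>)))"
    and "expectation (\<lambda>\<omega>. wsq (center (scaled t \<omega>))) \<le> real CARD('k) * (t * (1 - t))"
proof -
  have i: "integrable P (\<lambda>\<omega>. wsq (scaled t \<omega>))"
    unfolding wsq_scaled by (intro Bochner_Integration.integrable_sum B_square_integrable t)
  have m: "scaled t \<in> borel_measurable P" using t by (intro scaled_measurable) auto
  have "expectation (\<lambda>\<omega>. wsq (scaled t \<omega>)) = (\<Sum>j\<in>UNIV. expectation (\<lambda>\<omega>. (B j t \<omega>)\<^sup>2))"
    unfolding wsq_scaled by (intro Bochner_Integration.integral_sum B_square_integrable t)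
  also have "\<dots> = (\<Sum>j\<in>(UNIV :: 'k set). t * (1 - t))"
    using B_cov[of t t] t by (intro sum.cong refl) (simp add: power2_eq_square algebra_simps)
  finally show "integrable P (\<lambda>\<omega>. wsq (center (scaled t \<omega>)))"
    "expectation (\<lambda>\<omega>. wsq (center (scaled t \<omega>))) \<le> real CARD('k) * (t * (1 - t))"
    using integrable_wsq_center_bound[OF m i] by simp_all
qed

text \<open>The increment of a bridge has variance \<open>\<bar>t - s\<bar>\<close> minus the square
  of \<open>t - s\<close>, and the scaling by \<open>sqrt (w $ j)\<close> cancels the weights in
  \<open>wsq\<close>.\<close>

lemma scaled_diff_moment:
  assumes s: "s \<in> {0<..<1}" and t: "t \<in> {0<..<1}"
  shows "integrable P (\<lambda>\<omega>. wsq (center (scaled t \<omega> - scaled s \<omega>)))"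
    and "expectation (\<lambda>\<omega>. wsq (center (scaled t \<omega> - scaled s \<omega>))) \<le> real CARD('k) * \<bar>t - s\<bar>"
proof -
  have sq: "(B j t \<omega> - B j s \<omega>)\<^sup>2 = (B j t \<omega>)\<^sup>2 - 2 * (B j t \<omega> * B j s \<omega>) + (B j s \<omega>)\<^sup>2" for j \<omega>
    by (simp add: power2_diff)
  have ij: "integrable P (\<lambda>\<omega>. (B j t \<omega> - B j s \<omega>)\<^sup>2)" for j
    unfolding sq using B_square_integrable[OF s] B_square_integrable[OF t] B_product_integrable[OF t s] by simp
  have i: "integrable P (\<lambda>\<omega>. wsq (scaled t \<omega> - scaled s \<omega>))"
    unfolding wsq_scaled_diff by (intro Bochner_Integration.integrable_sum ij)
  have m: "(\<lambda>\<omega>. scaled t \<omega> - scaled s \<omega>) \<in> borel_measurable P"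
    using s t by (intro borel_measurable_diff scaled_measurable) auto
  have e: "expectation (\<lambda>\<omega>. (B j t \<omega> - B j s \<omega>)\<^sup>2) \<le> \<bar>t - s\<bar>" for j
  proof -
    have "expectation (\<lambda>\<omega>. (B j t \<omega> - B j s \<omega>)\<^sup>2) = (t - t * t) - 2 * (min t s - t * s) + (s - s * s)"
      unfolding sq using B_square_integrable[OF s] B_square_integrable[OF t] B_product_integrable[OF t s]
        B_cov[of t t j] B_cov[of s s j] B_cov[of t s j] s t
      by (simp add: power2_eq_square)
    also have "\<dots> = \<bar>t - s\<bar> - (t - s)\<^sup>2" by (simp add: min_def power2_eq_square algebra_simps)
    finally show ?thesis by simp
  qed
  have "expectation (\<lambda>\<omega>. wsq (scaled t \<omega> - scaled s \<omega>)) = (\<Sum>j\<in>UNIV. expectation (\<lambda>\<omega>. (B j t \<omega> - B j s \<omega>)\<^sup>2))"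
    unfolding wsq_scaled_diff by (intro Bochner_Integration.integral_sum ij)
  also have "\<dots> \<le> (\<Sum>j\<in>(UNIV :: 'k set). \<bar>t - s\<bar>)" by (intro sum_mono e)
  finally show "integrable P (\<lambda>\<omega>. wsq (center (scaled t \<omega> - scaled s \<omega>)))"
    "expectation (\<lambda>\<omega>. wsq (center (scaled t \<omega> - scaled s \<omega>))) \<le> real CARD('k) * \<bar>t - s\<bar>"
    using integrable_wsq_center_bound[OF m i] by simp_all
qed

text \<open>Continuous paths are limits of step functions.\<close>

lemma B_joint_measurable:
  "(\<lambda>(t, \<omega>). indicator {0<..<1} t * B j t \<omega>) \<in> borel_measurable (lborel \<Otimes>\<^sub>M P)"
proof (rule borel_measurable_LIMSEQ_real)
  define S where "S n z = indicator {0<..<1} (fst z) *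
    (\<Sum>i<n. indicator {real i / n<..(real i + 1) / n} (fst z) * B j (real i / n) (snd z))" for n z
  show "S n \<in> borel_measurable (lborel \<Otimes>\<^sub>M P)" for n
    unfolding S_def[abs_def]
  proof (intro borel_measurable_times borel_measurable_sum)
    show "(\<lambda>z. indicator {0<..<1 :: real} (fst z) :: real) \<in> borel_measurable (lborel \<Otimes>\<^sub>M P)"
      by measurable
    fix i assume i: "i \<in> {..<n}"
    show "(\<lambda>z. indicator {real i / n<..(real i + 1) / n} (fst z) :: real) \<in> borel_measurable (lborel \<Otimes>\<^sub>M P)"
      by measurable
    have "B j (real i / n) \<in> borel_measurable P" using i by (intro B_measurable) auto
    from measurable_compose[OF measurable_snd this]
    show "(\<lambda>z. B j (real i / n) (snd z)) \<in> borel_measurable (lborel \<Otimes>\<^sub>M P)" .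
  qed
  fix z :: "real \<times> 'b" assume "z \<in> space (lborel \<Otimes>\<^sub>M P)"
  then obtain t \<omega> where z: "z = (t, \<omega>)" and \<omega>: "\<omega> \<in> space P" by (auto simp: space_pair_measure)
  show "(\<lambda>n. S n z) \<longlonglongrightarrow> (case z of (t, \<omega>) \<Rightarrow> indicator {0<..<1} t * B j t \<omega>)"
  proof (cases "t \<in> {0<..<1}")
    case False
    then show ?thesis by (simp add: S_def z)
  next
    case True
    \<comment> \<open>Left endpoint of the cell of width \<open>1 / n\<close> that contains
      \<open>t\<close>; it converges to \<open>t\<close>, and path continuity does the rest.\<close>
    define q where "q n = real (nat (\<lceil>t * real n\<rceil> - 1)) / n" for n
    have Sq: "S n z = B j (q n) \<omega>" and q: "q n \<in> {0..1}" "\<bar>q n - t\<bar> \<le> 1 / n" if n: "0 < n" for n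
    proof -
      let ?i = "nat (\<lceil>t * real n\<rceil> - 1)"
      have tn: "0 < t * n" "t * n < n" using True n by auto
      have i: "real ?i < t * n" "t * n \<le> real ?i + 1" using tn by linarith+
      have "real ?i < real n" using i tn by linarith
      then have mem: "?i \<in> {..<n}" by simp
      have "indicator {real i / n<..(real i + 1) / n} t * B j (real i / n) \<omega> = (if i = ?i then B j (q n) \<omega> else 0)" for i
      proof -
        have "real i < t * n \<and> t * n \<le> real i + 1 \<longleftrightarrow> i = ?i"
        proof
          assume "real i < t * n \<and> t * n \<le> real i + 1"
          then have "real i < real ?i + 1" "real ?i < real i + 1" using i by linarith+
          then show "i = ?i" by linarith
        qed (use i in blast)
        then have "t \<in> {real i / n<..(real i + 1) / n} \<longleftrightarrow> i = ?i"
          using n by (simp add: pos_divide_less_eq pos_le_divide_eq)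
        then show ?thesis by (auto simp: indicator_def q_def)
      qed
      then have "(\<Sum>i<n. indicator {real i / n<..(real i + 1) / n} t * B j (real i / n) \<omega>) = B j (q n) \<omega>"
        using mem by simp
      then show "S n z = B j (q n) \<omega>" using True by (simp add: S_def z)
      show "q n \<in> {0..1}" using mem n by (simp add: q_def)
      have "q n * n = real ?i" using n by (simp add: q_def)
      then have "\<bar>q n * n - t * n\<bar> \<le> 1" using i by linarith
      then have "\<bar>q n - t\<bar> * n \<le> 1" by (simp add: abs_mult flip: left_diff_distrib)
      then show "\<bar>q n - t\<bar> \<le> 1 / n" using n by (simp add: pos_le_divide_eq)
    qed
    have "(\<lambda>n. q n - t) \<longlonglongrightarrow> 0"
    proof (rule Lim_null_comparison[OF _ lim_1_over_n])
      show "\<forall>\<^sub>F n in sequentially. norm (q n - t) \<le> 1 / real n"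
        using eventually_gt_at_top[of 0] by eventually_elim (use q(2) in simp)
    qed
    then have "q \<longlonglongrightarrow> t" by (simp add: LIM_zero_iff)
    moreover have "continuous_on {0..1} (\<lambda>t. B j t \<omega>)"
      using bridge[of j] \<omega> by (simp add: brownian_bridge_def)
    moreover have "\<forall>\<^sub>F n in sequentially. q n \<in> {0..1}"
      using eventually_gt_at_top[of 0] by eventually_elim (use q(1) in simp)
    ultimately have "(\<lambda>n. B j (q n) \<omega>) \<longlonglongrightarrow> B j t \<omega>"
      using True by (intro continuous_on_tendsto_compose[of "{0..1}" "\<lambda>t. B j t \<omega>"]) auto
    moreover have "\<forall>\<^sub>F n in sequentially. B j (q n) \<omega> = S n z"
      using eventually_gt_at_top[of 0] by eventually_elim (use Sq in simp)
    ultimately have "(\<lambda>n. S n z) \<longlonglongrightarrow> B j t \<omega>" by (rule Lim_transform_eventually)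
    then show ?thesis using True by (simp add: z)
  qed
qed

section \<open>The integrand of the limit variable and its Riemann sums\<close>

definition integrand :: "'k \<Rightarrow> real \<Rightarrow> 'b \<Rightarrow> real" where
  "integrand j t \<omega> = indicator {0<..<1} t * ((proj (scaled t \<omega>) $ j - wmean (scaled t \<omega>))\<^sup>2 / (t * (1 - t)))"

lemma integrand_measurable: "(\<lambda>(t, \<omega>). integrand j t \<omega>) \<in> borel_measurable (lborel \<Otimes>\<^sub>M P)"
proof -
  define V where "V z = (\<chi> i. (indicator {0<..<1} (fst z) * B i (fst z) (snd z)) / sqrt (w $ i))" for z
  have V: "V \<in> borel_measurable (lborel \<Otimes>\<^sub>M P)"
    unfolding V_def[abs_def]
    using B_joint_measurable by (intro borel_measurable_vec_lambda borel_measurable_divide) (auto simp: case_prod_unfold)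
  have "(\<lambda>v. (proj v $ j - wmean v)\<^sup>2) \<in> borel_measurable borel"
    by (intro borel_measurable_continuous_onI continuous_intros continuous_proj continuous_wmean)
  from measurable_compose[OF V this]
  have [measurable]: "(\<lambda>z. (proj (V z) $ j - wmean (V z))\<^sup>2) \<in> borel_measurable (lborel \<Otimes>\<^sub>M P)" .
  have "(\<lambda>z. indicator {0<..<1} (fst z) * ((proj (V z) $ j - wmean (V z))\<^sup>2 / (fst z * (1 - fst z))))
      \<in> borel_measurable (lborel \<Otimes>\<^sub>M P)"
    by measurable
  moreover have "(\<lambda>z. indicator {0<..<1} (fst z) * ((proj (V z) $ j - wmean (V z))\<^sup>2 / (fst z * (1 - fst z))))
      = (\<lambda>(t, \<omega>). integrand j t \<omega>)"
    by (auto simp: fun_eq_iff integrand_def V_def scaled_def indicator_def)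
  ultimately show ?thesis by (simp only:)
qed

lemma limit_variable_eq: "limit_variable w B \<omega> = (\<Sum>j\<in>UNIV. w $ j * (LINT t|lborel. integrand j t \<omega>))"
proof -
  have "wmean (scaled t \<omega>) = (\<Sum>i\<in>UNIV. sqrt (w $ i) * B i t \<omega>)" for t
  proof -
    have "w $ i * (B i t \<omega> / sqrt (w $ i)) = sqrt (w $ i) * B i t \<omega>" for i
      using weight_nonneg[of i] by (metis (no_types, opaque_lifting) mult.commute mult.left_commute real_div_sqrt times_divide_eq_left times_divide_eq_right)
    then show ?thesis by (simp add: wmean_def scaled_def)
  qed
  then show ?thesis
    unfolding limit_variable_def integrand_def scaled_def[symmetric] proj_def[symmetric]
    by (simp add: interval_lebesgue_integral_def set_lebesgue_integral_def zero_ereal_def one_ereal_def)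
qed

lemma limit_variable_measurable: "limit_variable w B \<in> borel_measurable P"
proof -
  have "(\<lambda>\<omega>. LINT t|lborel. integrand j t \<omega>) \<in> borel_measurable P" for j
  proof (rule sigma_finite_measure.borel_measurable_lebesgue_integral)
    show "sigma_finite_measure (lborel :: real measure)" by (rule sigma_finite_lborel)
    show "(\<lambda>(\<omega>, t). integrand j t \<omega>) \<in> borel_measurable (P \<Otimes>\<^sub>M lborel)"
      using measurable_compose[OF measurable_pair_swap' integrand_measurable] by (simp add: case_prod_unfold)
  qed
  then show ?thesis unfolding limit_variable_eq[abs_def] by simp
qed

definition total_integrand :: "real \<Rightarrow> 'b \<Rightarrow> real" where
  "total_integrand t \<omega> = (\<Sum>j\<in>UNIV. w $ j * integrand j t \<omega>)"

lemma total_integrand_eq: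
  "t \<in> {0<..<1} \<Longrightarrow> total_integrand t \<omega> = iso_dev (scaled t \<omega>) / (t * (1 - t))"
  by (simp add: total_integrand_def integrand_def iso_dev_def sum_divide_distrib)

lemma integrand_nonneg: "0 \<le> integrand j t \<omega>"
  by (auto simp: integrand_def indicator_def)

text \<open>The weighted summands are nonnegative, so each is dominated by the total, and
  integrability of the total, known almost surely from the Riemann sum argument, passes to each of
  them. This justifies exchanging sum and integral.\<close>

lemma integrable_integrand:
  assumes \<omega>: "\<omega> \<in> space P" and i: "integrable lborel (\<lambda>t. total_integrand t \<omega>)"
  shows "integrable lborel (\<lambda>t. integrand j t \<omega>)"
proof (rule Bochner_Integration.integrable_bound)
  show "integrable lborel (\<lambda>t. total_integrand t \<omega> / w $ j)" using i by simp
  show "(\<lambda>t. integrand j t \<omega>) \<in> borel_measurable lborel"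
    using measurable_compose[OF measurable_Pair2'[OF \<omega>, of lborel] integrand_measurable] by simp
  show "AE t in lborel. norm (integrand j t \<omega>) \<le> norm (total_integrand t \<omega> / w $ j)"
  proof (rule AE_I2)
    fix t
    have "w $ j * integrand j t \<omega> \<le> total_integrand t \<omega>"
      unfolding total_integrand_def
      by (rule member_le_sum[of j UNIV "\<lambda>j. w $ j * integrand j t \<omega>"]) (auto intro: mult_nonneg_nonneg weight_nonneg integrand_nonneg)
    then have "integrand j t \<omega> \<le> total_integrand t \<omega> / w $ j"
      using weight_pos[of j] by (simp add: pos_le_divide_eq mult.commute)
    then show "norm (integrand j t \<omega>) \<le> norm (total_integrand t \<omega> / w $ j)"
      using integrand_nonneg[of j t \<omega>] unfolding real_norm_def by linarith
  qed
qed

text \<open>The expected squared norm of the bridges is at most a multiple of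
  \<open>t * (1 - t)\<close>, which cancels the weight and bounds the end strips. The margin
  \<open>a / (2 * K)\<close> is the one used for the statistic, so a single mesh serves
  both.\<close>

lemma limit_variable_approximation:
  assumes a: "0 < a" "2 * a \<le> K"
  shows "(\<integral>\<^sup>+\<omega>. ennreal \<bar>limit_variable w B \<omega>
      - (\<Sum>l=a..<K - a. iso_dev (scaled (real l / K) \<omega>) / (real l / K * (1 - real l / K))) / K\<bar> \<partial>P)
    \<le> ennreal (2 * real CARD('k) * a / K + cell_error (real CARD('k)) (real a / (2 * real K)) (1 / K))"
proof -
  let ?k = "real CARD('k)"
  define c where "c = real a / (2 * real K)"
  define Q where "Q l \<omega> = iso_dev (scaled (real l / K) \<omega>) / (real l / K * (1 - real l / K))" for l \<omega>
  have K: "0 < real K" using a by simp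
  have c: "0 < c" using a K by (simp add: c_def)
  have e: "0 \<le> cell_error ?k c (1 / K)"
    unfolding cell_error_def using c K by (intro add_nonneg_nonneg divide_nonneg_nonneg mult_nonneg_nonneg) auto
  have l01: "2 * c \<le> real l / K" "real l / K \<le> 1 - 2 * c" "(real l + 1) / K \<le> 1 - 2 * c" if l: "l \<in> {a..<K - a}" for l
  proof -
    have l': "real a \<le> real l" "real l + 1 \<le> real K - real a" using l by auto
    have "real a / K \<le> real l / K" "(real l + 1) / K \<le> (real K - real a) / K"
      using l' K by (auto intro: divide_right_mono)
    moreover have "(real K - real a) / K = 1 - real a / K" using K by (simp add: diff_divide_distrib)
    moreover have "real a / K = 2 * c" using K by (simp add: c_def)
    moreover have "real l / K \<le> (real l + 1) / K" using K by (simp add: divide_right_mono)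
    ultimately show "2 * c \<le> real l / K" "real l / K \<le> 1 - 2 * c" "(real l + 1) / K \<le> 1 - 2 * c" by linarith+
  qed
  note R = riemann_sum_approximation[where G=total_integrand and Q=Q and a=a and K=K and C="?k" and e="cell_error ?k c (1 / K)", OF _ _ _ a _ e]
  have m: "(\<lambda>(t, \<omega>). total_integrand t \<omega>) \<in> borel_measurable (lborel \<Otimes>\<^sub>M P)"
    unfolding total_integrand_def case_prod_unfold
    using integrand_measurable by (intro borel_measurable_sum borel_measurable_times) (auto simp: case_prod_unfold)
  have z: "total_integrand t \<omega> = 0" if "t \<notin> {0<..<1}" for t \<omega>
    using that by (simp add: total_integrand_def integrand_def)
  have Qm: "Q l \<in> borel_measurable P" if l: "l \<in> {a..<K - a}" for l
  proof -
    have "real l / K \<in> {0..1}" using l01[OF l] c by auto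
    from measurable_compose[OF scaled_measurable[OF this] measurable_iso_dev]
    show ?thesis by (simp add: Q_def[abs_def])
  qed
  have k0: "0 \<le> ?k" by simp
  have ends: "(\<integral>\<^sup>+\<omega>. ennreal \<bar>total_integrand t \<omega>\<bar> \<partial>P) \<le> ennreal ?k" if t: "t \<in> {0<..<1}" for t
  proof -
    have p: "0 < t * (1 - t)" using t by simp
    have "(\<integral>\<^sup>+\<omega>. ennreal \<bar>total_integrand t \<omega>\<bar> \<partial>P) \<le> (\<integral>\<^sup>+\<omega>. ennreal (wsq (center (scaled t \<omega>)) / (t * (1 - t))) \<partial>P)"
    proof (intro nn_integral_mono ennreal_leI)
      fix \<omega>
      have "\<bar>total_integrand t \<omega>\<bar> = iso_dev (scaled t \<omega>) / (t * (1 - t))"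
        using p t by (simp add: total_integrand_eq[OF t] iso_dev_nonneg)
      then show "\<bar>total_integrand t \<omega>\<bar> \<le> wsq (center (scaled t \<omega>)) / (t * (1 - t))"
        using p by (simp only:) (intro divide_right_mono iso_dev_le, simp)
    qed
    also have "\<dots> = ennreal (expectation (\<lambda>\<omega>. wsq (center (scaled t \<omega>)) / (t * (1 - t))))"
      using scaled_moment(1)[OF t] t by (intro nn_integral_eq_integral) (auto simp: wsq_nonneg intro!: AE_I2)
    also have "\<dots> \<le> ennreal ?k"
    proof (rule ennreal_leI)
      have "expectation (\<lambda>\<omega>. wsq (center (scaled t \<omega>)) / (t * (1 - t)))
          \<le> ?k * (t * (1 - t)) / (t * (1 - t))"
        using p by (simp only: integral_divide_zero) (intro divide_right_mono scaled_moment(2)[OF t], simp)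
      moreover have "x * y / y = x" if "0 < y" for x y :: real using that by simp
      ultimately show "expectation (\<lambda>\<omega>. wsq (center (scaled t \<omega>)) / (t * (1 - t))) \<le> ?k"
        using p by (simp only:)
    qed
    finally show ?thesis .
  qed
  have cell: "(\<integral>\<^sup>+\<omega>. ennreal \<bar>total_integrand t \<omega> - Q l \<omega>\<bar> \<partial>P) \<le> ennreal (cell_error ?k c (1 / K))"
    if l: "l \<in> {a..<K - a}" and t: "t \<in> {0<..<1}" "real l / K < t" "t \<le> (real l + 1) / K" for l t
  proof -
    let ?s = "real l / K"
    have s: "?s \<in> {0<..<1}" using l01[OF l] c by auto
    have ts: "\<bar>t - ?s\<bar> \<le> 1 / K" using t by (simp add: add_divide_distrib)
    have le1: "u * (1 - u) \<le> 1" if "u \<in> {0<..<1}" for u :: real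
      using that mult_mono[of u 1 "1 - u" 1] by simp
    have mom: "expectation (\<lambda>\<omega>. wsq (center (scaled u \<omega>))) \<le> ?k" if u: "u \<in> {0<..<1}" for u
    proof -
      have "?k * (u * (1 - u)) \<le> ?k * 1" by (intro mult_left_mono le1 u) simp
      from order_trans[OF scaled_moment(2)[OF u] this] show ?thesis by simp
    qed
    have momd: "expectation (\<lambda>\<omega>. wsq (center (scaled t \<omega> - scaled ?s \<omega>))) \<le> ?k * (1 / K)"
      by (rule order_trans[OF scaled_diff_moment(2)[OF s t(1)]]) (intro mult_left_mono ts, simp)
    have meas: "scaled t \<in> borel_measurable P" "scaled ?s \<in> borel_measurable P"
      using s t by (auto intro!: scaled_measurable simp del: divide_le_eq_1)
    have cs: "c \<le> t" "c \<le> 1 - t" "c \<le> ?s" "c \<le> 1 - ?s" using l01[OF l] t c by linarith+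
    have d: "0 < 1 / real K" using K by simp
    note diff = iso_dev_ratio_diff[OF prob_space_axioms meas scaled_moment(1)[OF t(1)] scaled_moment(1)[OF s]
        scaled_diff_moment(1)[OF s t(1)] mom[OF t(1)] mom[OF s] momd d ts c cs]
    have "(\<integral>\<^sup>+\<omega>. ennreal \<bar>total_integrand t \<omega> - Q l \<omega>\<bar> \<partial>P)
        = (\<integral>\<^sup>+\<omega>. ennreal \<bar>iso_dev (scaled t \<omega>) / (t * (1 - t)) - iso_dev (scaled ?s \<omega>) / (?s * (1 - ?s))\<bar> \<partial>P)"
      by (simp only: total_integrand_eq[OF t(1)] Q_def)
    also have "\<dots> = ennreal (expectation (\<lambda>\<omega>. \<bar>iso_dev (scaled t \<omega>) / (t * (1 - t)) - iso_dev (scaled ?s \<omega>) / (?s * (1 - ?s))\<bar>))"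
      using diff(1) by (intro nn_integral_eq_integral AE_I2) simp_all
    also have "\<dots> \<le> ennreal (cell_error ?k c (1 / K))" by (intro ennreal_leI diff(2))
    finally show ?thesis .
  qed
  have R1: "AE \<omega> in P. integrable lborel (\<lambda>t. total_integrand t \<omega>)"
    by (rule R(1)[OF m z Qm k0 ends cell]) assumption+
  have R3: "(\<integral>\<^sup>+\<omega>. ennreal \<bar>(LINT t|lborel. total_integrand t \<omega>) - (\<Sum>l=a..<K - a. Q l \<omega>) / K\<bar> \<partial>P)
      \<le> ennreal (2 * ?k * a / K + cell_error ?k c (1 / K))"
    by (rule R(3)[OF m z Qm k0 ends cell]) assumption+
  have "AE \<omega> in P. limit_variable w B \<omega> = (LINT t|lborel. total_integrand t \<omega>)"
    using R1 AE_space
  proof eventually_elim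
    case (elim \<omega>)
    then have "(LINT t|lborel. total_integrand t \<omega>) = (\<Sum>j\<in>UNIV. LINT t|lborel. w $ j * integrand j t \<omega>)"
      unfolding total_integrand_def
      by (intro Bochner_Integration.integral_sum integrable_mult_right integrable_integrand)
        (simp_all add: total_integrand_def)
    then show ?case by (simp add: limit_variable_eq)
  qed
  then have "(\<integral>\<^sup>+\<omega>. ennreal \<bar>limit_variable w B \<omega> - (\<Sum>l=a..<K - a. Q l \<omega>) / K\<bar> \<partial>P)
      = (\<integral>\<^sup>+\<omega>. ennreal \<bar>(LINT t|lborel. total_integrand t \<omega>) - (\<Sum>l=a..<K - a. Q l \<omega>) / K\<bar> \<partial>P)"
    by (intro nn_integral_cong_AE) (auto elim!: eventually_mono)
  with R3 show ?thesis by (simp add: Q_def c_def)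
qed

end

section \<open>Convergence in distribution\<close>

lemma (in prob_space) cts_step_close:
  assumes T: "T \<in> borel_measurable M" and Y: "Y \<in> borel_measurable M" and D: "0 \<le> D"
    and close: "(\<integral>\<^sup>+\<omega>. ennreal \<bar>T \<omega> - Y \<omega>\<bar> \<partial>M) \<le> ennreal D" and ab: "a < b"
  shows "\<bar>expectation (\<lambda>\<omega>. cts_step a b (T \<omega>)) - expectation (\<lambda>\<omega>. cts_step a b (Y \<omega>))\<bar> \<le> D / (b - a)"
proof -
  have int: "integrable M (\<lambda>\<omega>. cts_step a b (U \<omega>))" if "U \<in> borel_measurable M" for U
    using measurable_compose[OF that measurable_cts_step[OF ab]] cts_step_bound[OF ab]
    by (intro integrable_const_bound[of _ 1]) auto
  have "expectation (\<lambda>\<omega>. cts_step a b (T \<omega>)) - expectation (\<lambda>\<omega>. cts_step a b (Y \<omega>))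
      = expectation (\<lambda>\<omega>. cts_step a b (T \<omega>) - cts_step a b (Y \<omega>))"
    using int[OF T] int[OF Y] by simp
  also have "\<bar>\<dots>\<bar> \<le> expectation (\<lambda>\<omega>. \<bar>cts_step a b (T \<omega>) - cts_step a b (Y \<omega>)\<bar>)"
    by (rule integral_abs_bound)
  also have "\<dots> \<le> D / (b - a)"
  proof -
    have "ennreal (expectation (\<lambda>\<omega>. \<bar>cts_step a b (T \<omega>) - cts_step a b (Y \<omega>)\<bar>))
        = (\<integral>\<^sup>+\<omega>. ennreal \<bar>cts_step a b (T \<omega>) - cts_step a b (Y \<omega>)\<bar> \<partial>M)"
      using int[OF T] int[OF Y] by (intro nn_integral_eq_integral[symmetric]) auto
    also have "\<dots> \<le> (\<integral>\<^sup>+\<omega>. ennreal (1 / (b - a)) * ennreal \<bar>T \<omega> - Y \<omega>\<bar> \<partial>M)"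
    proof (rule nn_integral_mono)
      fix \<omega>
      have "ennreal (1 / (b - a)) * ennreal \<bar>T \<omega> - Y \<omega>\<bar> = ennreal (\<bar>T \<omega> - Y \<omega>\<bar> / (b - a))"
        using ab by (subst ennreal_mult[symmetric]) auto
      then show "ennreal \<bar>cts_step a b (T \<omega>) - cts_step a b (Y \<omega>)\<bar> \<le> ennreal (1 / (b - a)) * ennreal \<bar>T \<omega> - Y \<omega>\<bar>"
        using cts_step_lipschitz[OF ab] by (simp only: ennreal_leI)
    qed
    also have "\<dots> = ennreal (1 / (b - a)) * (\<integral>\<^sup>+\<omega>. ennreal \<bar>T \<omega> - Y \<omega>\<bar> \<partial>M)"
      using T Y by (intro nn_integral_cmult) auto
    also have "\<dots> \<le> ennreal (1 / (b - a)) * ennreal D" by (intro mult_left_mono close) auto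
    also have "\<dots> = ennreal (D / (b - a))" using ab D by (subst ennreal_mult[symmetric]) auto
    finally show ?thesis using ab D by (subst (asm) ennreal_le_iff) auto
  qed
  finally show ?thesis .
qed

lemma (in prob_space) cos_sin_char:
  assumes V: "V \<in> borel_measurable M"
  shows "expectation (\<lambda>\<omega>. cos (V \<omega>)) = Re (char (distr M borel V) 1)"
    and "expectation (\<lambda>\<omega>. sin (V \<omega>)) = Im (char (distr M borel V) 1)"
proof -
  have e: "char (distr M borel V) 1 = (CLINT \<omega>|M. iexp (V \<omega>))"
    unfolding char_def using V by (subst integral_distr) auto
  have i: "complex_integrable M (\<lambda>\<omega>. iexp (V \<omega>))"
    using V by (intro integrable_iexp) auto
  show "expectation (\<lambda>\<omega>. cos (V \<omega>)) = Re (char (distr M borel V) 1)"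
    unfolding e using integral_Re[OF i] by (simp add: Re_exp)
  show "expectation (\<lambda>\<omega>. sin (V \<omega>)) = Im (char (distr M borel V) 1)"
    unfolding e using integral_Im[OF i] by (simp add: Im_exp)
qed

lemma cell_error_tendsto:
  assumes "(d \<longlongrightarrow> d0) F" shows "((\<lambda>x. cell_error k c (d x)) \<longlongrightarrow> cell_error k c d0) F"
  unfolding cell_error_def divide_inverse by (intro tendsto_intros assms)

text \<open>With \<open>K = q * a\<close> the strip width \<open>a / K = 1 / q\<close> is fixed
  first, making the ends cheap while freezing the margin at \<open>1 / (2 * q)\<close>. Then
  \<open>a\<close> grows, the mesh width tends to 0, and so does the cell error. The maximum with 2
  ensures \<open>2 * a \<le> K\<close>.\<close>

lemma small_mesh:
  fixes e k :: real
  assumes e: "0 < e" and k: "0 \<le> k"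
  obtains a K :: nat where "0 < a" "2 * a \<le> K"
    "8 * k * a / K + cell_error k (a / (2 * real K)) (1 / K) < e"
proof -
  obtain p :: nat where p: "16 * k / e < p" using reals_Archimedean2 by blast
  define q where "q = max p 2"
  have q: "16 * k / e < q" "2 \<le> q" using p by (auto simp: q_def)
  have q0: "0 < real q" using q by simp
  have small: "8 * k / q < e / 2" using q(1) e q0 by (simp add: field_simps)
  have "(\<lambda>a. 1 / real q * (1 / real a)) \<longlonglongrightarrow> 1 / real q * 0"
    by (rule tendsto_mult_left[OF lim_1_over_n])
  then have "(\<lambda>a. 1 / real q * (1 / real a)) \<longlonglongrightarrow> 0" by (simp only: mult_zero_right)
  then have "(\<lambda>a. cell_error k (1 / (2 * q)) (1 / real q * (1 / real a))) \<longlonglongrightarrow> cell_error k (1 / (2 * q)) 0"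
    by (rule cell_error_tendsto)
  then have "(\<lambda>a. cell_error k (1 / (2 * q)) (1 / real q * (1 / real a))) \<longlonglongrightarrow> 0"
    by (simp add: cell_error_def)
  then have "\<forall>\<^sub>F a in sequentially. cell_error k (1 / (2 * q)) (1 / real q * (1 / real a)) < e / 2"
    using e by (intro order_tendstoD(2)) auto
  with eventually_gt_at_top[of 0]
  have "\<forall>\<^sub>F a in sequentially. 0 < a \<and> cell_error k (1 / (2 * q)) (1 / real q * (1 / real a)) < e / 2"
    by (rule eventually_conj)
  then obtain a where "\<forall>b\<ge>a. 0 < b \<and> cell_error k (1 / (2 * q)) (1 / real q * (1 / real b)) < e / 2"
    unfolding eventually_sequentially ..
  then have a: "0 < a" "cell_error k (1 / (2 * q)) (1 / real q * (1 / real a)) < e / 2" by blast+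
  show thesis
  proof (rule that[of a "q * a"])
    show "0 < a" "2 * a \<le> q * a" using a q by auto
    have "8 * k * a / real (q * a) = 8 * k / q" "real a / (2 * real (q * a)) = 1 / (2 * q)"
      "1 / real (q * a) = 1 / real q * (1 / real a)"
      using a by simp_all
    then show "8 * k * a / real (q * a) + cell_error k (real a / (2 * real (q * a))) (1 / real (q * a)) < e"
      using small a(2) by simp
  qed
qed

context sample_model
begin

section \<open>Finite-dimensional vectors at the mesh points\<close>

definition emp_process :: "(nat \<Rightarrow> real) \<Rightarrow> nat \<Rightarrow> 'k \<times> nat \<Rightarrow> 'a \<Rightarrow> real" where
  "emp_process s K p \<omega> = sqrt size * (emp (s (snd p)) \<omega> $ fst p - real (snd p) / K)"

lemma emp_process_measurable: "emp_process s K p \<in> borel_measurable M"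
proof -
  have "(\<lambda>\<omega>. emp (s (snd p)) \<omega> $ fst p) \<in> borel_measurable M"
    using measurable_compose[OF emp_measurable borel_measurable_continuous_onI[OF continuous_on_component[OF continuous_on_id]]] .
  then show ?thesis unfolding emp_process_def[abs_def] by simp
qed

lemma emp_process_moment:
  assumes s: "measure \<nu> {..s (snd p)} = real (snd p) / K"
  shows "integrable M (\<lambda>\<omega>. (emp_process s K p \<omega>)\<^sup>2)"
    and "expectation (\<lambda>\<omega>. (emp_process s K p \<omega>)\<^sup>2) \<le> inv_weights"
proof -
  have eq: "(emp_process s K p \<omega>)\<^sup>2 = size * (emp (s (snd p)) \<omega> $ fst p - measure \<nu> {..s (snd p)})\<^sup>2" for \<omega>
    by (simp add: emp_process_def power_mult_distrib s)
  show "integrable M (\<lambda>\<omega>. (emp_process s K p \<omega>)\<^sup>2)"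
    unfolding eq by (intro integrable_mult_right emp_component_moments)
  have "expectation (\<lambda>\<omega>. (emp_process s K p \<omega>)\<^sup>2)
      = size * expectation (\<lambda>\<omega>. (emp (s (snd p)) \<omega> $ fst p - measure \<nu> {..s (snd p)})\<^sup>2)"
    unfolding eq by simp
  also have "\<dots> \<le> size * (1 / N (fst p))" by (intro mult_left_mono emp_component_moments) auto
  also have "\<dots> = 1 / w $ fst p" using size_pos by (simp add: N_eq)
  also have "\<dots> \<le> inv_weights" by (rule inv_weights_ge)
  finally show "expectation (\<lambda>\<omega>. (emp_process s K p \<omega>)\<^sup>2) \<le> inv_weights" .
qed

text \<open>Centering shifts all coordinates by the same amount, because under the null hypothesis
  every sample has the same quantile level; \<open>iso_dev\<close> ignores such shifts.\<close>

lemma iso_dev_emp_process: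
  "iso_dev (\<chi> j. emp_process s K (j, l) \<omega>) = iso_dev (sqrt size *\<^sub>R emp (s l) \<omega>)"
proof -
  have n: "0 < sqrt size" using size_pos by simp
  have "(\<chi> j. emp_process s K (j, l) \<omega>) = sqrt size *\<^sub>R (\<chi> j. emp (s l) \<omega> $ j + (- (real l / K)))"
    by (simp add: emp_process_def vec_eq_iff)
  then show ?thesis by (simp only: iso_dev_scale[OF n] iso_dev_shift)
qed

end

text \<open>One functional of finitely many coordinates yields both Riemann sums: at
  \<open>emp_process\<close> that of the statistic, at the scaled bridges that of the limit.\<close>

definition mesh_functional :: "real ^ 'k::{finite,linorder} \<Rightarrow> nat \<Rightarrow> nat \<Rightarrow> ('k \<times> nat \<Rightarrow> real) \<Rightarrow> real" where
  "mesh_functional w a K u =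
    (\<Sum>l=a..<K - a. weights.iso_dev w (\<chi> j. u (j, l)) / (real l / K * (1 - real l / K))) / K"

lemma (in weights) continuous_mesh_functional: "continuous_on UNIV (mesh_functional w a K)"
  unfolding mesh_functional_def[abs_def] divide_inverse
  by (intro continuous_intros continuous_on_compose2[OF continuous_iso_dev] continuous_on_vec_lambda) auto

theorem theorem2:
  fixes w :: "real ^ 'k::{finite,linorder}"
    and N :: "nat \<Rightarrow> 'k \<Rightarrow> nat"
    and M :: "nat \<Rightarrow> 'a measure"
    and X :: "nat \<Rightarrow> 'k \<Rightarrow> nat \<Rightarrow> 'a \<Rightarrow> real"
    and F :: "'k \<Rightarrow> real \<Rightarrow> real"
    and P :: "'b measure"
    and B :: "'k \<Rightarrow> real \<Rightarrow> 'b \<Rightarrow> real"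
  assumes k: "CARD('k) \<ge> 2"
    and w_bounds: "\<And>j. 0 < w $ j \<and> w $ j < 1"
    and proportions: "\<And>m j. w $ j = real (N m j) / real (\<Sum>i\<in>UNIV. N m i)"
    and total_size: "filterlim (\<lambda>m. \<Sum>i\<in>UNIV. N m i) at_top sequentially"
    and M: "\<And>m. prob_space (M m)"
    and independent: "\<And>m. prob_space.indep_vars (M m) (\<lambda>_. borel) (\<lambda>(j, i). X m j i)
                         (SIGMA j:UNIV. {..<N m j})"
    and sample_cdf: "\<And>m j i. i < N m j \<Longrightarrow> cdf (distr (M m) borel (X m j i)) = F j"
    and H0: "\<And>i j. F i = F j"
    and F_cont: "\<And>j. continuous_on UNIV (F j)"
    and P: "prob_space P"
    and bridges: "\<And>j. brownian_bridge P (B j)"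
    and bridges_indep: "indep_processes P {0..1} B"
  shows "weak_conv_m
           (\<lambda>m. distr (M m) borel (\<lambda>\<omega>. test_statistic w (N m) (\<lambda>j i. X m j i \<omega>)))
           (distr P borel (limit_variable w B))"
proof -
  have w: "0 < w $ j" for j using w_bounds by blast
  have N0: "0 < N m j" for m j using w[of j] proportions[of j m] by (cases "N m j") auto
  have S0: "0 < (\<Sum>i\<in>UNIV. N m i)" for m using N0 by (intro sum_pos) auto
  have "(\<Sum>j\<in>UNIV. w $ j) = 1"
  proof -
    have "(\<Sum>j\<in>UNIV. w $ j) = real (\<Sum>i\<in>UNIV. N 0 i) / real (\<Sum>i\<in>UNIV. N 0 i)"
      by (subst (1) proportions[of _ 0]) (simp flip: sum_divide_distrib)
    moreover have "real (\<Sum>i\<in>UNIV. N 0 i) \<noteq> 0" using S0[of 0] by (metis of_nat_eq_0_iff less_irrefl)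
    ultimately show ?thesis by (metis divide_self)
  qed
  then interpret weights w by unfold_locales (use w in auto)
  define j0 :: 'k where "j0 = undefined"
  define \<nu> where "\<nu> = distr (M 0) borel (X 0 j0 0)"
  define \<xi> where "\<xi> m = (\<lambda>(j, i). X m j i)" for m
  have Xm: "X m j i \<in> borel_measurable (M m)" if "i < N m j" for m j i
  proof -
    interpret prob_space "M m" by (rule M)
    show ?thesis using independent[of m] that by (auto simp: indep_vars_def2)
  qed
  have rd: "real_distribution (distr (M m) borel (X m j i))" if "i < N m j" for m j i
    by (intro prob_space.real_distribution_distr M Xm that)
  interpret \<nu>: real_distribution \<nu> unfolding \<nu>_def by (rule rd) (rule N0)
  \<comment> \<open>Under the null hypothesis all observations, in every sample and for every
    \<open>m\<close>, have the same cdf, so one law \<open>\<nu>\<close> serves the whole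
    sequence.\<close>
  have law: "distr (M m) borel (X m j i) = \<nu>" if "i < N m j" for m j i
    unfolding \<nu>_def using sample_cdf[OF that] sample_cdf[OF N0[of 0 j0]] H0[of j j0]
    by (intro cdf_unique rd that N0) simp
  have atomless: "measure \<nu> {x} = 0" for x
  proof -
    have "cdf \<nu> = F j0" unfolding \<nu>_def by (rule sample_cdf[OF N0])
    moreover have "isCont (F j0) x"
      using F_cont[of j0] by (simp add: continuous_on_eq_continuous_at)
    ultimately have "isCont (cdf \<nu>) x" by (simp only:)
    then show ?thesis by (simp only: \<nu>.isCont_cdf)
  qed
  have model: "sample_model w (N m) (M m) (\<xi> m) \<nu>" for m
  proof -
    interpret prob_space "M m" by (rule M)
    interpret samples w "N m" by unfold_locales (rule proportions)
    show ?thesis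
    proof unfold_locales
      show "finite pool" by (rule finite_pool)
      show "indep_vars (\<lambda>_. borel) (\<xi> m) pool"
        using independent[of m] by (simp add: pool_def \<xi>_def)
      show "distr (M m) borel (\<xi> m p) = \<nu>" if "p \<in> pool" for p
        using that law by (auto simp: pool_def \<xi>_def)
      have "(\<Sum>j\<in>(UNIV :: 'k set). 1) \<le> (\<Sum>j\<in>UNIV. N m j)"
        using N0[of m] by (intro sum_mono) (simp add: Suc_le_eq)
      then show "2 \<le> card pool" using k by (simp add: card_pool size_def)
      show "measure \<nu> {x} = 0" for x by (rule atomless)
    qed
  qed
  interpret Br: bridges w P B
    by (intro bridges.intro bridges_axioms.intro weights_axioms P bridges bridges_indep)
  define n where "n m = (\<Sum>i\<in>UNIV. N m i)" for m
  have size: "samples.size (N m) = n m" for m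
  proof -
    interpret sample_model w "N m" "M m" "\<xi> m" \<nu> by (rule model)
    show ?thesis by (simp add: size_def n_def)
  qed
  have n_top: "filterlim (\<lambda>m. real (n m)) at_top sequentially"
    unfolding n_def by (rule filterlim_compose[OF filterlim_real_sequentially total_size])
  have inv_n: "(\<lambda>m. 1 / real (n m)) \<longlonglongrightarrow> 0"
    by (rule tendsto_divide_0[OF tendsto_const filterlim_at_top_imp_at_infinity[OF n_top]])
  have sqrt_top: "filterlim (\<lambda>m. sqrt (real (n m))) at_top sequentially"
    by (rule filterlim_compose[OF sqrt_at_top n_top])
  have inv_sqrt: "(\<lambda>m. x / sqrt (real (n m))) \<longlonglongrightarrow> 0" for x
    by (rule tendsto_divide_0[OF tendsto_const filterlim_at_top_imp_at_infinity[OF sqrt_top]])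
  define T where "T m \<omega> = test_statistic w (N m) (\<lambda>j i. X m j i \<omega>)" for m \<omega>
  have Tm: "T m \<in> borel_measurable (M m)" for m
  proof -
    interpret sample_model w "N m" "M m" "\<xi> m" \<nu> by (rule model)
    show ?thesis unfolding T_def[abs_def] by (rule measurable_test_statistic[OF Xm])
  qed
  let ?k = "real CARD('k)"
  \<comment> \<open>The functions \<open>cts_step x y\<close> suffice for weak convergence. The
    error has three parts below or equal to \<open>r / 4\<close>: statistic to Riemann sum,
    empirical to bridge Riemann sum, and Riemann sum to limit.\<close>
  have "(\<lambda>m. LINT \<omega>|M m. cts_step x y (T m \<omega>)) \<longlonglongrightarrow> (LINT \<omega>|P. cts_step x y (limit_variable w B \<omega>))"
    if xy: "x < y" for x y
  proof (rule LIMSEQ_I)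
    fix r :: real assume r: "0 < r"
    \<comment> \<open>The Lipschitz constant of \<open>cts_step x y\<close> is
      \<open>1 / (y - x)\<close>, so an error \<open>e\<close> in mean costs at most
      \<open>r / 4\<close>.\<close>
    define e where "e = r / 4 * (y - x)"
    have e: "0 < e" "e / (y - x) = r / 4"
      unfolding e_def using r xy by (simp, intro nonzero_mult_div_cancel_right, simp)
    obtain a K :: nat where a: "0 < a" "2 * a \<le> K"
      and err: "8 * ?k * a / K + cell_error ?k (a / (2 * real K)) (1 / K) < e"
      using small_mesh[OF e(1), of ?k] by auto
    let ?L = "{a..<K - a}" and ?c = "real a / (2 * real K)"
    have K: "0 < real K" using a by simp
    have l01: "real l / K \<in> {0<..<1}" if "l \<in> ?L" for l
      using that a by auto
    have "\<exists>s. measure \<nu> {..s} = real l / K" if "l \<in> ?L" for l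
    proof -
      interpret sample_model w "N 0" "M 0" "\<xi> 0" \<nu> by (rule model)
      show ?thesis using l01[OF that] by (intro exists_quantile) auto
    qed
    then obtain s where s: "\<And>l. l \<in> ?L \<Longrightarrow> measure \<nu> {..s l} = real l / K" by metis
    define Z where "Z m = sample_model.emp_process (N m) (\<xi> m) s K" for m
    define Y where "Y p \<omega> = B (fst p) (real (snd p) / K) \<omega> / sqrt (w $ fst p)" for p \<omega>
    define J where "J = (UNIV :: 'k set) \<times> ?L"
    define h where "h u = cts_step x y (mesh_functional w a K u)" for u
    \<comment> \<open>\<open>random_vectors_convergence\<close> evaluates at vectors that vanish
      outside \<open>J\<close>; \<open>mesh_functional\<close> reads only coordinates in
      \<open>J\<close>, so padding leaves its value unchanged.\<close>
    define pad where "pad u = (\<lambda>p. if p \<in> J then u p else 0)" for u :: "'k \<times> nat \<Rightarrow> real"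
    have Zm: "Z m p \<in> borel_measurable (M m)" for m p
    proof -
      interpret sample_model w "N m" "M m" "\<xi> m" \<nu> by (rule model)
      show ?thesis unfolding Z_def by (rule emp_process_measurable)
    qed
    have Ym: "Y p \<in> borel_measurable P" if "p \<in> J" for p
    proof -
      have "real (snd p) / K \<in> {0..1}" using that l01[of "snd p"] by (auto simp: J_def)
      then show ?thesis unfolding Y_def[abs_def] by (intro borel_measurable_divide Br.B_measurable) auto
    qed
    have sumJ: "(\<Sum>p\<in>J. c p * f p) = (\<Sum>j\<in>UNIV. \<Sum>l\<in>?L. c (j, l) * f (j, l))" for c f :: "'k \<times> nat \<Rightarrow> real"
      unfolding J_def by (simp add: sum.cartesian_product)
    \<comment> \<open>Both sides refer to the same Gaussian value \<open>exp (- v / 2)\<close>: the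
      bridges attain it exactly, the empirical vectors up to an error of order
      \<open>1 / sqrt (n m)\<close>.\<close>
    have char: "(\<lambda>m. char (distr (M m) borel (\<lambda>\<omega>. \<Sum>p\<in>J. c p * Z m p \<omega>)) 1)
        \<longlonglongrightarrow> char (distr P borel (\<lambda>\<omega>. \<Sum>p\<in>J. c p * Y p \<omega>)) 1" for c
    proof -
      define v where "v = (\<Sum>j\<in>UNIV. \<Sum>l\<in>?L. \<Sum>l'\<in>?L. c (j, l) * c (j, l') / w $ j *
        (min (real l / K) (real l' / K) - real l / K * (real l' / K)))"
      define G where "G = (\<Sum>j\<in>UNIV. \<Sum>l\<in>?L. \<bar>c (j, l)\<bar>) * inv_weights"
      have lim: "char (distr P borel (\<lambda>\<omega>. \<Sum>p\<in>J. c p * Y p \<omega>)) 1 = complex_of_real (exp (- v / 2))"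
        unfolding sumJ Y_def fst_conv snd_conv v_def
        by (rule Br.bridge_linear_char) (use l01 K in \<open>auto simp: inj_on_def\<close>)
      have dist: "cmod (char (distr (M m) borel (\<lambda>\<omega>. \<Sum>p\<in>J. c p * Z m p \<omega>)) 1 - complex_of_real (exp (- v / 2)))
          \<le> G ^ 3 / 6 / sqrt (n m) + G ^ 4 / 8 * (1 / n m)" for m
      proof -
        interpret sample_model w "N m" "M m" "\<xi> m" \<nu> by (rule model)
        show ?thesis
          using emp_linear_char[where L="?L" and s=s and t="\<lambda>l. real l / K" and c="\<lambda>j l. c (j, l)", OF _ s] size[of m]
          unfolding sumJ Z_def emp_process_def fst_conv snd_conv v_def G_def by simp
      qed
      have "(\<lambda>m. char (distr (M m) borel (\<lambda>\<omega>. \<Sum>p\<in>J. c p * Z m p \<omega>)) 1 - complex_of_real (exp (- v / 2))) \<longlonglongrightarrow> 0"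
      proof (rule Lim_null_comparison)
        show "\<forall>\<^sub>F m in sequentially. norm (char (distr (M m) borel (\<lambda>\<omega>. \<Sum>p\<in>J. c p * Z m p \<omega>)) 1 - complex_of_real (exp (- v / 2)))
            \<le> G ^ 3 / 6 / sqrt (n m) + G ^ 4 / 8 * (1 / n m)"
          using dist by (intro always_eventually allI)
        have "(\<lambda>m. G ^ 3 / 6 / sqrt (n m) + G ^ 4 / 8 * (1 / n m)) \<longlonglongrightarrow> 0 + G ^ 4 / 8 * 0"
          by (intro tendsto_add tendsto_mult tendsto_const inv_sqrt inv_n)
        then show "(\<lambda>m. G ^ 3 / 6 / sqrt (n m) + G ^ 4 / 8 * (1 / n m)) \<longlonglongrightarrow> 0" by simp
      qed
      then show ?thesis unfolding lim by (simp add: LIM_zero_iff)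
    qed
    have fidi: "(\<lambda>m. LINT \<omega>|M m. h (pad (\<lambda>p. Z m p \<omega>))) \<longlonglongrightarrow> (LINT \<omega>|P. h (pad (\<lambda>p. Y p \<omega>)))"
      unfolding pad_def
    proof (rule random_vectors_convergence[OF M P])
      show "finite J" by (simp add: J_def)
      show "Z m p \<in> borel_measurable (M m)" if "p \<in> J" for m p by (rule Zm)
      show "Y p \<in> borel_measurable P" if "p \<in> J" for p by (rule Ym[OF that])
      fix c :: "'k \<times> nat \<Rightarrow> real"
      have VZ: "(\<lambda>\<omega>. \<Sum>p\<in>J. c p * Z m p \<omega>) \<in> borel_measurable (M m)" for m
        by (intro borel_measurable_sum borel_measurable_times borel_measurable_const Zm)
      have VY: "(\<lambda>\<omega>. \<Sum>p\<in>J. c p * Y p \<omega>) \<in> borel_measurable P"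
        by (intro borel_measurable_sum borel_measurable_times borel_measurable_const Ym)
      show "(\<lambda>m. LINT \<omega>|M m. cos (\<Sum>p\<in>J. c p * Z m p \<omega>)) \<longlonglongrightarrow> (LINT \<omega>|P. cos (\<Sum>p\<in>J. c p * Y p \<omega>))"
        unfolding prob_space.cos_sin_char(1)[OF M VZ] prob_space.cos_sin_char(1)[OF P VY]
        by (rule tendsto_Re[OF char])
      show "(\<lambda>m. LINT \<omega>|M m. sin (\<Sum>p\<in>J. c p * Z m p \<omega>)) \<longlonglongrightarrow> (LINT \<omega>|P. sin (\<Sum>p\<in>J. c p * Y p \<omega>))"
        unfolding prob_space.cos_sin_char(2)[OF M VZ] prob_space.cos_sin_char(2)[OF P VY]
        by (rule tendsto_Im[OF char])
    next
      fix m p assume p: "p \<in> J"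
      then have sp: "measure \<nu> {..s (snd p)} = real (snd p) / K" by (intro s) (auto simp: J_def)
      interpret sample_model w "N m" "M m" "\<xi> m" \<nu> by (rule model)
      show "integrable (M m) (\<lambda>\<omega>. (Z m p \<omega>)\<^sup>2) \<and> (LINT \<omega>|M m. (Z m p \<omega>)\<^sup>2) \<le> inv_weights"
        unfolding Z_def using emp_process_moment[where s=s, OF sp] by blast
    next
      fix p assume p: "p \<in> J"
      let ?t = "real (snd p) / K"
      have t: "?t \<in> {0<..<1}" using p by (intro l01) (auto simp: J_def)
      have sq: "(Y p \<omega>)\<^sup>2 = (B (fst p) ?t \<omega>)\<^sup>2 / w $ fst p" for \<omega>
        using weight_nonneg[of "fst p"] by (simp add: Y_def power_divide)
      have "(LINT \<omega>|P. (Y p \<omega>)\<^sup>2) = (?t - ?t * ?t) / w $ fst p"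
        unfolding sq using Br.B_cov[of ?t ?t "fst p"] t by (simp add: power2_eq_square)
      also have "\<dots> \<le> 1 / w $ fst p"
      proof (intro divide_right_mono weight_nonneg)
        have "0 \<le> ?t * ?t" by simp
        moreover have "?t \<le> 1" using t by simp
        ultimately show "?t - ?t * ?t \<le> 1" by linarith
      qed
      also have "\<dots> \<le> inv_weights" by (rule inv_weights_ge)
      finally show "integrable P (\<lambda>\<omega>. (Y p \<omega>)\<^sup>2) \<and> (LINT \<omega>|P. (Y p \<omega>)\<^sup>2) \<le> inv_weights"
        unfolding sq using Br.B_square_integrable[OF t] by simp
    next
      show "continuous_on UNIV h"
        unfolding h_def
        by (rule continuous_on_compose2[OF cts_step_continuous[OF xy] continuous_mesh_functional]) simp
      show "\<bar>h u\<bar> \<le> 1" for u unfolding h_def by (rule cts_step_bound[OF xy])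
    qed
    \<comment> \<open>The bound of \<open>test_statistic_approximation\<close>. As the sample size
      grows, only the mesh error remains, which is below \<open>e\<close> by the choice of the
      mesh.\<close>
    define D where "D m = 8 * ?k * a / K + (32 * inv_weights * (8 * ?k + 12 * inv_weights) / (?c\<^sup>2 * sqrt (n m))
      + cell_error ?k ?c (1 / K + 2 / sqrt (n m)))" for m
    have "D \<longlonglongrightarrow> 8 * ?k * a / K + (0 + cell_error ?k ?c (1 / K + 0))"
    proof -
      have "(\<lambda>m. 32 * inv_weights * (8 * ?k + 12 * inv_weights) / (?c\<^sup>2 * sqrt (n m)))
          = (\<lambda>m. 32 * inv_weights * (8 * ?k + 12 * inv_weights) / ?c\<^sup>2 / sqrt (n m))" by simp
      then have "(\<lambda>m. 32 * inv_weights * (8 * ?k + 12 * inv_weights) / (?c\<^sup>2 * sqrt (n m))) \<longlonglongrightarrow> 0"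
        by (simp only: inv_sqrt)
      then show ?thesis
        unfolding D_def[abs_def]
        by (intro tendsto_add tendsto_const cell_error_tendsto inv_sqrt)
    qed
    then have "\<forall>\<^sub>F m in sequentially. D m < e" using err by (intro order_tendstoD(2)) auto
    moreover have "\<forall>\<^sub>F m in sequentially. 1 / real (n m) < ?c"
      using a K by (intro order_tendstoD(2)[OF inv_n]) auto
    moreover have "\<forall>\<^sub>F m in sequentially. \<bar>(LINT \<omega>|M m. h (pad (\<lambda>p. Z m p \<omega>))) - (LINT \<omega>|P. h (pad (\<lambda>p. Y p \<omega>)))\<bar> < r / 4"
      using tendstoD[OF fidi, of "r / 4"] r by (simp add: dist_real_def)
    ultimately have ev: "\<forall>\<^sub>F m in sequentially.
        \<bar>(LINT \<omega>|M m. cts_step x y (T m \<omega>)) - (LINT \<omega>|P. cts_step x y (limit_variable w B \<omega>))\<bar> < r"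
    proof eventually_elim
      case (elim m)
      interpret sample_model w "N m" "M m" "\<xi> m" \<nu> by (rule model)
      have padJ: "mesh_functional w a K (pad u) = mesh_functional w a K u" for u
        unfolding mesh_functional_def pad_def J_def by (intro arg_cong2[where f="(/)"] sum.cong refl) simp
      have hZ: "mesh_functional w a K (pad (\<lambda>p. Z m p \<omega>))
          = (\<Sum>l=a..<K - a. iso_dev (sqrt (n m) *\<^sub>R emp (s l) \<omega>) / (real l / K * (1 - real l / K))) / K" for \<omega>
        unfolding padJ unfolding mesh_functional_def Z_def iso_dev_emp_process size ..
      have hY: "mesh_functional w a K (pad (\<lambda>p. Y p \<omega>))
          = (\<Sum>l=a..<K - a. iso_dev (Br.scaled (real l / K) \<omega>) / (real l / K * (1 - real l / K))) / K" for \<omega>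
        unfolding padJ unfolding mesh_functional_def Y_def Br.scaled_def by simp
      have padm: "(\<lambda>\<omega>. mesh_functional w a K (pad (\<lambda>p. f p \<omega>))) \<in> borel_measurable Q"
        if f: "\<And>p. p \<in> J \<Longrightarrow> f p \<in> borel_measurable Q" for f :: "'k \<times> nat \<Rightarrow> 'c \<Rightarrow> real" and Q
        unfolding padJ unfolding mesh_functional_def
      proof (intro borel_measurable_divide borel_measurable_sum borel_measurable_const)
        fix l assume "l \<in> {a..<K - a}"
        then have "(\<lambda>\<omega>. \<chi> j. f (j, l) \<omega>) \<in> borel_measurable Q"
          by (intro borel_measurable_vec_lambda f) (simp add: J_def)
        from measurable_compose[OF this measurable_iso_dev]
        show "(\<lambda>\<omega>. iso_dev (\<chi> j. f (j, l) \<omega>)) \<in> borel_measurable Q" .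
      qed
      have D0: "0 \<le> D m"
        unfolding D_def cell_error_def using inv_weights_nonneg by (intro add_nonneg_nonneg divide_nonneg_nonneg mult_nonneg_nonneg) auto
      have "\<bar>(LINT \<omega>|M m. cts_step x y (T m \<omega>)) - (LINT \<omega>|M m. h (pad (\<lambda>p. Z m p \<omega>)))\<bar> \<le> D m / (y - x)"
        unfolding h_def
      proof (rule cts_step_close[OF Tm padm D0 _ xy])
        show "Z m p \<in> borel_measurable (M m)" for p by (rule Zm)
        show "(\<integral>\<^sup>+\<omega>. ennreal \<bar>T m \<omega> - mesh_functional w a K (pad (\<lambda>p. Z m p \<omega>))\<bar> \<partial>M m) \<le> ennreal (D m)"
          using test_statistic_approximation[OF a _ s] elim(2)
          unfolding hZ D_def T_def size \<xi>_def by simp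
      qed
      also have "\<dots> \<le> e / (y - x)" using elim(1) xy by (intro divide_right_mono) auto
      finally have 1: "\<bar>(LINT \<omega>|M m. cts_step x y (T m \<omega>)) - (LINT \<omega>|M m. h (pad (\<lambda>p. Z m p \<omega>)))\<bar> \<le> r / 4"
        by (simp only: e(2))
      have "\<bar>(LINT \<omega>|P. cts_step x y (limit_variable w B \<omega>)) - (LINT \<omega>|P. h (pad (\<lambda>p. Y p \<omega>)))\<bar> \<le> e / (y - x)"
        unfolding h_def
      proof (rule prob_space.cts_step_close[OF P Br.limit_variable_measurable padm _ _ xy])
        show "Y p \<in> borel_measurable P" if "p \<in> J" for p by (rule Ym[OF that])
        show "0 \<le> e" using e by simp
        have "2 * ?k * a / K \<le> 8 * ?k * a / K" by (intro divide_right_mono mult_right_mono) auto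
        then have "2 * ?k * a / K + cell_error ?k ?c (1 / K) \<le> e" using err by linarith
        then show "(\<integral>\<^sup>+\<omega>. ennreal \<bar>limit_variable w B \<omega> - mesh_functional w a K (pad (\<lambda>p. Y p \<omega>))\<bar> \<partial>P) \<le> ennreal e"
          unfolding hY by (intro order_trans[OF Br.limit_variable_approximation[OF a]] ennreal_leI)
      qed
      then have 2: "\<bar>(LINT \<omega>|P. cts_step x y (limit_variable w B \<omega>)) - (LINT \<omega>|P. h (pad (\<lambda>p. Y p \<omega>)))\<bar> \<le> r / 4"
        by (simp only: e(2))
      show ?case using 1 2 elim(3) r by linarith
    qed
    then show "\<exists>no. \<forall>m\<ge>no. norm ((LINT \<omega>|M m. cts_step x y (T m \<omega>)) - (LINT \<omega>|P. cts_step x y (limit_variable w B \<omega>))) < r"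
      by (simp add: eventually_sequentially)
  qed
  then have "(\<lambda>m. integral\<^sup>L (distr (M m) borel (T m)) (cts_step x y)) \<longlonglongrightarrow> integral\<^sup>L (distr P borel (limit_variable w B)) (cts_step x y)"
    if "x < y" for x y
    using that Tm Br.limit_variable_measurable by (simp add: integral_distr measurable_cts_step)
  then have "weak_conv_m (\<lambda>m. distr (M m) borel (T m)) (distr P borel (limit_variable w B))"
    by (intro integral_cts_step_conv_imp_weak_conv prob_space.real_distribution_distr M Tm P Br.limit_variable_measurable)
  then show ?thesis by (simp add: T_def[abs_def])
qed

end
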